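(* Let $M$ be a smooth $n$-dimensional hypersurface of $\mathbb{R}^{n+1}$ with $n\geq 2$, let $r>0$, and let $B_r=B_r(0)\subset\mathbb{R}^{n+1}$ be the open ball of radius $r$ centered at the origin. Then for every $\varphi\in C^1_c(B_r\cap M)$, \[ \frac{(n-2)^2}{4}\int_M\frac{\varphi^2}{|x|^2}\,dV+\frac{n^2-4}{4}\int_M\left(\frac{x}{|x|}\cdot\nu_M\right)^2\frac{\varphi^2}{|x|^2}\,dV+\frac{1}{2r^2}\int_M\varphi^2\,dV \leq \int_M\left(|\nabla_T\varphi|^2+\frac{n-2}{2}\,\frac{|H|\varphi^2}{|x|}+\frac14|H\varphi|^2\right)dV. \]
   Context: $x$ denotes the position vector in $\mathbb{R}^{n+1}$ and $|x|$ its Euclidean norm; $dV$ is the $n$-dimensional volume measure on $M$. $\nu_M$ is a unit normal vector field to $M$. $C^1_c(B_r\cap M)$ denotes $C^1$ functions with compact support in $B_r\cap M$. The tangential gradient is $\nabla_T\varphi=\nabla\varphi-(\nabla\varphi\cdot\nu_M)\nu_M$. $H$ is the mean curvature of $M$, the sum of principal curvatures, i.e. $H=\operatorname{div}_T\nu_M$. *)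

theory Defs
  imports "HOL-Analysis.Analysis"
begin

fun Ck_on :: "nat \<Rightarrow> 'a::euclidean_space set \<Rightarrow> ('a \<Rightarrow> real) \<Rightarrow> bool" where
  "Ck_on 0 U f = continuous_on U f"
| "Ck_on (Suc k) U f =
     ((\<forall>x\<in>U. f differentiable (at x)) \<and>
      (\<forall>b\<in>Basis. Ck_on k U (\<lambda>x. frechet_derivative f (at x) b)))"

definition smooth_on :: "'a::euclidean_space set \<Rightarrow> ('a \<Rightarrow> real) \<Rightarrow> bool" where
  "smooth_on U f \<longleftrightarrow> (\<forall>k. Ck_on k U f)"

definition grad :: "('a::euclidean_space \<Rightarrow> real) \<Rightarrow> 'a \<Rightarrow> 'a" where
  "grad f x = (\<Sum>b\<in>Basis. frechet_derivative f (at x) b *\<^sub>R b)"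

definition smooth_hypersurface :: "'a::euclidean_space set \<Rightarrow> bool" where
  "smooth_hypersurface M \<longleftrightarrow>
     (\<forall>p\<in>M. \<exists>U f. open U \<and> p \<in> U \<and> smooth_on U f \<and>
        (\<forall>x\<in>U. grad f x \<noteq> 0) \<and> M \<inter> U = {x\<in>U. f x = 0})"

definition tangent_space :: "'a::euclidean_space set \<Rightarrow> 'a \<Rightarrow> 'a set" where
  "tangent_space M p = {v. \<exists>\<gamma> (e::real). e > 0 \<and> (\<forall>t\<in>{-e<..<e}. \<gamma> t \<in> M) \<and> \<gamma> 0 = p \<and>
                            (\<gamma> has_vector_derivative v) (at 0)}"

definition unit_normal_field :: "'a::euclidean_space set \<Rightarrow> ('a \<Rightarrow> 'a) \<Rightarrow> bool" where
  "unit_normal_field M \<nu> \<longleftrightarrow> continuous_on M \<nu> \<and>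
     (\<forall>p\<in>M. norm (\<nu> p) = 1 \<and> (\<forall>v\<in>tangent_space M p. \<nu> p \<bullet> v = 0))"

definition tproj :: "('a::euclidean_space \<Rightarrow> 'a) \<Rightarrow> 'a \<Rightarrow> 'a \<Rightarrow> 'a" where
  "tproj \<nu> p v = v - (v \<bullet> \<nu> p) *\<^sub>R \<nu> p"

definition tgrad :: "('a::euclidean_space \<Rightarrow> 'a) \<Rightarrow> ('a \<Rightarrow> real) \<Rightarrow> 'a \<Rightarrow> 'a" where
  "tgrad \<nu> \<phi> x = grad \<phi> x - (grad \<phi> x \<bullet> \<nu> x) *\<^sub>R \<nu> x"

text \<open>Mean curvature H = div_T nu (trace of the tangential derivative of nu along M).\<close>
definition mean_curv :: "'a::euclidean_space set \<Rightarrow> ('a \<Rightarrow> 'a) \<Rightarrow> 'a \<Rightarrow> real" where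
  "mean_curv M \<nu> p =
     (\<Sum>b\<in>Basis. frechet_derivative \<nu> (at p within M) (tproj \<nu> p b) \<bullet> tproj \<nu> p b)"

definition hausdorff_pre :: "nat \<Rightarrow> real \<Rightarrow> 'a::metric_space set \<Rightarrow> ennreal" where
  "hausdorff_pre d \<delta> S =
     (INF C \<in> {C::nat \<Rightarrow> 'a set. S \<subseteq> (\<Union>i. C i) \<and> (\<forall>i. bounded (C i) \<and> diameter (C i) \<le> \<delta>)}.
        (\<Sum>i. ennreal (unit_ball_vol (real d) / 2 ^ d * diameter (C i) ^ d)))"

definition hausdorff_outer :: "nat \<Rightarrow> 'a::metric_space set \<Rightarrow> ennreal" where
  "hausdorff_outer d S = (SUP \<delta> \<in> {0<..}. hausdorff_pre d \<delta> S)"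

definition hausdorff_measure :: "nat \<Rightarrow> 'a::metric_space measure" where
  "hausdorff_measure d = measure_of UNIV (sets borel) (hausdorff_outer d)"

end

theory Submission
  imports Defs
begin

text \<open>
  Let \<open>a = (n - 2) / 2\<close>. The divergence theorem for the vector field
  \<open>\<phi>\<^sup>2 (a / (|x|\<^sup>2 + \<epsilon>) + 1 / r\<^sup>2) x\<close>, combined with completing the square
  \<open>|\<nabla>\<^sub>T \<phi> + \<phi> w x\<^sub>T|\<^sup>2 \<ge> 0\<close> for \<open>w = a / (|x|\<^sup>2 + \<epsilon>) + 1 / r\<^sup>2\<close>, gives the inequality with
  regularised weights; \<open>\<epsilon> \<rightarrow> 0\<close> by Fatou's lemma.

  The divergence theorem is linear in the measure, so the normalisation of Hausdorff measure is
  irrelevant: if the outer measure is not additive on Borel sets the measure of the statement is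
  zero; otherwise, on hyperplanes it is a constant multiple of Lebesgue measure by uniqueness of
  Haar measure, and the area formula in graph coordinates follows since a \<open>C\<^sup>1\<close> surface is locally
  \<open>(1 \<plusminus> \<eta>)\<close>-bilipschitz to its tangent plane. Instead of integrating over \<open>n\<close>-dimensional
  space, functions on the graph are extended constantly along a coordinate direction \<open>e\<close> and
  integrated over the slab \<open>0 \<le> z \<bullet> e < 1\<close> of the ambient space.
\<close>

section \<open>Hausdorff outer measure\<close>

text \<open>For a hyperplane through the origin and w = t / |x|^2, the completed square leaves the
  weight ((n - 2) t - t^2) / |x|^2. Its maximum is at t = (n - 2) / 2, which explains a and the
  constant (n - 2)^2 / 4. On a general M the normal part s = x \<bullet> \<nu> shortens the
  tangential part of x to |x|^2 - s^2, and what this saves is the second weight, with a (a + 2) =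
  (n^2 - 4) / 4. The summand c = 1 / r^2 of w contributes at least 2 c - c^2 |x|^2, hence at least c
  on the ball. Curvature enters through H s w: its part with a is bounded by a |H| / |x|, its part
  with c by H^2 / 4 + c^2 s^2, and c^2 s^2 completes c^2 |x_T|^2 to c^2 |x|^2. The regularisation is
  there because M may pass through the origin, where the singular field is not C^1.

  In a chart the divergence theorem becomes one identity: for a tangential field V with normal N,
  the flat divergence of V / (N \<bullet> e), extended constantly along e, is div_T V / (N \<bullet>
  e). The denominator is the area element of the graph up to sign, so the surface integral turns
  into integrals of partial derivatives.\<close>

lemma hausdorff_pre_lipschitz:
  fixes f :: "'a::real_normed_vector \<Rightarrow> 'b::real_normed_vector"
  assumes lip: "\<And>x y. x \<in> S \<Longrightarrow> y \<in> S \<Longrightarrow> norm (f x - f y) \<le> L * norm (x - y)" and L: "L > 0"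
  shows "hausdorff_pre d (L * \<delta>) (f ` S) \<le> ennreal (L ^ d) * hausdorff_pre d \<delta> S"
proof -
  let ?k = "unit_ball_vol (real d) / 2 ^ d"
  have k0: "?k \<ge> 0" by simp
  have key: "hausdorff_pre d (L * \<delta>) (f ` S) \<le> ennreal (L ^ d) * (\<Sum>i. ennreal (?k * diameter (C i) ^ d))"
    if C: "S \<subseteq> (\<Union>i. C i)" "\<And>i. bounded (C i) \<and> diameter (C i) \<le> \<delta>" for C :: "nat \<Rightarrow> 'a set"
  proof -
    \<comment> \<open>Traces on \<open>S\<close> are taken because the Lipschitz bound is known only
      there.\<close>
    define D where "D i = f ` (S \<inter> C i)" for i
    have nb: "norm (f x - f y) \<le> L * diameter (C i)" if "x \<in> S \<inter> C i" "y \<in> S \<inter> C i" for x y i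
    proof -
      have "norm (f x - f y) \<le> L * norm (x - y)" using lip that by auto
      also have "norm (x - y) \<le> diameter (C i)"
        using diameter_bounded_bound[of "C i" x y] C(2) that by (auto simp: dist_norm)
      finally show ?thesis using L by simp
    qed
    have dn: "0 \<le> diameter (C i)" for i using C(2) diameter_ge_0 by auto
    have dd: "diameter (D i) \<le> L * diameter (C i)" for i
      by (rule diameter_le) (use nb L dn in \<open>auto simp: D_def\<close>)
    have bd: "bounded (D i)" for i
      unfolding bounded_two_points using nb by (auto simp: D_def dist_norm)
    have "hausdorff_pre d (L * \<delta>) (f ` S) \<le> (\<Sum>i. ennreal (?k * diameter (D i) ^ d))"
      unfolding hausdorff_pre_def
    proof (rule INF_lower, intro CollectI conjI allI)
      show "f ` S \<subseteq> (\<Union>i. D i)" using C(1) by (force simp: D_def)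
      show "bounded (D i)" for i by (rule bd)
      show "diameter (D i) \<le> L * \<delta>" for i
        using dd[of i] C(2)[of i] L by (meson mult_le_cancel_left_pos order_trans)
    qed
    also have "\<dots> \<le> (\<Sum>i. ennreal (L ^ d) * ennreal (?k * diameter (C i) ^ d))"
    proof (rule suminf_le)
      fix i
      have "?k * diameter (D i) ^ d \<le> ?k * (L * diameter (C i)) ^ d"
        using dd bd k0 by (intro mult_left_mono power_mono) (auto simp: diameter_ge_0)
      then show "ennreal (?k * diameter (D i) ^ d) \<le> ennreal (L ^ d) * ennreal (?k * diameter (C i) ^ d)"
        using L k0 dn[of i] by (subst ennreal_mult[symmetric]) (auto simp: power_mult_distrib mult_ac intro!: ennreal_leI)
    qed auto
    finally show ?thesis by simp
  qed
  have Ld: "ennreal (L ^ d) \<noteq> 0" "ennreal (L ^ d) \<noteq> \<infinity>" using L by auto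
  \<comment> \<open>Division by \<open>L ^ d\<close> leaves the bare infimum over covers on the
    right, so \<open>key\<close> can be applied to one cover at a time.\<close>
  have "hausdorff_pre d (L * \<delta>) (f ` S) / ennreal (L ^ d) \<le> hausdorff_pre d \<delta> S"
    unfolding hausdorff_pre_def[of d \<delta> S]
  proof (rule INF_greatest, clarsimp)
    fix C :: "nat \<Rightarrow> 'a set"
    assume "S \<subseteq> (\<Union>i. C i)" "\<forall>i. bounded (C i) \<and> diameter (C i) \<le> \<delta>"
    from key[OF this(1) this(2)[rule_format]]
    show "hausdorff_pre d (L * \<delta>) (f ` S) / ennreal (L ^ d) \<le> (\<Sum>i. ennreal (unit_ball_vol (real d) * diameter (C i) ^ d / 2 ^ d))"
      using Ld L by (intro divide_le_posI_ennreal) (auto simp: mult_ac)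
  qed
  then have "hausdorff_pre d (L * \<delta>) (f ` S) / ennreal (L ^ d) * ennreal (L ^ d) \<le> hausdorff_pre d \<delta> S * ennreal (L ^ d)"
    by (rule mult_right_mono) simp
  also have "hausdorff_pre d (L * \<delta>) (f ` S) / ennreal (L ^ d) * ennreal (L ^ d) = hausdorff_pre d (L * \<delta>) (f ` S)"
    using Ld by (simp add: ennreal_divide_times)
  finally show ?thesis by (simp add: mult.commute)
qed

lemma hausdorff_outer_lipschitz:
  fixes f :: "'a::real_normed_vector \<Rightarrow> 'b::real_normed_vector"
  assumes lip: "\<And>x y. x \<in> S \<Longrightarrow> y \<in> S \<Longrightarrow> norm (f x - f y) \<le> L * norm (x - y)" and L: "L > 0"
  shows "hausdorff_outer d (f ` S) \<le> ennreal (L ^ d) * hausdorff_outer d S"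
  unfolding hausdorff_outer_def[of d "f ` S"]
proof (rule SUP_least)
  fix \<delta> :: real assume "\<delta> \<in> {0<..}"
  then have "\<delta> / L \<in> {0<..}" using L by simp
  then have "hausdorff_pre d (\<delta> / L) S \<le> hausdorff_outer d S"
    unfolding hausdorff_outer_def by (rule SUP_upper)
  moreover have "hausdorff_pre d \<delta> (f ` S) \<le> ennreal (L ^ d) * hausdorff_pre d (\<delta> / L) S"
    using hausdorff_pre_lipschitz[OF lip L, where \<delta>="\<delta>/L" and d=d and S=S] L by simp
  ultimately show "hausdorff_pre d \<delta> (f ` S) \<le> ennreal (L ^ d) * hausdorff_outer d S"
    by (meson mult_left_mono order_trans zero_le)
qed

lemma hausdorff_outer_isometry:
  fixes f :: "'a::real_normed_vector \<Rightarrow> 'b::real_normed_vector"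
  assumes iso: "\<And>x y. x \<in> S \<Longrightarrow> y \<in> S \<Longrightarrow> norm (f x - f y) = norm (x - y)"
  shows "hausdorff_outer d (f ` S) = hausdorff_outer d S"
proof (rule antisym)
  show "hausdorff_outer d (f ` S) \<le> hausdorff_outer d S"
    using hausdorff_outer_lipschitz[of S f 1 d] iso by simp
  have inj: "inj_on f S"
    by (rule inj_onI) (metis iso norm_eq_zero right_minus_eq)
  have "hausdorff_outer d (inv_into S f ` f ` S) \<le> ennreal (1 ^ d) * hausdorff_outer d (f ` S)"
    by (rule hausdorff_outer_lipschitz) (auto simp: inv_into_f_f inj iso)
  then show "hausdorff_outer d S \<le> hausdorff_outer d (f ` S)"
    using inj by (simp add: inv_into_image_cancel)
qed

text \<open>A grid of mesh 2R/N has N^d cells of diameter of order R/N, so N cancels from the sum of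
  d-th powers and the bound does not depend on \<delta>.\<close>

lemma hausdorff_outer_cube_finite:
  fixes e :: "'a::euclidean_space"
  assumes e: "e \<in> Basis" and d: "d = DIM('a) - 1" "d > 0" and R: "R > 0"
  shows "hausdorff_outer d {x::'a. x \<bullet> e = 0 \<and> (\<forall>b\<in>Basis. \<bar>x \<bullet> b\<bar> \<le> R)} < \<infinity>"
proof -
  let ?k = "unit_ball_vol (real d) / 2 ^ d" and ?S = "{x::'a. x \<bullet> e = 0 \<and> (\<forall>b\<in>Basis. \<bar>x \<bullet> b\<bar> \<le> R)}"
  let ?D = "DIM('a) * (2 * R)"
  have k0: "?k \<ge> 0" by simp
  have D0: "?D > 0" using R by simp
  have "hausdorff_pre d \<delta> ?S \<le> ennreal (?k * ?D ^ d)" if \<delta>: "\<delta> > 0" for \<delta>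
  proof -
    obtain N :: nat where N: "N > 0" "?D / real N \<le> \<delta>"
    proof -
      obtain N :: nat where "?D / \<delta> < real N" using reals_Archimedean2 by blast
      then show ?thesis using that[of N] \<delta> D0
        by (smt (verit) divide_less_eq divide_pos_pos mult.commute of_nat_0_less_iff)
    qed
    define F where "F = PiE (Basis - {e}) (\<lambda>_. {..<N})"
    have cF: "card F = N ^ d" "finite F"
      using e d unfolding F_def by (auto simp: card_PiE card_Diff_singleton intro!: finite_PiE)
    obtain h where h: "bij_betw h {0..<card F} F" using ex_bij_betw_nat_finite[OF cF(2)] by blast
    define cell where "cell p = {x::'a. x \<bullet> e = 0 \<and> (\<forall>b\<in>Basis - {e}. - R + 2 * R / N * p b \<le> x \<bullet> b \<and> x \<bullet> b \<le> - R + 2 * R / N * p b + 2 * R / N)}" for p :: "'a \<Rightarrow> nat"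
    \<comment> \<open>The padding by empty sets adds nothing because d > 0; for d = 0 each of them
      would count as 0^0 = 1.\<close>
    define C where "C i = (if i < card F then cell (h i) else {})" for i
    have nb: "norm (x - y) \<le> ?D / N" if "x \<in> cell p" "y \<in> cell p" for x y p
    proof -
      have "norm (x - y) \<le> (\<Sum>b\<in>Basis. \<bar>(x - y) \<bullet> b\<bar>)" by (rule norm_le_l1)
      also have "\<dots> \<le> (\<Sum>b\<in>(Basis::'a set). 2 * R / N)"
      proof (rule sum_mono)
        fix b :: 'a assume b: "b \<in> Basis"
        show "\<bar>(x - y) \<bullet> b\<bar> \<le> 2 * R / N"
        proof (cases "b = e")
          case True then show ?thesis using that R by (simp add: cell_def inner_diff_left)
        next
          case False
          then have "- R + 2 * R / N * p b \<le> x \<bullet> b \<and> x \<bullet> b \<le> - R + 2 * R / N * p b + 2 * R / N"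
            "- R + 2 * R / N * p b \<le> y \<bullet> b \<and> y \<bullet> b \<le> - R + 2 * R / N * p b + 2 * R / N"
            using that b by (auto simp: cell_def)
          then show ?thesis by (auto simp: inner_diff_left abs_le_iff)
        qed
      qed
      finally show ?thesis by (simp add: field_simps)
    qed
    have bC: "bounded (C i)" for i
      unfolding bounded_two_points C_def using nb by (auto simp: dist_norm)
    have dC: "diameter (C i) \<le> ?D / N" for i
      by (rule diameter_le) (use nb D0 in \<open>auto simp: C_def split: if_splits\<close>)
    have cover: "?S \<subseteq> (\<Union>i. C i)"
    proof
      fix x assume x: "x \<in> ?S"
      \<comment> \<open>On the face x \<bullet> b = R the floor is N; the minimum with N - 1 assigns
        these points to the last cell.\<close>
      define p where "p = (\<lambda>b\<in>Basis - {e}. min (N - 1) (nat \<lfloor>(x \<bullet> b + R) * N / (2 * R)\<rfloor>))"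
      have pF: "p \<in> F" unfolding F_def p_def using N by (auto simp: restrict_PiE_iff)
      have "x \<in> cell p"
        unfolding cell_def
      proof (intro CollectI conjI ballI)
        show "x \<bullet> e = 0" using x by simp
        fix b assume b: "b \<in> Basis - {e}"
        define t where "t = (x \<bullet> b + R) * N / (2 * R)"
        have xb: "x \<bullet> b = - R + 2 * R / N * t" using R N by (simp add: t_def field_simps)
        have "- R \<le> x \<bullet> b" "x \<bullet> b \<le> R" using x b by (auto simp: abs_le_iff)
        then have "0 \<le> (x \<bullet> b + R) * N" "(x \<bullet> b + R) * N \<le> (2 * R) * N"
          by (intro mult_nonneg_nonneg mult_right_mono; simp)+
        then have t0: "0 \<le> t" "t \<le> N" using R by (auto simp: t_def divide_le_eq mult_ac)
        have pb: "p b = min (N - 1) (nat \<lfloor>t\<rfloor>)" using b by (simp add: p_def t_def)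
        have 1: "real (p b) \<le> t" using t0 pb by linarith
        have 2: "t \<le> real (p b) + 1"
        proof (cases "nat \<lfloor>t\<rfloor> \<le> N - 1")
          case True then show ?thesis using pb t0 by linarith
        next
          case False then show ?thesis using pb t0 N by linarith
        qed
        have RN: "0 \<le> 2 * R / N" using R by simp
        show "- R + 2 * R / N * p b \<le> x \<bullet> b"
          unfolding xb using mult_left_mono[OF 1 RN] by linarith
        show "x \<bullet> b \<le> - R + 2 * R / N * p b + 2 * R / N"
          unfolding xb using mult_left_mono[OF 2 RN] by (simp only: distrib_left mult_1_right)
      qed
      moreover obtain i where "i < card F" "h i = p" using h pF
        by (metis atLeastLessThan_iff bij_betw_iff_bijections)
      ultimately show "x \<in> (\<Union>i. C i)" by (auto simp: C_def intro!: exI[of _ i])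
    qed
    have "hausdorff_pre d \<delta> ?S \<le> (\<Sum>i. ennreal (?k * diameter (C i) ^ d))"
      unfolding hausdorff_pre_def
      by (rule INF_lower) (use cover bC dC N(2) order_trans in blast)
    also have "\<dots> = (\<Sum>i\<in>{..<card F}. ennreal (?k * diameter (C i) ^ d))"
      by (rule suminf_finite) (use d in \<open>auto simp: C_def\<close>)
    also have "\<dots> \<le> (\<Sum>i\<in>{..<card F}. ennreal (?k * (?D / N) ^ d))"
      using dC bC k0 by (intro sum_mono ennreal_leI mult_left_mono power_mono) (auto simp: diameter_ge_0)
    also have "\<dots> = ennreal (real (N ^ d) * (?k * (?D / N) ^ d))"
      using cF k0 D0 by (subst ennreal_mult) (auto simp: ennreal_of_nat_eq_real_of_nat simp del: of_nat_power)
    also have "real (N ^ d) * (?k * (?D / N) ^ d) = ?k * ?D ^ d"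
      using N by (simp add: power_divide)
    finally show ?thesis .
  qed
  then have "hausdorff_outer d ?S \<le> ennreal (?k * ?D ^ d)"
    unfolding hausdorff_outer_def by (intro SUP_least) auto
  then show ?thesis by (simp add: le_less_trans)
qed

section \<open>Haar uniqueness and Lebesgue measure\<close>

lemma sigma_finite_if_finite_on_balls:
  fixes M :: "'a::euclidean_space measure"
  assumes "sets M = sets borel" "\<And>n::nat. emeasure M (cball 0 n) < \<infinity>"
  shows "sigma_finite_measure M"
proof
  show "\<exists>A. countable A \<and> A \<subseteq> sets M \<and> \<Union>A = space M \<and> (\<forall>a\<in>A. emeasure M a \<noteq> \<infinity>)"
  proof (intro exI conjI)
    let ?A = "range (\<lambda>n::nat. cball (0::'a) (real n))"
    show "countable ?A" by simp
    show "?A \<subseteq> sets M" using assms by auto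
    have "space M = UNIV" using sets_eq_imp_space_eq[OF assms(1)] by simp
    then show "\<Union>?A = space M" by (auto simp: real_arch_simple)
    show "\<forall>a\<in>?A. emeasure M a \<noteq> \<infinity>" using assms(2) by (auto simp: less_top)
  qed
qed

text \<open>Weil's Fubini argument: both sides equal the
  \<open>\<kappa>1 \<times> \<kappa>2\<close>-measure of \<open>{(x, y). x + y \<in> A, y \<in> B}\<close>.\<close>

lemma haar_unique:
  fixes \<kappa>1 \<kappa>2 :: "'a::euclidean_space measure"
  assumes sets: "sets \<kappa>1 = sets borel" "sets \<kappa>2 = sets borel"
    and sf: "sigma_finite_measure \<kappa>1" "sigma_finite_measure \<kappa>2"
    and T: "T \<in> sets borel" "\<And>x. x \<in> T \<Longrightarrow> - x \<in> T" "AE x in \<kappa>1. x \<in> T" "AE x in \<kappa>2. x \<in> T"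
    and inv1: "\<And>a. a \<in> T \<Longrightarrow> distr \<kappa>1 borel ((+) a) = \<kappa>1"
    and inv2: "\<And>a. a \<in> T \<Longrightarrow> distr \<kappa>2 borel ((+) a) = \<kappa>2"
    and A: "A \<in> sets borel" and B: "B \<in> sets borel" "\<And>x. x \<in> B \<longleftrightarrow> - x \<in> B"
  shows "emeasure \<kappa>1 A * emeasure \<kappa>2 B = emeasure \<kappa>2 A * emeasure \<kappa>1 B"
proof -
  interpret pair_sigma_finite \<kappa>1 \<kappa>2 using sf by (simp add: pair_sigma_finite_def)
  note [measurable_cong] = sets
  note [measurable] = A B(1) T(1)
  \<comment> \<open>Only shifts by elements of \<open>T\<close> are available, and \<open>T\<close>
    carries both measures. With \<open>T\<close> a hyperplane this covers measures that are singular
    in the ambient space.\<close>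
  have sh1: "(\<integral>\<^sup>+x. f (a + x) \<partial>\<kappa>1) = (\<integral>\<^sup>+x. f x \<partial>\<kappa>1)" if "a \<in> T" "f \<in> borel_measurable borel" for f :: "'a \<Rightarrow> ennreal" and a
    by (subst (2) inv1[OF that(1), symmetric], subst nn_integral_distr) (use that in auto)
  have sh2: "(\<integral>\<^sup>+x. f (a + x) \<partial>\<kappa>2) = (\<integral>\<^sup>+x. f x \<partial>\<kappa>2)" if "a \<in> T" "f \<in> borel_measurable borel" for f :: "'a \<Rightarrow> ennreal" and a
    by (subst (2) inv2[OF that(1), symmetric], subst nn_integral_distr) (use that in auto)
  have "emeasure \<kappa>1 A * emeasure \<kappa>2 B = (\<integral>\<^sup>+y. (\<integral>\<^sup>+x. indicator A x * indicator B y \<partial>\<kappa>1) \<partial>\<kappa>2)"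
    by (simp add: nn_integral_multc nn_integral_cmult)
  also have "\<dots> = (\<integral>\<^sup>+y. (\<integral>\<^sup>+x. indicator A (y + x) * indicator B y \<partial>\<kappa>1) \<partial>\<kappa>2)"
    using T(4) by (intro nn_integral_cong_AE, eventually_elim)
      (simp add: nn_integral_multc sh1[where f="indicator A"])
  also have "\<dots> = (\<integral>\<^sup>+x. (\<integral>\<^sup>+y. indicator A (y + x) * indicator B y \<partial>\<kappa>2) \<partial>\<kappa>1)"
    by (rule Fubini') measurable
  also have "\<dots> = (\<integral>\<^sup>+x. (\<integral>\<^sup>+y. indicator A y * indicator B (y - x) \<partial>\<kappa>2) \<partial>\<kappa>1)"
    using T(3)
  proof (intro nn_integral_cong_AE, eventually_elim)
    fix x assume x: "x \<in> T"
    show "(\<integral>\<^sup>+y. indicator A (y + x) * indicator B y \<partial>\<kappa>2) = (\<integral>\<^sup>+y. indicator A y * indicator B (y - x) \<partial>\<kappa>2)"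
      using sh2[OF x, of "\<lambda>y. indicator A y * indicator B (y - x)"] by (simp add: add.commute)
  qed
  also have "\<dots> = (\<integral>\<^sup>+y. (\<integral>\<^sup>+x. indicator A y * indicator B (y - x) \<partial>\<kappa>1) \<partial>\<kappa>2)"
    by (rule Fubini'[symmetric]) measurable
  also have "\<dots> = (\<integral>\<^sup>+y. indicator A y * emeasure \<kappa>1 B \<partial>\<kappa>2)"
    using T(4)
  proof (intro nn_integral_cong_AE, eventually_elim)
    fix y assume y: "y \<in> T"
    \<comment> \<open>The symmetry of \<open>B\<close> turns a reflected translate into a translate,
      to which invariance applies.\<close>
    have "indicator B (y - x) = (indicator B (- y + x) :: ennreal)" for x
      using B(2)[of "y - x"] by (simp add: indicator_def)
    then show "(\<integral>\<^sup>+x. indicator A y * indicator B (y - x) \<partial>\<kappa>1) = indicator A y * emeasure \<kappa>1 B"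
      using sh1[OF T(2)[OF y], of "indicator B"] by (simp add: nn_integral_cmult)
  qed
  finally show ?thesis by (simp add: nn_integral_multc)
qed

text \<open>The image of Lebesgue measure under \<open>S\<close> is again translation invariant, so
  by Haar uniqueness it is proportional to Lebesgue measure; the unit ball serves as the test set.
  Cross-multiplication states the proportion without a quotient in \<open>ennreal\<close>.\<close>

lemma lborel_linear_bij:
  fixes S S' :: "'a::euclidean_space \<Rightarrow> 'a"
  assumes S: "linear S" "\<And>x. S (S' x) = x" "\<And>x. S' (S x) = x" and A: "A \<in> sets borel"
  shows "emeasure lborel (S -` A) * emeasure lborel (cball 0 1 :: 'a set)
       = emeasure lborel A * emeasure lborel (S -` cball 0 1)"
proof -
  have S': "linear S'"
  proof (rule linearI)
    show "S' (x + y) = S' x + S' y" for x y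
      using S(3)[of "S' x + S' y"] linear_add[OF S(1), of "S' x" "S' y"] S(2) by simp
    show "S' (c *\<^sub>R x) = c *\<^sub>R S' x" for c x
      using S(3)[of "c *\<^sub>R S' x"] linear_scale[OF S(1), of c "S' x"] S(2) by simp
  qed
  note [measurable] = borel_measurable_continuous_onI[OF linear_continuous_on[OF linear_conv_bounded_linear[THEN iffD1, OF S(1)]]]
  have em: "emeasure (distr lborel borel S) A = emeasure lborel (S -` A)" if "A \<in> sets borel" for A
    using that by (subst emeasure_distr) auto
  obtain K where K: "K > 0" "\<And>x. norm (S' x) \<le> K * norm x"
    using linear_bounded_pos[OF S'] by blast
  have fin: "emeasure lborel (S -` cball 0 r) < \<infinity>" for r
  proof -
    have "S -` cball 0 r \<subseteq> cball 0 (K * r)"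
    proof
      fix x assume "x \<in> S -` cball 0 r"
      then have "norm (S x) \<le> r" by simp
      then have "K * norm (S x) \<le> K * r" using K by simp
      then show "x \<in> cball 0 (K * r)" using K(2)[of "S x"] S(3)[of x] by simp
    qed
    then show ?thesis by (intro le_less_trans[OF emeasure_mono emeasure_lborel_cball_finite]) auto
  qed
  have "emeasure (distr lborel borel S) A * emeasure lborel (cball 0 1 :: 'a set)
       = emeasure lborel A * emeasure (distr lborel borel S) (cball 0 1)"
  proof (rule haar_unique[where T=UNIV])
    show "sigma_finite_measure (distr lborel borel S)"
      by (rule sigma_finite_if_finite_on_balls) (use fin in \<open>auto simp: em\<close>)
    fix a :: 'a
    show "distr lborel borel ((+) a) = (lborel :: 'a measure)" by (rule lborel_distr_plus)
    have "distr (distr lborel borel S) borel ((+) a) = distr lborel borel (\<lambda>x. a + S x)"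
      by (subst distr_distr) (auto simp: o_def)
    \<comment> \<open>A shift by \<open>a\<close> after \<open>S\<close> is a shift by
      \<open>S' a\<close> before it, which Lebesgue measure does not see.\<close>
    also have "(\<lambda>x. a + S x) = S \<circ> (+) (S' a)" using S by (auto simp: linear_add)
    also have "distr lborel borel (S \<circ> (+) (S' a)) = distr (distr lborel borel ((+) (S' a))) borel S"
      by (subst distr_distr) auto
    finally show "distr (distr lborel borel S) borel ((+) a) = distr lborel borel S"
      by (simp add: lborel_distr_plus)
  qed (auto simp: A sigma_finite_lborel)
  then show ?thesis by (simp add: em A)
qed

lemma lborel_cball_pos: "0 < r \<Longrightarrow> emeasure lborel (cball (a::'a::euclidean_space) r) \<noteq> 0"
  by (simp add: emeasure_cball ennreal_eq_0_iff not_le unit_ball_vol_pos)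

lemma ennreal_mult_right_cancel:
  fixes a b c :: ennreal
  assumes eq: "a * c = b * c" and c: "c \<noteq> 0" "c \<noteq> \<infinity>"
  shows "a = b"
proof -
  have c': "c \<noteq> top" using c by simp
  have "a = a * c / c" by (rule mult_divide_eq_ennreal[OF c(1) c', symmetric])
  also have "\<dots> = b" unfolding eq by (rule mult_divide_eq_ennreal[OF c(1) c'])
  finally show ?thesis .
qed

section \<open>Volume under reflections and shears\<close>

definition hrefl :: "'a::real_inner \<Rightarrow> 'a \<Rightarrow> 'a" where
  "hrefl u x = x - (2 * (x \<bullet> u)) *\<^sub>R u"

lemma hrefl_hrefl: "norm u = 1 \<Longrightarrow> hrefl u (hrefl u x) = x"
proof -
  assume "norm u = 1"
  then have "hrefl u x \<bullet> u = - (x \<bullet> u)" by (simp add: hrefl_def inner_diff_left dot_square_norm)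
  then show ?thesis by (simp add: hrefl_def[of u "hrefl u x"]) (simp add: hrefl_def)
qed

lemma hrefl_inner: "norm u = 1 \<Longrightarrow> hrefl u x \<bullet> hrefl u y = x \<bullet> y"
  by (simp add: hrefl_def inner_diff_left inner_diff_right dot_square_norm inner_commute[of u y])

lemma norm_hrefl: "norm u = 1 \<Longrightarrow> norm (hrefl u x) = norm x"
  by (simp add: norm_eq_sqrt_inner hrefl_inner)

lemma linear_hrefl: "linear (hrefl u)"
  by (rule linearI) (auto simp: hrefl_def algebra_simps inner_add_left)

text \<open>Equal lengths give |u - v|^2 = 2 u \<bullet> (u - v), so the reflection subtracts
  exactly u - v from u. A single map that is its own inverse thus carries any unit vector to any
  other and takes the place of rotations.\<close>

lemma hrefl_swap:
  assumes "norm u = 1" "norm v = 1" "u \<noteq> v"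
  shows "hrefl ((u - v) /\<^sub>R norm (u - v)) u = v"
proof -
  let ?w = "u - v"
  have n: "norm ?w \<noteq> 0" using assms by simp
  have "norm ?w ^ 2 = 2 * (u \<bullet> ?w)"
    using assms dot_square_norm[of u] dot_square_norm[of v]
    by (simp add: power2_norm_eq_inner inner_diff_left inner_diff_right inner_commute[of v u])
  moreover have "2 * (u \<bullet> (?w /\<^sub>R norm ?w)) / norm ?w = 2 * (u \<bullet> ?w) / norm ?w ^ 2"
    by (simp add: power2_eq_square divide_inverse)
  ultimately have "2 * (u \<bullet> (?w /\<^sub>R norm ?w)) / norm ?w = 1"
    using n by (metis divide_self power_not_zero)
  then show ?thesis by (simp add: hrefl_def divide_inverse)
qed

text \<open>The unit ball is mapped to itself, so the factor of proportionality is 1.\<close>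

lemma lborel_hrefl:
  assumes u: "norm u = 1" and A: "A \<in> sets borel"
  shows "emeasure lborel (hrefl u -` A) = emeasure lborel (A :: 'a::euclidean_space set)"
proof -
  have "hrefl u -` cball 0 1 = (cball 0 1 :: 'a set)" using norm_hrefl[OF u] by auto
  then have eq: "emeasure lborel (hrefl u -` A) * emeasure lborel (cball 0 1 :: 'a set) = emeasure lborel A * emeasure lborel (cball 0 1 :: 'a set)"
    using lborel_linear_bij[OF linear_hrefl hrefl_hrefl[OF u] hrefl_hrefl[OF u] A] by simp
  show ?thesis
    by (rule ennreal_mult_right_cancel[OF eq])
      (use lborel_cball_pos[of 1 "0::'a"] emeasure_lborel_cball_finite[of "0::'a" 1] in auto)
qed

text \<open>The reflection in \<open>u\<close> conjugates the shear to its inverse, so its Jacobian \<open>k\<close> satisfies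
  \<open>k = 1 / k\<close>.\<close>

lemma lborel_shear:
  fixes \<tau> u :: "'a::euclidean_space"
  assumes u: "norm u = 1" and \<tau>: "\<tau> \<bullet> u = 0" and A: "A \<in> sets borel"
  shows "emeasure lborel ((\<lambda>x. x + (x \<bullet> u) *\<^sub>R \<tau>) -` A) = emeasure lborel A"
proof -
  define S where "S x = x + (x \<bullet> u) *\<^sub>R \<tau>" for x
  define S' where "S' x = x - (x \<bullet> u) *\<^sub>R \<tau>" for x
  have uu: "u \<bullet> u = 1" using u by (simp add: dot_square_norm)
  have lin: "linear S" by (rule linearI) (auto simp: S_def algebra_simps inner_add_left)
  have SS: "S (S' x) = x" "S' (S x) = x" for x
    by (auto simp: S_def S'_def inner_add_left inner_diff_left \<tau>)
  have conj: "hrefl u (S (hrefl u x)) = S' x" for x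
    by (simp add: S_def S'_def hrefl_def inner_add_left inner_diff_left \<tau> uu algebra_simps)
  have contS: "continuous_on UNIV S" "continuous_on UNIV S'" unfolding S_def S'_def by (intro continuous_intros)+
  note [measurable] = contS[THEN borel_measurable_continuous_onI]
  have mS: "S -` X \<in> sets borel" "S' -` X \<in> sets borel" "hrefl u -` X \<in> sets borel" if "X \<in> sets borel" for X
    using measurable_sets[of S borel borel X] measurable_sets[of S' borel borel X]
      measurable_sets[of "hrefl u" borel borel X] that
      borel_measurable_continuous_onI[OF linear_continuous_on[OF linear_conv_bounded_linear[THEN iffD1, OF linear_hrefl[of u]]]]
    by auto
  let ?b = "emeasure lborel (cball 0 1 :: 'a set)" and ?s = "emeasure lborel (S -` cball 0 1)"
  have sc: "emeasure lborel (S -` X) * ?b = emeasure lborel X * ?s" if "X \<in> sets borel" for X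
    by (rule lborel_linear_bij[OF lin SS that])
  have "S' -` cball 0 1 = hrefl u -` (S -` (hrefl u -` cball 0 1))"
    using conj by auto
  also have "hrefl u -` cball 0 1 = (cball 0 1 :: 'a set)" using norm_hrefl[OF u] by auto
  finally have "emeasure lborel (S' -` cball 0 1) = ?s"
    using lborel_hrefl[OF u, of "S -` cball 0 1"] mS(1)[of "cball 0 1"] by simp
  moreover have "S -` (S' -` cball 0 1) = cball 0 1" using SS by auto
  ultimately have bs: "?b * ?b = ?s * ?s" using sc[of "S' -` cball 0 1"] mS by simp
  have b: "?b \<noteq> 0" "?b \<noteq> \<infinity>" using lborel_cball_pos[of 1 "0::'a"] emeasure_lborel_cball_finite[of "0::'a" 1] by auto
  have "?s = ?b"
  \<comment> \<open>\<open>?b * ?b = ?s * ?s\<close> gives equality by taking roots of finite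
    numbers; an infinite \<open>?s\<close> would make the finite \<open>?b * ?b\<close>
    infinite.\<close>
  proof (cases "?s < \<infinity>")
    case True
    then obtain s b where sb: "?s = ennreal s" "?b = ennreal b" "s \<ge> 0" "b \<ge> 0" using b
      by (metis ennreal_cases infinity_ennreal_def less_irrefl)
    then show ?thesis using bs
      by (smt (verit, ccfv_SIG) ennreal_inj ennreal_mult' mult_nonneg_nonneg power2_eq_iff_nonneg power2_eq_square)
  next
    case False
    then show ?thesis using bs b by (auto simp: not_less top_unique ennreal_mult_eq_top_iff)
  qed
  then have "emeasure lborel (S -` A) * ?b = emeasure lborel A * ?b" using sc[OF A] by simp
  from ennreal_mult_right_cancel[OF this b] show ?thesis unfolding S_def .
qed

lemma nn_integral_lborel_translate:
  fixes f :: "'a::euclidean_space \<Rightarrow> ennreal"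
  assumes "f \<in> borel_measurable borel"
  shows "(\<integral>\<^sup>+x. f (a + x) \<partial>lborel) = (\<integral>\<^sup>+x. f x \<partial>lborel)"
  by (subst (2) lborel_distr_plus[symmetric, of a], subst nn_integral_distr) (use assms in auto)

text \<open>On each line parallel to \<open>e\<close> the function \<open>G\<close> is constant, so
  only the integral of the profile along the line matters, not the place \<open>s z\<close> where it
  starts. Fubini in z and an auxiliary shift t expresses this without splitting the space into a
  line and its complement. It later trades oblique slabs for the coordinate slab.\<close>

lemma nn_integral_line_invariant:
  fixes G :: "'a::euclidean_space \<Rightarrow> ennreal" and s :: "'a \<Rightarrow> real" and \<chi>1 \<chi>2 :: "real \<Rightarrow> ennreal"
  assumes [measurable]: "G \<in> borel_measurable borel" "s \<in> borel_measurable borel"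
      "\<chi>1 \<in> borel_measurable borel" "\<chi>2 \<in> borel_measurable borel"
    and e: "e \<bullet> e = 1" and G: "\<And>z t. G (z + t *\<^sub>R e) = G z" and s: "\<And>z t. s (z + t *\<^sub>R e) = s z"
  shows "(\<integral>\<^sup>+z. G z * \<chi>1 (z \<bullet> e - s z) \<partial>lborel) * (\<integral>\<^sup>+t. \<chi>2 t \<partial>lborel)
       = (\<integral>\<^sup>+z. G z * \<chi>2 (z \<bullet> e) \<partial>lborel) * (\<integral>\<^sup>+t. \<chi>1 t \<partial>lborel)"
proof -
  have tr: "(\<integral>\<^sup>+t. \<chi>1 (c - t) \<partial>lborel) = (\<integral>\<^sup>+t. \<chi>1 t \<partial>lborel)" for c
    using nn_integral_real_affine[of \<chi>1 "-1" c] by simp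
  have "(\<integral>\<^sup>+z. G z * \<chi>1 (z \<bullet> e - s z) \<partial>lborel) * (\<integral>\<^sup>+t. \<chi>2 t \<partial>lborel)
      = (\<integral>\<^sup>+z. (\<integral>\<^sup>+t. G z * \<chi>1 (z \<bullet> e - s z) * \<chi>2 (z \<bullet> e + t) \<partial>lborel) \<partial>lborel)"
    by (simp add: nn_integral_multc nn_integral_cmult nn_integral_lborel_translate)
  also have "\<dots> = (\<integral>\<^sup>+t. (\<integral>\<^sup>+z. G z * \<chi>1 (z \<bullet> e - s z) * \<chi>2 (z \<bullet> e + t) \<partial>lborel) \<partial>lborel)"
    by (rule lborel_pair.Fubini') measurable
  \<comment> \<open>Translation of z by t e moves the shift from \<chi>2 to \<chi>1, since
    \<open>G\<close> and \<open>s\<close> do not notice it.\<close>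
  also have "\<dots> = (\<integral>\<^sup>+t. (\<integral>\<^sup>+z. G z * \<chi>1 (z \<bullet> e - s z - t) * \<chi>2 (z \<bullet> e) \<partial>lborel) \<partial>lborel)"
  proof (rule nn_integral_cong)
    fix t :: real
    show "(\<integral>\<^sup>+z. G z * \<chi>1 (z \<bullet> e - s z) * \<chi>2 (z \<bullet> e + t) \<partial>lborel) = (\<integral>\<^sup>+z. G z * \<chi>1 (z \<bullet> e - s z - t) * \<chi>2 (z \<bullet> e) \<partial>lborel)"
      using nn_integral_lborel_translate[of "\<lambda>z. G z * \<chi>1 (z \<bullet> e - s z - t) * \<chi>2 (z \<bullet> e)" "t *\<^sub>R e"]
        G[of _ t] s[of _ t] e by (simp add: add.commute inner_add_left)
  qed
  also have "\<dots> = (\<integral>\<^sup>+z. (\<integral>\<^sup>+t. G z * \<chi>1 (z \<bullet> e - s z - t) * \<chi>2 (z \<bullet> e) \<partial>lborel) \<partial>lborel)"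
    by (rule lborel_pair.Fubini') measurable
  also have "\<dots> = (\<integral>\<^sup>+z. G z * \<chi>2 (z \<bullet> e) * (\<integral>\<^sup>+t. \<chi>1 t \<partial>lborel) \<partial>lborel)"
    by (simp add: nn_integral_multc nn_integral_cmult tr mult_ac)
  finally show ?thesis by (simp add: nn_integral_multc)
qed

section \<open>Hausdorff measure on hyperplanes\<close>

definition perp_disc :: "real \<Rightarrow> 'a::euclidean_space \<Rightarrow> 'a set" where
  "perp_disc r u = {x. x \<bullet> u = 0 \<and> norm x \<le> r}"

lemma hrefl_hrefl_image:
  assumes "norm w = 1" "\<And>x. x \<in> A \<Longrightarrow> hrefl w x \<in> B" "\<And>x. x \<in> B \<Longrightarrow> hrefl w x \<in> A"
  shows "hrefl w ` A = B"
  using assms hrefl_hrefl[OF assms(1)] by (metis image_eqI image_subsetI subsetI subset_antisym)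

text \<open>The reflection that swaps \<open>u\<close> and \<open>v\<close> is an isometry between
  the two discs. Finiteness and the plane constant are thereby inherited from a single coordinate
  direction.\<close>

lemma hausdorff_outer_perp_disc:
  fixes u v :: "'a::euclidean_space"
  assumes u: "norm u = 1" and v: "norm v = 1"
  shows "hausdorff_outer d (perp_disc r u) = hausdorff_outer d (perp_disc r v)"
proof (cases "u = v")
  case False
  define w where "w = (u - v) /\<^sub>R norm (u - v)"
  have w: "norm w = 1" using False by (simp add: w_def)
  have uv: "hrefl w u = v" unfolding w_def by (rule hrefl_swap[OF u v False])
  have vu: "hrefl w v = u" using uv hrefl_hrefl[OF w] by metis
  have "hrefl w ` perp_disc r u = perp_disc r v"
  proof (rule hrefl_hrefl_image[OF w])
    show "hrefl w x \<in> perp_disc r v" if "x \<in> perp_disc r u" for x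
      using that hrefl_inner[OF w, of x u] by (simp add: perp_disc_def uv norm_hrefl[OF w])
    show "hrefl w x \<in> perp_disc r u" if "x \<in> perp_disc r v" for x
      using that hrefl_inner[OF w, of x v] by (simp add: perp_disc_def vu norm_hrefl[OF w])
  qed
  moreover have "norm (hrefl w x - hrefl w y) = norm (x - y)" for x y
    by (metis linear_diff linear_hrefl norm_hrefl w)
  ultimately show ?thesis using hausdorff_outer_isometry[of "perp_disc r u" "hrefl w" d] by simp
qed simp

lemma hausdorff_outer_mono: "A \<subseteq> B \<Longrightarrow> hausdorff_outer d A \<le> hausdorff_outer d B"
  unfolding hausdorff_outer_def hausdorff_pre_def
  by (intro SUP_mono' INF_superset_mono) auto

lemma hausdorff_outer_perp_disc_finite:
  fixes u :: "'a::euclidean_space"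
  assumes d: "d = DIM('a) - 1" "d > 0" and u: "norm u = 1"
  shows "hausdorff_outer d (perp_disc r u) < \<infinity>"
proof -
  define e :: 'a where "e = (SOME e. e \<in> Basis)"
  have e: "e \<in> Basis" unfolding e_def by (rule someI_ex) (use nonempty_Basis in blast)
  have "perp_disc r e \<subseteq> {x::'a. x \<bullet> e = 0 \<and> (\<forall>b\<in>Basis. \<bar>x \<bullet> b\<bar> \<le> max r 1)}"
    unfolding perp_disc_def by (auto intro: order_trans[OF Basis_le_norm])
  from hausdorff_outer_mono[OF this, of d] hausdorff_outer_cube_finite[OF e d, of "max r 1"]
  have "hausdorff_outer d (perp_disc r e) < \<infinity>" by (auto intro: le_less_trans)
  then show ?thesis using hausdorff_outer_perp_disc[of u e d r] u e by simp
qed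

text \<open>The right cylinder of height 1 over \<open>perp_disc 1 u\<close>, against whose volume
  the Hausdorff measure of the disc is calibrated.\<close>

definition perp_cyl :: "'a::euclidean_space \<Rightarrow> 'a set" where
  "perp_cyl u = {y. norm (y - (y \<bullet> u) *\<^sub>R u) \<le> 1 \<and> 0 \<le> y \<bullet> u \<and> y \<bullet> u < 1}"

lemma perp_cyl_measurable [measurable]: "perp_cyl u \<in> sets borel"
  unfolding perp_cyl_def by measurable

lemma emeasure_perp_cyl:
  fixes u v :: "'a::euclidean_space"
  assumes u: "norm u = 1" and v: "norm v = 1"
  shows "emeasure lborel (perp_cyl u) = emeasure lborel (perp_cyl v)"
proof (cases "u = v")
  case False
  define w where "w = (u - v) /\<^sub>R norm (u - v)"
  have w: "norm w = 1" using False by (simp add: w_def)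
  have uv: "hrefl w u = v" unfolding w_def by (rule hrefl_swap[OF u v False])
  have "hrefl w -` perp_cyl v = perp_cyl u"
  proof -
    have "hrefl w x \<bullet> v = x \<bullet> u" for x using hrefl_inner[OF w, of x u] uv by simp
    moreover have "hrefl w x - c *\<^sub>R v = hrefl w (x - c *\<^sub>R u)" for x c
      using linear_hrefl[of w] uv by (simp add: linear_diff linear_scale)
    ultimately show ?thesis by (auto simp: perp_cyl_def norm_hrefl[OF w])
  qed
  then show ?thesis using lborel_hrefl[OF w, of "perp_cyl v"] by simp
qed simp

lemma perp_cyl_pos_finite:
  fixes u :: "'a::euclidean_space"
  assumes u: "norm u = 1"
  shows "emeasure lborel (perp_cyl u) \<noteq> 0" "emeasure lborel (perp_cyl u) < \<infinity>"
proof -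
  have uu: "u \<bullet> u = 1" using u by (simp add: dot_square_norm)
  have "cball ((1/2) *\<^sub>R u) (1/4) \<subseteq> perp_cyl u"
  proof
    fix y assume "y \<in> cball ((1/2) *\<^sub>R u) (1/4)"
    then have n: "norm (y - (1/2) *\<^sub>R u) \<le> 1/4" by (simp add: dist_norm norm_minus_commute)
    have "\<bar>(y - (1/2) *\<^sub>R u) \<bullet> u\<bar> \<le> norm (y - (1/2) *\<^sub>R u) * norm u" by (rule Cauchy_Schwarz_ineq2)
    then have 1: "\<bar>y \<bullet> u - 1/2\<bar> \<le> 1/4" using n u uu by (simp add: inner_diff_left)
    have "norm (y - (y \<bullet> u) *\<^sub>R u) = norm ((y - (1/2) *\<^sub>R u) - (y \<bullet> u - 1/2) *\<^sub>R u)"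
      by (simp add: algebra_simps)
    also have "\<dots> \<le> norm (y - (1/2) *\<^sub>R u) + \<bar>y \<bullet> u - 1/2\<bar>"
      using norm_triangle_ineq4[of "y - (1/2) *\<^sub>R u" "(y \<bullet> u - 1/2) *\<^sub>R u"] u by simp
    finally have "norm (y - (y \<bullet> u) *\<^sub>R u) \<le> 1" using 1 n by linarith
    moreover have "0 \<le> y \<bullet> u" "y \<bullet> u < 1" using 1 by linarith+
    ultimately show "y \<in> perp_cyl u" unfolding perp_cyl_def by simp
  qed
  from emeasure_mono[OF this, of lborel] show "emeasure lborel (perp_cyl u) \<noteq> 0"
    using lborel_cball_pos[of "1/4" "(1/2) *\<^sub>R u"] by auto
  have "perp_cyl u \<subseteq> cball 0 2"
  proof
    fix y assume y: "y \<in> perp_cyl u"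
    have "norm y \<le> norm (y - (y \<bullet> u) *\<^sub>R u) + norm ((y \<bullet> u) *\<^sub>R u)"
      using norm_triangle_ineq[of "y - (y \<bullet> u) *\<^sub>R u" "(y \<bullet> u) *\<^sub>R u"] by simp
    then show "y \<in> cball 0 2" using y u by (simp add: perp_cyl_def)
  qed
  from emeasure_mono[OF this, of lborel] show "emeasure lborel (perp_cyl u) < \<infinity>"
    using emeasure_lborel_cball_finite[of "0::'a" 2] by (auto intro: le_less_trans)
qed

text \<open>\<open>sweep u v p A\<close> is the prism \<open>A + [0,1) v\<close> over a subset \<open>A\<close> of the hyperplane through \<open>p\<close>
  with normal \<open>u\<close>.\<close>

definition sweep :: "'a::euclidean_space \<Rightarrow> 'a \<Rightarrow> 'a \<Rightarrow> 'a set \<Rightarrow> 'a set" where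
  "sweep u v p A = {z. z - (((z - p) \<bullet> u) / (v \<bullet> u)) *\<^sub>R v \<in> A
                      \<and> 0 \<le> ((z - p) \<bullet> u) / (v \<bullet> u) \<and> ((z - p) \<bullet> u) / (v \<bullet> u) < 1}"

text \<open>A shear parallel to the hyperplane straightens the prism into a right cylinder of signed
  height v \<bullet> u over the same base, without changing its volume.\<close>

lemma emeasure_sweep_disc:
  fixes u v :: "'a::euclidean_space"
  assumes u: "norm u = 1" and vu: "v \<bullet> u \<noteq> 0"
  shows "emeasure lborel (sweep u v 0 (perp_disc 1 u)) = ennreal \<bar>v \<bullet> u\<bar> * emeasure lborel (perp_cyl u)"
proof -
  have uu: "u \<bullet> u = 1" using u by (simp add: dot_square_norm)
  define \<beta> where "\<beta> = v \<bullet> u"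
  have \<beta>: "\<beta> \<noteq> 0" using vu by (simp add: \<beta>_def)
  \<comment> \<open>With this choice the shear sends \<open>v\<close> to \<beta> u and fixes the
    hyperplane.\<close>
  define \<tau> where "\<tau> = u - v /\<^sub>R \<beta>"
  have \<tau>: "\<tau> \<bullet> u = 0" using \<beta> uu by (simp add: \<tau>_def inner_diff_left \<beta>_def[symmetric])
  define G :: "'a \<Rightarrow> ennreal" where "G y = indicator (cball 0 1) (y - (y \<bullet> u) *\<^sub>R u)" for y
  define E where "E = {y. norm (y - (y \<bullet> u) *\<^sub>R u) \<le> 1 \<and> 0 \<le> (y \<bullet> u) / \<beta> \<and> (y \<bullet> u) / \<beta> < 1}"
  have [measurable]: "cball (0::'a) 1 \<in> sets borel" by simp
  have [measurable]: "G \<in> borel_measurable borel" unfolding G_def by measurable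
  have E[measurable]: "E \<in> sets borel" unfolding E_def by measurable
  have "sweep u v 0 (perp_disc 1 u) = (\<lambda>x. x + (x \<bullet> u) *\<^sub>R \<tau>) -` E"
  proof -
    have 1: "(x + (x \<bullet> u) *\<^sub>R \<tau>) \<bullet> u = x \<bullet> u" for x by (simp add: inner_add_left \<tau>)
    have 2: "x + (x \<bullet> u) *\<^sub>R \<tau> - (x \<bullet> u) *\<^sub>R u = x - ((x \<bullet> u) / \<beta>) *\<^sub>R v" for x
      by (simp add: \<tau>_def algebra_simps divide_inverse)
    have 3: "(x - ((x \<bullet> u) / \<beta>) *\<^sub>R v) \<bullet> u = 0" for x
      using \<beta> by (simp add: inner_diff_left \<beta>_def[symmetric])
    show ?thesis by (auto simp: sweep_def E_def perp_disc_def 1 2 3 \<beta>_def[symmetric])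
  qed
  then have "emeasure lborel (sweep u v 0 (perp_disc 1 u)) = emeasure lborel E"
    using lborel_shear[OF u \<tau> E] by simp
  \<comment> \<open>The factor 1 is the length of [0, 1); it brings the integral into the shape in
    which the heights [0, 1) and 0 \<le> t / \<beta> < 1 can be exchanged.\<close>
  also have "\<dots> = (\<integral>\<^sup>+z. G z * indicator {t. 0 \<le> t / \<beta> \<and> t / \<beta> < 1} (z \<bullet> u - 0) \<partial>lborel)
      * (\<integral>\<^sup>+t. indicator {t::real. 0 \<le> t \<and> t < 1} t \<partial>lborel)"
  proof -
    have "{t::real. 0 \<le> t \<and> t < 1} = {0..<1}" by auto
    then have "(\<integral>\<^sup>+t. indicator {t::real. 0 \<le> t \<and> t < 1} t \<partial>lborel) = 1" by simp
    moreover have "emeasure lborel E = (\<integral>\<^sup>+z. G z * indicator {t. 0 \<le> t / \<beta> \<and> t / \<beta> < 1} (z \<bullet> u - 0) \<partial>lborel)"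
      unfolding nn_integral_indicator[symmetric, OF E[folded sets_lborel]]
      by (intro nn_integral_cong) (auto simp: E_def G_def indicator_def)
    ultimately show ?thesis by simp
  qed
  also have "\<dots> = (\<integral>\<^sup>+z. G z * indicator {t. 0 \<le> t \<and> t < 1} (z \<bullet> u) \<partial>lborel)
      * (\<integral>\<^sup>+t. indicator {t::real. 0 \<le> t / \<beta> \<and> t / \<beta> < 1} t \<partial>lborel)"
  proof (rule nn_integral_line_invariant[OF _ _ _ _ uu])
    have i: "indicator {t::real. 0 \<le> t / \<beta> \<and> t / \<beta> < 1} \<in> borel_measurable borel" for \<beta> by measurable
    show "indicator {t::real. 0 \<le> t / \<beta> \<and> t / \<beta> < 1} \<in> borel_measurable borel" by (rule i)
    show "indicator {t::real. 0 \<le> t \<and> t < 1} \<in> borel_measurable borel" using i[of 1] by simp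
    fix z t show "G (z + t *\<^sub>R u) = G z"
      by (simp add: G_def inner_add_left uu algebra_simps)
  qed auto
  also have "(\<integral>\<^sup>+t. indicator {t::real. 0 \<le> t / \<beta> \<and> t / \<beta> < 1} t \<partial>lborel) = ennreal \<bar>\<beta>\<bar>"
  proof (cases "\<beta> > 0")
    case True
    then have "{t::real. 0 \<le> t / \<beta> \<and> t / \<beta> < 1} = {0..<\<beta>}" by (auto simp: field_simps)
    then show ?thesis using True by simp
  next
    case False
    then have "{t::real. 0 \<le> t / \<beta> \<and> t / \<beta> < 1} = {\<beta><..0}" using \<beta> by (auto simp: field_simps)
    then show ?thesis using False by simp
  qed
  also have "(\<integral>\<^sup>+z. G z * indicator {t. 0 \<le> t \<and> t < 1} (z \<bullet> u) \<partial>lborel) = emeasure lborel (perp_cyl u)"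
    unfolding nn_integral_indicator[symmetric, OF perp_cyl_measurable[folded sets_lborel]]
    by (intro nn_integral_cong) (auto simp: perp_cyl_def G_def indicator_def)
  finally show ?thesis by (simp add: \<beta>_def mult.commute)
qed

lemma sweep_translate:
  "(+) p -` sweep u v p A = sweep u v 0 ((+) p -` A)"
proof -
  have 1: "p + x - p = x" "p + x - y = p + (x - y)" for x y :: 'a by simp_all
  show ?thesis unfolding sweep_def vimage_def mem_Collect_eq 1 by simp
qed

lemma sweep_measurable:
  assumes [measurable]: "A \<in> sets borel"
  shows "sweep u v p A \<in> sets borel"
  unfolding sweep_def by measurable

text \<open>The case in which \<open>measure_of\<close> really returns the outer measure on Borel
  sets. The arguments about surfaces use no other fact about the measure.\<close>

locale hausdorff_borel =
  fixes \<mu> :: "'a::euclidean_space measure" and d :: nat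
  assumes sets_\<mu>: "sets \<mu> = sets borel"
    and emeasure_\<mu>: "\<And>A. A \<in> sets borel \<Longrightarrow> emeasure \<mu> A = hausdorff_outer d A"
    and d_def: "d = DIM('a) - 1" and d_pos: "d > 0"
begin

text \<open>The quotient for one arbitrary coordinate direction; \<open>plane_const_eq\<close>
  carries it to all unit vectors by reflection.\<close>

definition plane_const :: ennreal where
  "plane_const = (let e = (SOME e::'a. e \<in> Basis) in hausdorff_outer d (perp_disc 1 e) / emeasure lborel (perp_cyl e))"

lemma plane_const_eq:
  assumes u: "norm (u :: 'a) = 1"
  shows "hausdorff_outer d (perp_disc 1 u) = plane_const * emeasure lborel (perp_cyl u)"
proof -
  define e :: 'a where "e = (SOME e. e \<in> Basis)"
  have e: "e \<in> Basis" unfolding e_def by (rule someI_ex) (use nonempty_Basis in blast)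
  then have ne: "norm e = 1" by simp
  show ?thesis unfolding plane_const_def Let_def e_def[symmetric]
    using perp_cyl_pos_finite[OF ne] hausdorff_outer_perp_disc[OF u ne] emeasure_perp_cyl[OF u ne]
    by (simp add: ennreal_divide_times)
qed

lemma plane_const_finite: "plane_const < \<infinity>"
proof -
  define e :: 'a where "e = (SOME e. e \<in> Basis)"
  have e: "e \<in> Basis" unfolding e_def by (rule someI_ex) (use nonempty_Basis in blast)
  then have ne: "norm e = 1" by simp
  show ?thesis unfolding plane_const_def Let_def e_def[symmetric]
    using perp_cyl_pos_finite[OF ne] hausdorff_outer_perp_disc_finite[OF d_def d_pos ne, of 1]
    by (simp add: less_top[symmetric] ennreal_divide_eq_top_iff)
qed

text \<open>As functions of \<open>A\<close> both sides are measures on the hyperplane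
  \<open>T\<close> that are invariant under its translations: Hausdorff measure restricted to
  \<open>T\<close>, and the volume of a slab pushed forward by the projection \<open>P\<close> along
  \<open>v\<close>. Haar uniqueness makes them proportional, and the unit disc yields the factor |v
  \<bullet> u|.\<close>

lemma hausdorff_plane0:
  fixes u v :: 'a
  assumes u: "norm u = 1" and vu: "v \<bullet> u \<noteq> 0" and A: "A \<in> sets borel" "\<And>x. x \<in> A \<Longrightarrow> x \<bullet> u = 0"
  shows "hausdorff_outer d A * ennreal \<bar>v \<bullet> u\<bar> = plane_const * emeasure lborel (sweep u v 0 A)"
proof -
  define T where "T = {x. x \<bullet> u = 0}"
  have T[measurable]: "T \<in> sets borel" unfolding T_def by measurable
  define P where "P z = z - ((z \<bullet> u) / (v \<bullet> u)) *\<^sub>R v" for z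
  have [measurable]: "P \<in> borel_measurable borel" unfolding P_def by measurable
  define S where "S = {z. 0 \<le> (z \<bullet> u) / (v \<bullet> u) \<and> (z \<bullet> u) / (v \<bullet> u) < 1}"
  have [measurable]: "S \<in> sets borel" unfolding S_def by measurable
  note [measurable_cong] = sets_\<mu>
  define \<kappa>1 where "\<kappa>1 = density \<mu> (indicator T)"
  define \<kappa>2 where "\<kappa>2 = distr (density lborel (indicator S)) borel P"
  have s1: "sets \<kappa>1 = sets borel" by (simp add: \<kappa>1_def sets_\<mu>)
  have s2: "sets \<kappa>2 = sets borel" by (simp add: \<kappa>2_def)
  have sp: "space \<kappa>1 = UNIV" "space \<kappa>2 = UNIV"
    using sets_eq_imp_space_eq[OF s1] sets_eq_imp_space_eq[OF s2] by simp_all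
  have e1: "emeasure \<kappa>1 X = hausdorff_outer d (X \<inter> T)" if [measurable]: "X \<in> sets borel" for X
  proof -
    have "emeasure \<kappa>1 X = (\<integral>\<^sup>+x. indicator T x * indicator X x \<partial>\<mu>)"
      unfolding \<kappa>1_def by (rule emeasure_density) (auto simp: sets_\<mu>)
    also have "\<dots> = (\<integral>\<^sup>+x. indicator (X \<inter> T) x \<partial>\<mu>)"
      by (rule nn_integral_cong) (simp split: split_indicator)
    also have "\<dots> = emeasure \<mu> (X \<inter> T)" by (rule nn_integral_indicator) (simp add: sets_\<mu>)
    finally show ?thesis by (simp add: emeasure_\<mu>)
  qed
  have e2: "emeasure \<kappa>2 X = emeasure lborel (sweep u v 0 X)" if [measurable]: "X \<in> sets borel" for X
  proof -
    have m: "P -` X \<in> sets borel" using measurable_sets[of P borel borel X] by simp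
    have "emeasure \<kappa>2 X = (\<integral>\<^sup>+x. indicator S x * indicator (P -` X) x \<partial>lborel)"
      unfolding \<kappa>2_def by (subst emeasure_distr) (auto simp: emeasure_density m)
    also have "\<dots> = (\<integral>\<^sup>+x. indicator (sweep u v 0 X) x \<partial>lborel)"
      by (intro nn_integral_cong) (auto simp: indicator_def S_def P_def sweep_def)
    finally show ?thesis using sweep_measurable[of X] by simp
  qed
  have "emeasure \<kappa>1 A * emeasure \<kappa>2 (perp_disc 1 u) = emeasure \<kappa>2 A * emeasure \<kappa>1 (perp_disc 1 u)"
  proof (rule haar_unique[OF s1 s2, where T=T])
    show "AE x in \<kappa>1. x \<in> T" unfolding \<kappa>1_def by (subst AE_density) (auto simp: indicator_def)
    show "AE x in \<kappa>2. x \<in> T" unfolding \<kappa>2_def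
      by (subst AE_distr_iff) (use vu in \<open>auto simp: T_def P_def inner_diff_left\<close>)
    show "sigma_finite_measure \<kappa>1"
    proof (rule sigma_finite_if_finite_on_balls[OF s1])
      fix n :: nat
      have "cball 0 (real n) \<inter> T = perp_disc n u" by (auto simp: T_def perp_disc_def)
      then show "emeasure \<kappa>1 (cball 0 n) < \<infinity>"
        using hausdorff_outer_perp_disc_finite[OF d_def d_pos u, of n] by (simp add: e1)
    qed
    show "sigma_finite_measure \<kappa>2"
    proof (rule sigma_finite_if_finite_on_balls[OF s2])
      fix n :: nat
      have "sweep u v 0 (cball 0 n) \<subseteq> cball 0 (n + norm v)"
      proof
        fix z assume z: "z \<in> sweep u v 0 (cball 0 n)"
        define t where "t = (z \<bullet> u) / (v \<bullet> u)"
        have t: "norm (z - t *\<^sub>R v) \<le> n" "0 \<le> t" "t < 1" using z by (auto simp: sweep_def t_def)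
        have "norm z \<le> norm (z - t *\<^sub>R v) + norm (t *\<^sub>R v)"
          using norm_triangle_ineq[of "z - t *\<^sub>R v" "t *\<^sub>R v"] by simp
        also have "norm (t *\<^sub>R v) \<le> norm v" using t by (simp add: mult_left_le_one_le)
        finally show "z \<in> cball 0 (n + norm v)" using t by simp
      qed
      from emeasure_mono[OF this, of lborel] show "emeasure \<kappa>2 (cball 0 n) < \<infinity>"
        using emeasure_lborel_cball_finite[of "0::'a" "n + norm v"] by (auto simp: e2 intro: le_less_trans)
    qed
    fix a assume a: "a \<in> T"
    have mt: "(+) a -` X \<in> sets borel" if "X \<in> sets borel" for X
      using measurable_sets[of "(+) a" borel borel X] that by simp
    show "distr \<kappa>1 borel ((+) a) = \<kappa>1"
    proof (rule measure_eqI)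
      fix X assume "X \<in> sets (distr \<kappa>1 borel ((+) a))"
      then have X: "X \<in> sets borel" by simp
      have "emeasure (distr \<kappa>1 borel ((+) a)) X = hausdorff_outer d ((+) a -` X \<inter> T)"
        using X s1 by (subst emeasure_distr) (auto simp: e1 mt sp)
      also have "\<dots> = hausdorff_outer d ((+) a ` ((+) a -` X \<inter> T))"
        by (rule hausdorff_outer_isometry[symmetric]) auto
      also have "(+) a ` ((+) a -` X \<inter> T) = X \<inter> T"
      proof -
        have "x \<in> (+) a ` ((+) a -` X \<inter> T)" if "x \<in> X \<inter> T" for x
          by (rule image_eqI[of _ _ "x - a"]) (use that a in \<open>auto simp: T_def inner_diff_left\<close>)
        then show ?thesis using a by (auto simp: T_def inner_add_left)
      qed
      finally show "emeasure (distr \<kappa>1 borel ((+) a)) X = emeasure \<kappa>1 X" using X by (simp add: e1)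
    qed (simp add: s1)
    show "distr \<kappa>2 borel ((+) a) = \<kappa>2"
    proof (rule measure_eqI)
      fix X assume "X \<in> sets (distr \<kappa>2 borel ((+) a))"
      then have X: "X \<in> sets borel" by simp
      have "emeasure (distr \<kappa>2 borel ((+) a)) X = emeasure lborel (sweep u v 0 ((+) a -` X))"
        using X s2 by (subst emeasure_distr) (auto simp: e2 mt sp)
      also have "sweep u v 0 ((+) a -` X) = (+) a -` sweep u v 0 X"
        using a by (auto simp: sweep_def T_def inner_add_left algebra_simps)
      also have "emeasure lborel \<dots> = emeasure (distr lborel borel ((+) a)) (sweep u v 0 X)"
        by (subst emeasure_distr) (use sweep_measurable[OF X] in auto)
      finally show "emeasure (distr \<kappa>2 borel ((+) a)) X = emeasure \<kappa>2 X"
        using X by (simp add: e2 lborel_distr_plus)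
    qed (simp add: s2)
  next
    show "perp_disc 1 u \<in> sets borel" unfolding perp_disc_def by measurable
  qed (use A in \<open>auto simp: T_def perp_disc_def\<close>)
  moreover have "A \<inter> T = A" "perp_disc 1 u \<inter> T = perp_disc 1 u" using A by (auto simp: T_def perp_disc_def)
  moreover have "perp_disc 1 u \<in> sets borel" unfolding perp_disc_def by measurable
  ultimately have "hausdorff_outer d A * (ennreal \<bar>v \<bullet> u\<bar> * emeasure lborel (perp_cyl u))
      = emeasure lborel (sweep u v 0 A) * (plane_const * emeasure lborel (perp_cyl u))"
    using A by (simp add: e1 e2 emeasure_sweep_disc[OF u vu] plane_const_eq[OF u])
  then have eq: "(hausdorff_outer d A * ennreal \<bar>v \<bullet> u\<bar>) * emeasure lborel (perp_cyl u)
      = (plane_const * emeasure lborel (sweep u v 0 A)) * emeasure lborel (perp_cyl u)"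
    by (simp only: mult_ac)
  show ?thesis by (rule ennreal_mult_right_cancel[OF eq]) (use perp_cyl_pos_finite[OF u] in auto)
qed

lemma hausdorff_plane:
  fixes u v p :: 'a
  assumes u: "norm u = 1" and vu: "v \<bullet> u \<noteq> 0" and A: "A \<in> sets borel" "\<And>x. x \<in> A \<Longrightarrow> (x - p) \<bullet> u = 0"
  shows "hausdorff_outer d A * ennreal \<bar>v \<bullet> u\<bar> = plane_const * emeasure lborel (sweep u v p A)"
proof -
  have mt: "(+) p -` A \<in> sets borel"
    using measurable_sets[of "(+) p" borel borel A] A by simp
  have "(+) p ` ((+) p -` A) = A" by (auto simp: image_iff intro: bexI[of _ "x - p" for x])
  then have "hausdorff_outer d A = hausdorff_outer d ((+) p -` A)"
    using hausdorff_outer_isometry[of "(+) p -` A" "(+) p" d] by simp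
  moreover have "emeasure lborel (sweep u v p A) = emeasure (distr lborel borel ((+) p)) (sweep u v p A)"
    by (simp add: lborel_distr_plus)
  moreover have "\<dots> = emeasure lborel (sweep u v 0 ((+) p -` A))"
    by (subst emeasure_distr) (use sweep_measurable[OF A(1)] in \<open>auto simp: sweep_translate\<close>)
  ultimately show ?thesis using hausdorff_plane0[OF u vu mt] A(2) by (force simp: algebra_simps)
qed

end

section \<open>Calculus preliminaries\<close>

text \<open>The mean value theorem in the direction \<open>u\<close> is applied to the increment of
  \<open>f\<close> by t v; the gradients at the two ends of that increment are then expanded at
  \<open>p\<close>. In this way differentiability of \<open>g\<close> at the single point
  \<open>p\<close> suffices.\<close>

lemma second_difference_estimate:
  fixes f :: "'a::real_inner \<Rightarrow> real"
  assumes U: "open U" "p \<in> U"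
    and f: "\<And>x. x \<in> U \<Longrightarrow> (f has_derivative (\<lambda>v. g x \<bullet> v)) (at x)"
    and g: "(g has_derivative h) (at p)" and \<epsilon>: "\<epsilon> > 0"
  shows "\<exists>\<delta>>0. \<forall>t. 0 < t \<and> t < \<delta> \<longrightarrow>
     \<bar>f (p + t *\<^sub>R u + t *\<^sub>R v) - f (p + t *\<^sub>R u) - f (p + t *\<^sub>R v) + f p - t\<^sup>2 * (h v \<bullet> u)\<bar> \<le> \<epsilon> * t\<^sup>2"
proof -
  let ?c = "2 * norm u + norm v"
  \<comment> \<open>The two expansions of \<open>g\<close> err by \<eta> t (|u| + |v|) and \<eta> t
    |u|, and the product with t u adds a factor t |u|. The summand 1 covers u = 0.\<close>
  define \<eta> where "\<eta> = \<epsilon> / (?c * norm u + 1)"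
  have c0: "?c * norm u + 1 > 0" by (simp add: add_nonneg_pos)
  have \<eta>: "\<eta> > 0" using \<epsilon> c0 by (simp add: \<eta>_def)
  have \<eta>c: "\<eta> * ?c * norm u \<le> \<epsilon>"
  proof -
    have "\<eta> * ?c * norm u \<le> \<eta> * (?c * norm u + 1)" using \<eta> by (simp add: algebra_simps)
    also have "\<dots> = \<epsilon>" using c0 by (simp add: \<eta>_def)
    finally show ?thesis .
  qed
  interpret h: bounded_linear h using g by (rule has_derivative_bounded_linear)
  obtain d1 where d1: "d1 > 0" "\<And>y. norm (y - p) < d1 \<Longrightarrow> norm (g y - g p - h (y - p)) \<le> \<eta> * norm (y - p)"
    using g \<eta> unfolding has_derivative_at_alt by blast
  obtain d2 where d2: "d2 > 0" "ball p d2 \<subseteq> U" using U open_contains_ball by blast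
  define \<delta> where "\<delta> = min d1 d2 / (norm u + norm v + 1)"
  have n1: "norm u + norm v + 1 > 0" by (simp add: add_nonneg_pos)
  have \<delta>: "\<delta> > 0" using d1 d2 n1 by (simp add: \<delta>_def)
  have "\<bar>f (p + t *\<^sub>R u + t *\<^sub>R v) - f (p + t *\<^sub>R u) - f (p + t *\<^sub>R v) + f p - t\<^sup>2 * (h v \<bullet> u)\<bar> \<le> \<epsilon> * t\<^sup>2"
    if t: "0 < t" "t < \<delta>" for t
  proof -
    have td: "t * (norm u + norm v + 1) < min d1 d2" using t n1 by (simp add: \<delta>_def pos_less_divide_eq)
    have near: "norm ((s * t) *\<^sub>R u + (r * t) *\<^sub>R v) < min d1 d2" if "0 \<le> s" "s \<le> 1" "0 \<le> r" "r \<le> 1" for s r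
    proof -
      have "norm ((s * t) *\<^sub>R u + (r * t) *\<^sub>R v) \<le> s * (t * norm u) + r * (t * norm v)"
        using norm_triangle_ineq[of "(s * t) *\<^sub>R u" "(r * t) *\<^sub>R v"] that t by (simp add: mult_ac)
      also have "\<dots> \<le> 1 * (t * norm u) + 1 * (t * norm v)"
        using that t by (intro add_mono mult_right_mono) auto
      also have "\<dots> \<le> t * (norm u + norm v + 1)" using t by (simp add: algebra_simps)
      finally show ?thesis using td by linarith
    qed
    have inU: "p + (s * t) *\<^sub>R u + (r * t) *\<^sub>R v \<in> U" if "0 \<le> s" "s \<le> 1" "0 \<le> r" "r \<le> 1" for s r
      using near[OF that] d2 by (auto simp: subset_iff dist_norm add.assoc norm_minus_commute)
    define F where "F s = f (p + (s * t) *\<^sub>R u + t *\<^sub>R v) - f (p + (s * t) *\<^sub>R u)" for s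
    define F' where "F' s = (g (p + (s * t) *\<^sub>R u + t *\<^sub>R v) - g (p + (s * t) *\<^sub>R u)) \<bullet> (t *\<^sub>R u)" for s
    have der: "(F has_derivative (\<lambda>k. k * F' s)) (at s)" if s: "0 \<le> s" "s \<le> 1" for s
    proof -
      have a: "((\<lambda>s. p + (s * t) *\<^sub>R u + t *\<^sub>R v) has_derivative (\<lambda>k. (k * t) *\<^sub>R u)) (at s)"
        by (auto intro!: derivative_eq_intros)
      have b: "((\<lambda>s. p + (s * t) *\<^sub>R u) has_derivative (\<lambda>k. (k * t) *\<^sub>R u)) (at s)"
        by (auto intro!: derivative_eq_intros)
      have "(F has_derivative (\<lambda>k. g (p + (s * t) *\<^sub>R u + t *\<^sub>R v) \<bullet> ((k * t) *\<^sub>R u) - g (p + (s * t) *\<^sub>R u) \<bullet> ((k * t) *\<^sub>R u))) (at s)"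
        unfolding F_def
        using has_derivative_compose[OF a f[OF inU[OF s, of 1, simplified]]]
          has_derivative_compose[OF b f[OF inU[OF s, of 0, simplified]]]
        by (intro has_derivative_diff) auto
      then show ?thesis by (simp add: F'_def inner_diff_left algebra_simps)
    qed
    obtain s where s: "0 < s" "s < 1" "F 1 - F 0 = F' s"
    proof -
      have "\<exists>x\<in>{0<..<1}. F 1 - F 0 = (1 - 0) * F' x"
      proof (rule mvt[of 0 1 F "\<lambda>x k. k * F' x"])
        show "continuous_on {0..1} F"
          by (intro continuous_at_imp_continuous_on ballI has_derivative_continuous[OF der]) auto
        show "(F has_derivative (\<lambda>k. k * F' x)) (at x)" if "0 < x" "x < 1" for x
          using der[of x] that by simp
      qed (auto intro!: bexI)
      then show ?thesis using that by auto
    qed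
    let ?y1 = "p + (s * t) *\<^sub>R u + t *\<^sub>R v" and ?y2 = "p + (s * t) *\<^sub>R u"
    have nu: "norm ((s * t) *\<^sub>R u) \<le> t * norm u" using s t by (simp add: mult_left_le_one_le)
    have r1: "norm (g ?y1 - g p - h (?y1 - p)) \<le> \<eta> * (t * norm u + t * norm v)"
    proof -
      have "norm (?y1 - p) < d1" using near[of s 1] s by (simp add: add.assoc)
      then have "norm (g ?y1 - g p - h (?y1 - p)) \<le> \<eta> * norm (?y1 - p)" by (rule d1)
      also have "norm (?y1 - p) \<le> t * norm u + t * norm v"
        using norm_triangle_ineq[of "(s * t) *\<^sub>R u" "t *\<^sub>R v"] nu t by (simp add: add.assoc)
      finally show ?thesis using \<eta> by simp
    qed
    have r2: "norm (g ?y2 - g p - h (?y2 - p)) \<le> \<eta> * (t * norm u)"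
    proof -
      have "norm (?y2 - p) < d1" using near[of s 0] s by simp
      then have "norm (g ?y2 - g p - h (?y2 - p)) \<le> \<eta> * norm (?y2 - p)" by (rule d1)
      also have "norm (?y2 - p) \<le> t * norm u" using nu by simp
      finally show ?thesis using \<eta> by simp
    qed
    have e: "g ?y1 - g ?y2 - h (t *\<^sub>R v) = (g ?y1 - g p - h (?y1 - p)) - (g ?y2 - g p - h (?y2 - p))"
    proof -
      have "h (?y1 - p) - h (?y2 - p) = h (t *\<^sub>R v)" by (simp add: h.diff[symmetric])
      then show ?thesis by (simp add: algebra_simps)
    qed
    have "norm (g ?y1 - g ?y2 - h (t *\<^sub>R v)) \<le> \<eta> * (t * norm u + t * norm v) + \<eta> * (t * norm u)"
      unfolding e using r1 r2 by (rule norm_triangle_le_diff[OF add_mono])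
    also have "\<dots> = \<eta> * ?c * t" by (simp add: algebra_simps)
    finally have r: "norm (g ?y1 - g ?y2 - h (t *\<^sub>R v)) \<le> \<eta> * ?c * t" .
    have "F 1 - F 0 - t\<^sup>2 * (h v \<bullet> u) = (g ?y1 - g ?y2 - h (t *\<^sub>R v)) \<bullet> (t *\<^sub>R u)"
      unfolding s(3) F'_def by (simp add: inner_diff_left h.scaleR power2_eq_square algebra_simps)
    then have "\<bar>F 1 - F 0 - t\<^sup>2 * (h v \<bullet> u)\<bar> \<le> norm (g ?y1 - g ?y2 - h (t *\<^sub>R v)) * norm (t *\<^sub>R u)"
      using Cauchy_Schwarz_ineq2 by metis
    also have "\<dots> \<le> (\<eta> * ?c * t) * norm (t *\<^sub>R u)" using r by (rule mult_right_mono) simp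
    also have "\<dots> = (\<eta> * ?c * norm u) * t\<^sup>2" using t by (simp add: power2_eq_square)
    also have "\<dots> \<le> \<epsilon> * t\<^sup>2" using \<eta>c by (rule mult_right_mono) simp
    finally show ?thesis by (simp add: F_def algebra_simps)
  qed
  then show ?thesis using \<delta> by blast
qed

text \<open>The second difference is symmetric in \<open>u\<close> and \<open>v\<close>, while its
  quotient by t^2 tends to h v \<bullet> u and also to h u \<bullet> v.\<close>

lemma hessian_symmetric:
  fixes f :: "'a::real_inner \<Rightarrow> real"
  assumes U: "open U" "p \<in> U"
    and f: "\<And>x. x \<in> U \<Longrightarrow> (f has_derivative (\<lambda>v. g x \<bullet> v)) (at x)"
    and g: "(g has_derivative h) (at p)"
  shows "h u \<bullet> v = h v \<bullet> u"
proof (rule ccontr)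
  assume ne: "h u \<bullet> v \<noteq> h v \<bullet> u"
  \<comment> \<open>Two errors of size \<epsilon> cannot bridge a gap of size 3 \<epsilon>.\<close>
  define \<epsilon> where "\<epsilon> = \<bar>h u \<bullet> v - h v \<bullet> u\<bar> / 3"
  have \<epsilon>: "\<epsilon> > 0" using ne by (simp add: \<epsilon>_def)
  obtain \<delta>1 where \<delta>1: "\<delta>1 > 0" "\<And>t. 0 < t \<Longrightarrow> t < \<delta>1 \<Longrightarrow>
     \<bar>f (p + t *\<^sub>R u + t *\<^sub>R v) - f (p + t *\<^sub>R u) - f (p + t *\<^sub>R v) + f p - t\<^sup>2 * (h v \<bullet> u)\<bar> \<le> \<epsilon> * t\<^sup>2"
    using second_difference_estimate[OF U f g \<epsilon>, of u v] by blast
  obtain \<delta>2 where \<delta>2: "\<delta>2 > 0" "\<And>t. 0 < t \<Longrightarrow> t < \<delta>2 \<Longrightarrow>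
     \<bar>f (p + t *\<^sub>R v + t *\<^sub>R u) - f (p + t *\<^sub>R v) - f (p + t *\<^sub>R u) + f p - t\<^sup>2 * (h u \<bullet> v)\<bar> \<le> \<epsilon> * t\<^sup>2"
    using second_difference_estimate[OF U f g \<epsilon>, of v u] by blast
  define t where "t = min \<delta>1 \<delta>2 / 2"
  have t: "0 < t" "t < \<delta>1" "t < \<delta>2" using \<delta>1 \<delta>2 by (auto simp: t_def)
  have "p + t *\<^sub>R v + t *\<^sub>R u = p + t *\<^sub>R u + t *\<^sub>R v" by (simp add: algebra_simps)
  then have "\<bar>t\<^sup>2 * (h u \<bullet> v) - t\<^sup>2 * (h v \<bullet> u)\<bar> \<le> 2 * (\<epsilon> * t\<^sup>2)"
    using \<delta>1(2)[OF t(1,2)] \<delta>2(2)[OF t(1,3)] by (simp only:)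
  then have "t\<^sup>2 * (3 * \<epsilon>) \<le> t\<^sup>2 * (2 * \<epsilon>)"
    by (simp add: \<epsilon>_def right_diff_distrib[symmetric] abs_mult)
  then show False using t \<epsilon> by simp
qed

section \<open>Gradient and Hessian from \<open>Ck_on\<close>\<close>

lemma has_derivative_grad:
  fixes f :: "'a::euclidean_space \<Rightarrow> real"
  assumes "f differentiable (at x)"
  shows "(f has_derivative (\<lambda>v. grad f x \<bullet> v)) (at x)"
proof -
  have d: "(f has_derivative frechet_derivative f (at x)) (at x)"
    using assms by (simp add: frechet_derivative_works)
  interpret l: linear "frechet_derivative f (at x)" using d by (rule has_derivative_linear)
  have "frechet_derivative f (at x) v = grad f x \<bullet> v" for v
  proof -
    have "frechet_derivative f (at x) v = frechet_derivative f (at x) (\<Sum>b\<in>Basis. (v \<bullet> b) *\<^sub>R b)"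
      by (simp add: euclidean_representation)
    also have "\<dots> = grad f x \<bullet> v"
      by (simp add: l.sum l.scaleR grad_def inner_sum_right inner_sum_left inner_commute[of v] mult.commute)
    finally show ?thesis .
  qed
  then show ?thesis using d by (simp add: has_derivative_eq_rhs[OF d] ext)
qed

lemma Ck_on_1_grad:
  assumes "Ck_on 1 UNIV \<phi>"
  shows "(\<phi> has_derivative (\<lambda>v. grad \<phi> x \<bullet> v)) (at x)" "continuous_on UNIV (grad \<phi>)"
proof -
  show "(\<phi> has_derivative (\<lambda>v. grad \<phi> x \<bullet> v)) (at x)"
    using assms by (intro has_derivative_grad) (simp add: One_nat_def)
  show "continuous_on UNIV (grad \<phi>)"
    unfolding grad_def using assms by (intro continuous_intros) (simp add: One_nat_def)
qed

lemma smooth_on_hessian: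
  fixes f :: "'a::euclidean_space \<Rightarrow> real"
  assumes U: "open U" and f: "smooth_on U f"
  obtains h where "\<And>x. x \<in> U \<Longrightarrow> (f has_derivative (\<lambda>v. grad f x \<bullet> v)) (at x)"
    "\<And>x. x \<in> U \<Longrightarrow> (grad f has_derivative h x) (at x)"
    "\<And>v. continuous_on U (\<lambda>x. h x v)"
proof -
  have C2: "Ck_on (Suc (Suc 0)) U f" using f by (simp add: smooth_on_def)
  define D where "D b x = frechet_derivative f (at x) b" for b x
  have D: "D b differentiable (at x)" "continuous_on U (\<lambda>x. frechet_derivative (D b) (at x) c)"
    if "b \<in> Basis" "c \<in> Basis" "x \<in> U" for b c x
  proof -
    have "D b = (\<lambda>x. frechet_derivative f (at x) b)" by (simp add: fun_eq_iff D_def)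
    then show "D b differentiable (at x)" "continuous_on U (\<lambda>x. frechet_derivative (D b) (at x) c)"
      using C2 that by auto
  qed
  define h where "h x v = (\<Sum>b\<in>Basis. (grad (D b) x \<bullet> v) *\<^sub>R b)" for x v
  have 1: "(f has_derivative (\<lambda>v. grad f x \<bullet> v)) (at x)" if "x \<in> U" for x
    using C2 that by (intro has_derivative_grad) auto
  have 2: "(grad f has_derivative h x) (at x)" if "x \<in> U" for x
  proof -
    have "grad f = (\<lambda>x. \<Sum>b\<in>Basis. D b x *\<^sub>R b)" by (auto simp: grad_def D_def)
    then show ?thesis unfolding h_def using that D
      by (auto intro!: has_derivative_sum has_derivative_scaleR_left has_derivative_grad)
  qed
  have 3: "continuous_on U (\<lambda>x. h x v)" for v
    unfolding h_def grad_def
  proof (intro continuous_intros)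
    fix b c :: 'a assume "b \<in> Basis" "c \<in> Basis"
    then show "continuous_on U (\<lambda>x. frechet_derivative (D b) (at x) c)"
      by (cases "U = {}") (use D in auto)
  qed
  show ?thesis using that 1 2 3 by blast
qed

section \<open>Integrals of partial derivatives over a slab\<close>

text \<open>Difference quotients of \<open>y\<close> integrate to \<open>0\<close> by translation invariance.\<close>

lemma integral_slab_derivative_zero:
  fixes y D :: "'a::euclidean_space \<Rightarrow> real"
  assumes e: "e \<in> Basis" and b: "b \<in> Basis" "b \<noteq> e"
    and der: "\<And>z. ((\<lambda>t. y (z + t *\<^sub>R b)) has_real_derivative D z) (at 0)"
    and D: "D \<in> borel_measurable borel" "\<And>z. \<bar>D z\<bar> \<le> B"
    and y: "y \<in> borel_measurable borel" "\<And>z. \<bar>y z\<bar> \<le> B"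
    and supp: "\<And>z. y z \<noteq> 0 \<Longrightarrow> norm (z - (z \<bullet> e) *\<^sub>R e) \<le> R"
  shows "integrable lborel (\<lambda>z. indicator {z. 0 \<le> z \<bullet> e \<and> z \<bullet> e < 1} z * D z)"
    "(\<integral>z. indicator {z. 0 \<le> z \<bullet> e \<and> z \<bullet> e < 1} z * D z \<partial>lborel) = 0"
proof -
  note [measurable] = D(1) y(1)
  define S where "S = {z. 0 \<le> z \<bullet> e \<and> z \<bullet> e < 1}"
  have [measurable]: "S \<in> sets borel" unfolding S_def by measurable
  define k where "k n = 1 / real (Suc n)" for n
  have k: "0 < k n" "k n \<le> 1" for n by (auto simp: k_def)
  define q where "q n z = indicator S z * ((y (z + k n *\<^sub>R b) - y z) / k n)" for n z
  \<comment> \<open>Orthogonality makes the slab invariant under shifts along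
    \<open>b\<close>.\<close>
  have be: "b \<bullet> e = 0" using b e by (simp add: inner_Basis)
  have B0: "B \<ge> 0" using y(2)[of 0] by linarith
  have line: "((\<lambda>t. y (z + t *\<^sub>R b)) has_real_derivative D (z + s *\<^sub>R b)) (at s)" for z s
  proof -
    have "((\<lambda>t. y (z + s *\<^sub>R b + t *\<^sub>R b)) has_real_derivative D (z + s *\<^sub>R b)) (at (s - s))"
      using der[of "z + s *\<^sub>R b"] by simp
    from DERIV_shift[THEN iffD1, of _ _ s "-s", simplified, OF this[simplified]]
    show ?thesis by (simp add: algebra_simps)
  qed
  have lip: "\<bar>y (z + t *\<^sub>R b) - y z\<bar> \<le> B * t" if t: "0 < t" for z t
  proof -
    obtain s where "y (z + t *\<^sub>R b) - y (z + 0 *\<^sub>R b) = (t - 0) * D (z + s *\<^sub>R b)"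
      using MVT2[OF t, of "\<lambda>t. y (z + t *\<^sub>R b)" "\<lambda>s. D (z + s *\<^sub>R b)"] line by blast
    then have "\<bar>y (z + t *\<^sub>R b) - y z\<bar> = t * \<bar>D (z + s *\<^sub>R b)\<bar>" using t by (simp add: abs_mult)
    also have "\<dots> \<le> t * B" using D(2) t by (intro mult_left_mono) auto
    finally show ?thesis by (simp add: mult.commute)
  qed
  \<comment> \<open>\<open>R\<close> bounds the part of the support transverse to \<open>e\<close>;
    one unit is added for the shift t b with t \<le> 1 and one for the height inside the slab. This
    ball and the Lipschitz bound \<open>B\<close> dominate all difference quotients.\<close>
  let ?K = "cball (0::'a) (R + 2)"
  have nz: "z \<in> ?K" if "z \<in> S" "y z \<noteq> 0 \<or> y (z + t *\<^sub>R b) \<noteq> 0" "0 \<le> t" "t \<le> 1" for z t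
  proof -
    have "norm (z - (z \<bullet> e) *\<^sub>R e) \<le> R + 1"
    proof (cases "y z = 0")
      case False then show ?thesis using supp[of z] by simp
    next
      case True
      then have "norm (z + t *\<^sub>R b - (z \<bullet> e) *\<^sub>R e) \<le> R"
        using supp[of "z + t *\<^sub>R b"] that be by (simp add: inner_add_left)
      moreover have "norm (t *\<^sub>R b) \<le> 1" using that b by simp
      moreover have "norm (z - (z \<bullet> e) *\<^sub>R e) \<le> norm (z + t *\<^sub>R b - (z \<bullet> e) *\<^sub>R e) + norm (t *\<^sub>R b)"
        using norm_triangle_ineq4[of "z + t *\<^sub>R b - (z \<bullet> e) *\<^sub>R e" "t *\<^sub>R b"] by (simp add: algebra_simps)
      ultimately show ?thesis by linarith
    qed
    moreover have "norm ((z \<bullet> e) *\<^sub>R e) \<le> 1" using that e by (simp add: S_def)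
    ultimately show ?thesis using norm_triangle_ineq[of "z - (z \<bullet> e) *\<^sub>R e" "(z \<bullet> e) *\<^sub>R e"] by simp
  qed
  have Kint: "integrable lborel (\<lambda>z. B * indicator ?K z :: real)"
    by (intro integrable_mult_right integrable_real_indicator) (use emeasure_lborel_cball_finite in auto)
  have ybd: "norm (indicator S z * y (z + t *\<^sub>R b)) \<le> norm (B * indicator ?K z :: real)" if "0 \<le> t" "t \<le> 1" for z t
    using nz[of z t] y(2)[of "z + t *\<^sub>R b"] that B0 by (auto simp: indicator_def)
  have yint: "integrable lborel (\<lambda>z. indicator S z * y (z + t *\<^sub>R b))" if "0 \<le> t" "t \<le> 1" for t
    by (rule Bochner_Integration.integrable_bound[OF Kint]) (use ybd[OF that] in auto)
  have yeq: "(\<integral>z. indicator S z * y (z + t *\<^sub>R b) \<partial>lborel) = (\<integral>z. indicator S z * y z \<partial>lborel)" for t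
  proof -
    have "(\<integral>z. indicator S z * y z \<partial>lborel) = (\<integral>z. indicator S z * y z \<partial>distr lborel borel ((+) (t *\<^sub>R b)))"
      by (simp add: lborel_distr_plus)
    also have "\<dots> = (\<integral>z. indicator S (t *\<^sub>R b + z) * y (t *\<^sub>R b + z) \<partial>lborel)"
      by (subst integral_distr) auto
    also have "\<dots> = (\<integral>z. indicator S z * y (z + t *\<^sub>R b) \<partial>lborel)"
      by (intro Bochner_Integration.integral_cong) (auto simp: S_def indicator_def inner_add_left be add.commute)
    finally show ?thesis by simp
  qed
  have q0: "(\<integral>z. q n z \<partial>lborel) = 0" for n
  proof -
    have "(\<integral>z. q n z \<partial>lborel) = (\<integral>z. (indicator S z * y (z + k n *\<^sub>R b) - indicator S z * y (z + 0 *\<^sub>R b)) / k n \<partial>lborel)"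
      by (intro Bochner_Integration.integral_cong) (auto simp: q_def right_diff_distrib diff_divide_distrib)
    also have "\<dots> = ((\<integral>z. indicator S z * y (z + k n *\<^sub>R b) \<partial>lborel) - (\<integral>z. indicator S z * y (z + 0 *\<^sub>R b) \<partial>lborel)) / k n"
      using yint[of "k n"] yint[of 0] k[of n] by (simp add: Bochner_Integration.integral_diff)
    finally show ?thesis using yeq[of "k n"] by simp
  qed
  have lim: "(\<lambda>n. q n z) \<longlonglongrightarrow> indicator S z * D z" for z
  proof -
    have "((\<lambda>t. (y (z + t *\<^sub>R b) - y z) / t) \<longlongrightarrow> D z) (at 0)"
      using der[of z] by (simp add: DERIV_def)
    moreover have "filterlim k (at 0) sequentially"
    proof -
      have "k \<longlonglongrightarrow> 0"
        unfolding k_def[abs_def] using LIMSEQ_inverse_real_of_nat by (simp add: inverse_eq_divide)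
      then show ?thesis unfolding filterlim_at using k by (auto simp: less_imp_neq[symmetric] dest: less_imp_neq)
    qed
    ultimately have "(\<lambda>n. (y (z + k n *\<^sub>R b) - y z) / k n) \<longlonglongrightarrow> D z"
      by (rule filterlim_compose)
    then show ?thesis unfolding q_def by (intro tendsto_intros)
  qed
  have qbd: "norm (q n z) \<le> B * indicator ?K z" for n z
  proof (cases "q n z = 0")
    case False
    then have "z \<in> S" "y z \<noteq> 0 \<or> y (z + k n *\<^sub>R b) \<noteq> 0" by (auto simp: q_def indicator_def split: if_splits)
    then have "z \<in> ?K" using nz[of z "k n"] k[of n] by simp
    moreover have "\<bar>(y (z + k n *\<^sub>R b) - y z) / k n\<bar> \<le> B"
      using lip[OF k(1), of z n] k(1)[of n] by (simp add: abs_divide pos_divide_le_eq)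
    ultimately show ?thesis using \<open>z \<in> S\<close> by (simp add: q_def)
  qed (use B0 in simp)
  have qm: "q n \<in> borel_measurable lborel" for n unfolding q_def by measurable
  have Dm: "(\<lambda>z. indicator S z * D z) \<in> borel_measurable lborel" by measurable
  have "(\<lambda>n. \<integral>z. q n z \<partial>lborel) \<longlonglongrightarrow> (\<integral>z. indicator S z * D z \<partial>lborel)"
    by (rule integral_dominated_convergence[OF Dm qm Kint]) (use lim qbd in auto)
  then show "(\<integral>z. indicator {z. 0 \<le> z \<bullet> e \<and> z \<bullet> e < 1} z * D z \<partial>lborel) = 0"
    using q0 by (simp add: LIMSEQ_const_iff S_def)
  show "integrable lborel (\<lambda>z. indicator {z. 0 \<le> z \<bullet> e \<and> z \<bullet> e < 1} z * D z)"
    unfolding S_def[symmetric]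
    by (rule integrable_dominated_convergence[where s=q, OF Dm qm Kint]) (use lim qbd in auto)
qed

section \<open>Charts of a hypersurface\<close>

text \<open>The sign condition on g \<bullet> e makes M \<inter> W a graph over the orthogonal
  complement of \<open>e\<close>; convexity of \<open>W\<close> keeps segments parallel to
  \<open>e\<close> inside it. The sign of \<open>f\<close> is chosen so that the given normal is the
  normalised gradient itself.\<close>

locale hypersurface_chart =
  fixes M :: "'a::euclidean_space set" and \<nu> :: "'a \<Rightarrow> 'a" and f :: "'a \<Rightarrow> real"
    and g :: "'a \<Rightarrow> 'a" and h :: "'a \<Rightarrow> 'a \<Rightarrow> 'a" and e :: 'a and W :: "'a set"
  assumes e: "e \<in> Basis" and W: "open W" "convex W"
    and f: "\<And>x. x \<in> W \<Longrightarrow> (f has_derivative (\<lambda>v. g x \<bullet> v)) (at x)"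
    and g: "\<And>x. x \<in> W \<Longrightarrow> (g has_derivative h x) (at x)"
    and h: "\<And>v. continuous_on W (\<lambda>x. h x v)"
    and ge_sign: "(\<forall>x\<in>W. g x \<bullet> e > 0) \<or> (\<forall>x\<in>W. g x \<bullet> e < 0)"
    and MW: "M \<inter> W = {x\<in>W. f x = 0}"
    and nu: "\<And>x. x \<in> M \<inter> W \<Longrightarrow> \<nu> x = g x /\<^sub>R norm (g x)"
begin

definition N where "N x = g x /\<^sub>R norm (g x)"
definition Q where "Q z = z - (z \<bullet> e) *\<^sub>R e"
text \<open>The map of the implicit function theorem: the coordinate along \<open>e\<close> is
  replaced by the value of \<open>f\<close>, so that M \<inter> W is straightened into the
  hyperplane orthogonal to \<open>e\<close>.\<close>

definition \<Psi> where "\<Psi> z = Q z + f z *\<^sub>R e"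
definition C where "C = {z. Q z \<in> \<Psi> ` W}"
text \<open>\<open>pr\<close> projects the cylinder \<open>C\<close> onto the graph \<open>M \<inter> W\<close> along \<open>e\<close>; \<open>P x\<close> and \<open>DN x\<close> are the
  derivatives of \<open>pr\<close> (at any point over \<open>x\<close>) and of \<open>N\<close>.\<close>
definition pr where "pr z = inv_into W \<Psi> (Q z)"
definition P where "P x v = v - ((N x \<bullet> v) / (N x \<bullet> e)) *\<^sub>R e"
definition DN where "DN x k = (h x k - (N x \<bullet> h x k) *\<^sub>R N x) /\<^sub>R norm (g x)"
text \<open>The full ambient trace. It agrees with the tangential one because \<open>N\<close> has
  constant length, which makes the normal component of \<open>DN\<close> zero.\<close>

definition H where "H x = (\<Sum>b\<in>Basis. DN x b \<bullet> b)"

lemma ee: "e \<bullet> e = 1" "norm e = 1" using e by auto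

lemma ge: "x \<in> W \<Longrightarrow> g x \<bullet> e \<noteq> 0"
  using ge_sign by force

lemma g0: "x \<in> W \<Longrightarrow> g x \<noteq> 0"
  using ge by fastforce

lemma N: "x \<in> W \<Longrightarrow> N x \<bullet> N x = 1" "x \<in> W \<Longrightarrow> norm (N x) = 1" "x \<in> W \<Longrightarrow> N x \<bullet> e \<noteq> 0"
  using g0 ge by (auto simp: N_def dot_square_norm)

lemma nuN: "x \<in> M \<inter> W \<Longrightarrow> \<nu> x = N x"
  using nu by (simp add: N_def)

lemma cont_g: "continuous_on W g"
  by (meson W continuous_at_imp_continuous_on g has_derivative_continuous)

lemma cont_f: "continuous_on W f"
  by (meson W continuous_at_imp_continuous_on f has_derivative_continuous)

lemma cont_N: "continuous_on W N"
  unfolding N_def using g0 by (auto intro!: continuous_intros cont_g)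

lemma linear_h: "x \<in> W \<Longrightarrow> linear (h x)"
  using g has_derivative_linear by blast

lemma cont_h:
  assumes S: "S \<subseteq> W" and k: "continuous_on S k"
  shows "continuous_on S (\<lambda>x. h x (k x))"
proof -
  have "h x (k x) = (\<Sum>b\<in>Basis. (k x \<bullet> b) *\<^sub>R h x b)" if "x \<in> S" for x
  proof -
    interpret linear "h x" using linear_h that S by blast
    have "h x (k x) = h x (\<Sum>b\<in>Basis. (k x \<bullet> b) *\<^sub>R b)" by (simp add: euclidean_representation)
    then show ?thesis by (simp add: sum scaleR)
  qed
  moreover have "continuous_on S (\<lambda>x. \<Sum>b\<in>Basis. (k x \<bullet> b) *\<^sub>R h x b)"
    using continuous_on_subset[OF h S] by (intro continuous_intros k)
  ultimately show ?thesis by (simp cong: continuous_on_cong)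
qed

lemma cont_DN:
  assumes S: "S \<subseteq> W" and k: "continuous_on S k"
  shows "continuous_on S (\<lambda>x. DN x (k x))"
  unfolding DN_def
  using g0 S by (auto intro!: continuous_intros cont_h[OF S k] continuous_on_subset[OF cont_N S] continuous_on_subset[OF cont_g S])

lemma linear_DN: "x \<in> W \<Longrightarrow> linear (DN x)"
proof -
  assume "x \<in> W"
  then interpret linear "h x" by (rule linear_h)
  show ?thesis by (rule linearI) (auto simp: DN_def add scaleR inner_add_right algebra_simps)
qed

lemma deriv_N:
  assumes x: "x \<in> W"
  shows "(N has_derivative DN x) (at x)"
proof -
  have n: "((\<lambda>x. norm (g x)) has_derivative (\<lambda>k. h x k \<bullet> N x)) (at x)"
    using has_derivative_compose[OF g[OF x] has_derivative_norm[OF g0[OF x]]] by (simp add: N_def sgn_div_norm)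
  have "(N has_derivative (\<lambda>k. inverse (norm (g x)) *\<^sub>R h x k
      + (- (inverse (norm (g x)) * (h x k \<bullet> N x) * inverse (norm (g x)))) *\<^sub>R g x)) (at x)"
    unfolding N_def
    by (rule has_derivative_scaleR[OF Deriv.has_derivative_inverse[OF _ n[unfolded N_def]] g[OF x]]) (use g0[OF x] in simp)
  moreover have "inverse (norm (g x)) *\<^sub>R h x k
      + (- (inverse (norm (g x)) * (h x k \<bullet> N x) * inverse (norm (g x)))) *\<^sub>R g x = DN x k" for k
    by (simp add: DN_def N_def inner_commute algebra_simps)
  ultimately show ?thesis by simp
qed

lemma N_DN: "x \<in> W \<Longrightarrow> N x \<bullet> DN x k = 0"
  using N by (simp add: DN_def inner_diff_right)

text \<open>Two points with the same image differ by a multiple of \<open>e\<close> and share the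
  value of \<open>f\<close>, so the mean value theorem on their segment would give a zero of g
  \<bullet> e in \<open>W\<close>.\<close>

lemma inj_\<Psi>: "inj_on \<Psi> W"
proof (rule inj_onI, rule ccontr)
  fix x y assume x: "x \<in> W" and y: "y \<in> W" and eq: "\<Psi> x = \<Psi> y" and ne: "x \<noteq> y"
  have "\<Psi> z \<bullet> e = f z" for z by (simp add: \<Psi>_def Q_def inner_add_left inner_diff_left ee)
  with eq have feq: "f x = f y" by metis
  with eq have "Q x = Q y" by (simp add: \<Psi>_def)
  then have xy: "x - y = (x \<bullet> e - y \<bullet> e) *\<^sub>R e" by (simp add: Q_def algebra_simps)
  define c where "c = x \<bullet> e - y \<bullet> e"
  have c: "c \<noteq> 0" using xy ne by (auto simp: c_def)
  have inW: "y + t *\<^sub>R (x - y) \<in> W" if "0 \<le> t" "t \<le> 1" for t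
    using convexD_alt[OF W(2) y x that] by (simp add: algebra_simps)
  have der: "((\<lambda>t. f (y + t *\<^sub>R (x - y))) has_derivative (\<lambda>k. g (y + t *\<^sub>R (x - y)) \<bullet> (k *\<^sub>R (x - y)))) (at t)"
    if "0 \<le> t" "t \<le> 1" for t
  proof -
    have "((\<lambda>t. y + t *\<^sub>R (x - y)) has_derivative (\<lambda>k. k *\<^sub>R (x - y))) (at t)"
      by (auto intro!: derivative_eq_intros)
    from has_derivative_compose[OF this f[OF inW[OF that]]] show ?thesis .
  qed
  have "\<exists>t\<in>{0<..<1}. f (y + 1 *\<^sub>R (x - y)) - f (y + 0 *\<^sub>R (x - y)) = g (y + t *\<^sub>R (x - y)) \<bullet> ((1 - 0) *\<^sub>R (x - y))"
  proof (rule mvt[of 0 1 "\<lambda>t. f (y + t *\<^sub>R (x - y))" "\<lambda>t k. g (y + t *\<^sub>R (x - y)) \<bullet> (k *\<^sub>R (x - y))"])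
    show "continuous_on {0..1} (\<lambda>t. f (y + t *\<^sub>R (x - y)))"
      by (intro continuous_at_imp_continuous_on ballI has_derivative_continuous[OF der]) auto
    show "((\<lambda>t. f (y + t *\<^sub>R (x - y))) has_derivative (\<lambda>k. g (y + t *\<^sub>R (x - y)) \<bullet> (k *\<^sub>R (x - y)))) (at t)"
      if "0 < t" "t < 1" for t using der[of t] that by simp
  qed (auto intro!: bexI)
  then obtain t where t: "0 < t" "t < 1" "g (y + t *\<^sub>R (x - y)) \<bullet> (x - y) = 0" using feq by auto
  then have "c * (g (y + t *\<^sub>R (x - y)) \<bullet> e) = 0" unfolding c_def using xy by (metis inner_scaleR_right)
  then show False using c ge[OF inW[of t]] t by simp
qed

lemma cont_\<Psi>: "continuous_on W \<Psi>"
  unfolding \<Psi>_def Q_def by (intro continuous_intros cont_f)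

lemma open_C: "open C"
proof -
  have "open (\<Psi> ` W)" by (rule invariance_of_domain_gen) (use W cont_\<Psi> inj_\<Psi> in auto)
  moreover have "continuous_on UNIV Q" unfolding Q_def by (intro continuous_intros)
  ultimately have "open (Q -` (\<Psi> ` W))" by (simp add: continuous_on_open_vimage)
  then show ?thesis by (simp add: C_def vimage_def)
qed

lemma Q_shift: "Q (z + t *\<^sub>R e) = Q z"
  by (simp add: Q_def inner_add_left ee algebra_simps)

lemma C_shift: "z + t *\<^sub>R e \<in> C \<longleftrightarrow> z \<in> C"
  by (simp add: C_def Q_shift)

lemma pr_shift: "pr (z + t *\<^sub>R e) = pr z"
  by (simp add: pr_def Q_shift)

lemma pr_props:
  assumes z: "z \<in> C"
  shows "pr z \<in> M \<inter> W" "Q (pr z) = Q z" "\<Psi> (pr z) = Q z"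
proof -
  have 1: "pr z \<in> W" "\<Psi> (pr z) = Q z"
    using z by (auto simp: C_def pr_def inv_into_into f_inv_into_f)
  have "\<Psi> w \<bullet> e = f w" for w by (simp add: \<Psi>_def Q_def inner_add_left inner_diff_left ee)
  moreover have "Q z \<bullet> e = 0" by (simp add: Q_def inner_diff_left ee)
  ultimately have f0: "f (pr z) = 0" using 1 by metis
  then show "pr z \<in> M \<inter> W" using 1 MW by blast
  show "\<Psi> (pr z) = Q z" by (rule 1)
  then show "Q (pr z) = Q z" using f0 by (simp add: \<Psi>_def)
qed

lemma on_M:
  assumes x: "x \<in> M \<inter> W"
  shows "x \<in> C" "pr x = x"
proof -
  have "Q x = \<Psi> x" "x \<in> W" using x MW by (auto simp: \<Psi>_def)
  then show "x \<in> C" "pr x = x" using inj_\<Psi> by (auto simp: C_def pr_def)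
qed

lemma pr_eq: "x \<in> M \<inter> W \<Longrightarrow> Q z = Q x \<Longrightarrow> z \<in> C \<and> pr z = x"
  using on_M[of x] by (simp add: C_def pr_def)

lemma deriv_pr:
  assumes z: "z \<in> C"
  shows "(pr has_derivative P (pr z)) (at z)"
proof -
  let ?x = "pr z"
  have x: "?x \<in> W" using pr_props[OF z] by blast
  define A where "A y v = Q v + (g y \<bullet> v) *\<^sub>R e" for y v
  \<comment> \<open>The inverse of \<open>A ?x\<close>: the correction along \<open>e\<close> is
    fixed by requiring that \<open>g ?x\<close> see the e-component of \<open>w\<close>.\<close>
  define B where "B w = w + ((w \<bullet> e - g ?x \<bullet> w) / (g ?x \<bullet> e)) *\<^sub>R e" for w
  have dQ: "(Q has_derivative Q) (at y)" for y
    unfolding Q_def by (auto intro!: derivative_eq_intros)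
  have A: "(\<Psi> has_derivative A y) (at y)" if "y \<in> W" for y
    unfolding \<Psi>_def A_def using dQ f[OF that] by (intro has_derivative_add has_derivative_scaleR_left)
  have AB: "A ?x \<circ> B = id"
  proof
    fix v
    define s where "s = (v \<bullet> e - g ?x \<bullet> v) / (g ?x \<bullet> e)"
    have "s * (g ?x \<bullet> e) = v \<bullet> e - g ?x \<bullet> v" using ge[OF x] by (simp add: s_def)
    then have "A ?x (v + s *\<^sub>R e) = v"
      by (simp add: A_def Q_shift inner_add_right) (simp add: Q_def)
    then show "(A ?x \<circ> B) v = id v" by (simp add: B_def s_def)
  qed
  have "(inv_into W \<Psi> has_derivative B) (at (\<Psi> ?x))"
    by (rule has_derivative_inverse_on[where S=W and f'=A and g'="\<lambda>_. B", OF W(1) A _ AB x])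
      (use inj_\<Psi> in auto)
  then have "(inv_into W \<Psi> has_derivative B) (at (Q z))" using pr_props(3)[OF z] by simp
  from has_derivative_compose[OF dQ[of z] this]
  have "(pr has_derivative (\<lambda>v. B (Q v))) (at z)" by (simp add: pr_def[abs_def])
  moreover have "B (Q v) = P ?x v" for v
  proof -
    have "(g ?x \<bullet> v) / (g ?x \<bullet> e) = (N ?x \<bullet> v) / (N ?x \<bullet> e)" using g0[OF x] by (simp add: N_def)
    moreover have "Q v \<bullet> e = 0" by (simp add: Q_def inner_diff_left ee)
    moreover have "g ?x \<bullet> Q v = g ?x \<bullet> v - (v \<bullet> e) * (g ?x \<bullet> e)" by (simp add: Q_def inner_diff_right)
    ultimately show ?thesis using ge[OF x] by (simp add: B_def P_def) (simp add: Q_def diff_divide_distrib algebra_simps)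
  qed
  ultimately show ?thesis by simp
qed

lemma cont_pr: "continuous_on C pr"
  by (meson continuous_at_imp_continuous_on deriv_pr has_derivative_continuous)

section \<open>Tangent vectors and mean curvature in a chart\<close>

lemma P_e: "x \<in> W \<Longrightarrow> P x e = 0"
  using N by (simp add: P_def)

lemma P_tangent: "N x \<bullet> v = 0 \<Longrightarrow> P x v = v"
  by (simp add: P_def)

text \<open>Realises every vector orthogonal to \<open>N x\<close> as the velocity of a curve in M:
  the straight line is pushed back to M by \<open>pr\<close>, whose derivative fixes tangent
  vectors. These curves show that a unit normal field is parallel to \<open>N\<close> and that its
  tangential derivative is well defined.\<close>

lemma M_curve:
  assumes x: "x \<in> M \<inter> W" and v: "N x \<bullet> v = 0"
  shows "\<exists>\<delta>>0. \<forall>t\<in>{-\<delta><..<\<delta>}. pr (x + t *\<^sub>R v) \<in> M"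
    "((\<lambda>t. pr (x + t *\<^sub>R v)) has_derivative (\<lambda>t. t *\<^sub>R v)) (at 0)"
proof -
  have "continuous_on UNIV (\<lambda>t::real. x + t *\<^sub>R v)" by (intro continuous_intros)
  then have op: "open ((\<lambda>t. x + t *\<^sub>R v) -` C)" using open_C by (simp add: continuous_on_open_vimage)
  have "0 \<in> (\<lambda>t. x + t *\<^sub>R v) -` C" using on_M[OF x] by simp
  then obtain \<delta> where \<delta>: "\<delta> > 0" "ball 0 \<delta> \<subseteq> (\<lambda>t. x + t *\<^sub>R v) -` C"
    using op open_contains_ball by blast
  have "pr (x + t *\<^sub>R v) \<in> M" if "t \<in> {-\<delta><..<\<delta>}" for t
    using \<delta>(2) that pr_props(1)[of "x + t *\<^sub>R v"] by (auto simp: subset_iff dist_norm)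
  then show "\<exists>\<delta>>0. \<forall>t\<in>{-\<delta><..<\<delta>}. pr (x + t *\<^sub>R v) \<in> M" using \<delta>(1) by blast
  have d: "((\<lambda>t. x + t *\<^sub>R v) has_derivative (\<lambda>t. t *\<^sub>R v)) (at 0)"
    by (auto intro!: derivative_eq_intros)
  have pd: "(pr has_derivative P (pr (x + 0 *\<^sub>R v))) (at (x + 0 *\<^sub>R v))"
    by (rule deriv_pr) (use on_M[OF x] in simp)
  have "P x (t *\<^sub>R v) = t *\<^sub>R v" for t using v by (intro P_tangent) simp
  then show "((\<lambda>t. pr (x + t *\<^sub>R v)) has_derivative (\<lambda>t. t *\<^sub>R v)) (at 0)"
    using has_derivative_compose[OF d pd] on_M[OF x] by simp
qed

lemma deriv_nu:
  assumes x: "x \<in> M \<inter> W"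
  shows "(\<nu> has_derivative DN x) (at x within M)"
proof -
  obtain d where d: "d > 0" "ball x d \<subseteq> W" using x W open_contains_ball by blast
  show ?thesis
  proof (rule has_derivative_transform_within[OF has_derivative_at_withinI[OF deriv_N] d(1)])
    fix x' assume "x' \<in> M" "dist x' x < d"
    then have "x' \<in> M \<inter> W" using d by (auto simp: subset_iff dist_commute)
    then show "N x' = \<nu> x'" by (simp add: nuN)
  qed (use x in auto)
qed

text \<open>A derivative within M is not determined in the normal direction, so
  \<open>frechet_derivative\<close> may pick any of several maps. Composition with curves in M pins
  down its tangential values, and \<open>mean_curv\<close> evaluates it only on projected
  vectors.\<close>

lemma deriv_nu_unique:
  assumes x: "x \<in> M \<inter> W" and v: "N x \<bullet> v = 0"
    and D: "(\<nu> has_derivative D) (at x within M)"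
  shows "D v = DN x v"
proof -
  obtain \<delta> where \<delta>: "\<delta> > 0" "\<forall>t\<in>{-\<delta><..<\<delta>}. pr (x + t *\<^sub>R v) \<in> M"
    using M_curve(1)[OF x v] by blast
  let ?c = "\<lambda>t. pr (x + t *\<^sub>R v)" and ?T = "{-\<delta><..<\<delta>}"
  have c0: "?c 0 = x" using on_M[OF x] by simp
  have cT: "?c ` ?T \<subseteq> M" using \<delta>(2) by blast
  have cd: "(?c has_derivative (\<lambda>t. t *\<^sub>R v)) (at 0 within ?T)"
    using M_curve(2)[OF x v] by (rule has_derivative_at_withinI)
  have "(\<nu> \<circ> ?c has_derivative D' \<circ> (\<lambda>t. t *\<^sub>R v)) (at 0)" if D': "(\<nu> has_derivative D') (at x within M)" for D'
  proof -
    have "(\<nu> has_derivative D') (at (?c 0) within ?c ` ?T)"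
      using has_derivative_subset[OF D' cT] c0 by simp
    from diff_chain_within[OF cd this] show ?thesis
      using \<delta>(1) by (simp add: at_within_open[of 0 ?T])
  qed
  from has_derivative_unique[OF this[OF D] this[OF deriv_nu[OF x]]]
  have "(D \<circ> (\<lambda>t. t *\<^sub>R v)) 1 = (DN x \<circ> (\<lambda>t. t *\<^sub>R v)) 1" by (rule arg_cong)
  then show ?thesis by simp
qed

lemma sum_Basis_inner: "(\<Sum>b\<in>Basis. (x \<bullet> b) * (y \<bullet> b)) = x \<bullet> y"
  by (rule euclidean_inner[symmetric])

lemma linear_trace_shift:
  assumes "linear A"
  shows "(\<Sum>b\<in>Basis. (w \<bullet> b) * (A k \<bullet> b)) = A k \<bullet> w"
  using sum_Basis_inner[of w "A k"] by (simp add: inner_commute)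

lemma mean_curv_eq:
  assumes x: "x \<in> M \<inter> W"
  shows "mean_curv M \<nu> x = H x"
proof -
  have xW: "x \<in> W" using x by simp
  interpret D: linear "DN x" by (rule linear_DN[OF xW])
  have "\<nu> differentiable (at x within M)" using deriv_nu[OF x] by (auto simp: differentiable_def)
  then have fd: "(\<nu> has_derivative frechet_derivative \<nu> (at x within M)) (at x within M)"
    by (simp add: frechet_derivative_works)
  have tp: "tproj \<nu> x b = b - (b \<bullet> N x) *\<^sub>R N x" for b
    by (simp add: tproj_def nuN[OF x])
  have "N x \<bullet> tproj \<nu> x b = 0" for b
    by (simp add: tp inner_diff_right N[OF xW] inner_commute)
  then have "mean_curv M \<nu> x = (\<Sum>b\<in>Basis. DN x (tproj \<nu> x b) \<bullet> tproj \<nu> x b)"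
    unfolding mean_curv_def using deriv_nu_unique[OF x _ fd] by simp
  also have "\<dots> = (\<Sum>b\<in>Basis. DN x b \<bullet> b - (N x \<bullet> b) * (DN x (N x) \<bullet> b))"
    using N_DN[OF xW] by (intro sum.cong refl)
      (simp add: tp D.diff D.scaleR inner_diff_left inner_diff_right inner_commute[of _ "N x"])
  also have "\<dots> = H x - DN x (N x) \<bullet> N x"
    by (simp add: sum_subtractf H_def linear_trace_shift[OF linear_DN[OF xW]])
  also have "DN x (N x) \<bullet> N x = 0" using N_DN[OF xW] by (simp add: inner_commute)
  finally show ?thesis by simp
qed

lemma cont_H: "continuous_on W H"
  unfolding H_def by (intro continuous_intros cont_DN[OF subset_refl])

lemma h_sym: "x \<in> W \<Longrightarrow> h x u \<bullet> v = h x v \<bullet> u"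
  using hessian_symmetric[OF W(1) _ f g] by blast

end

section \<open>The divergence theorem in a chart\<close>

text \<open>The tangential divergence of \<open>\<psi> x - \<psi> (x \<bullet> \<nu>) \<nu>\<close>, i.e. \<open>div\<^sub>T (\<psi> x) - H \<psi> (x \<bullet> \<nu>)\<close>, where
  \<open>G\<close> is the gradient of \<open>\<psi>\<close>, \<open>u\<close> the normal and \<open>\<eta>\<close> the mean curvature.\<close>

definition radial_div :: "('a::euclidean_space \<Rightarrow> 'a) \<Rightarrow> ('a \<Rightarrow> real) \<Rightarrow> ('a \<Rightarrow> real) \<Rightarrow> ('a \<Rightarrow> 'a) \<Rightarrow> 'a \<Rightarrow> real" where
  "radial_div u \<eta> \<psi> G x = G x \<bullet> x + (real DIM('a) - 1) * \<psi> x - (x \<bullet> u x) * (G x \<bullet> u x) - \<psi> x * (x \<bullet> u x) * \<eta> x"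

context hypersurface_chart
begin

text \<open>The tangential part of the radial field \<psi> x, written with the extended normal
  \<open>N\<close> so that it can be differentiated in \<open>W\<close>.\<close>

definition vf where "vf \<psi> x = \<psi> x *\<^sub>R x - (\<psi> x * (x \<bullet> N x)) *\<^sub>R N x"
definition dvf where "dvf \<psi> G x k = (G x \<bullet> k) *\<^sub>R x + \<psi> x *\<^sub>R k
   - ((G x \<bullet> k) * (x \<bullet> N x) + \<psi> x * (k \<bullet> N x + x \<bullet> DN x k)) *\<^sub>R N x - (\<psi> x * (x \<bullet> N x)) *\<^sub>R DN x k"
text \<open>The quotient rule for the component along \<open>b\<close> of \<open>vf \<psi>\<close>
  divided by N \<bullet> e, the field whose ordinary divergence is taken in the chart.\<close>

definition dY where "dY \<psi> G b x k = (dvf \<psi> G x k \<bullet> b) / (N x \<bullet> e)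
   - (vf \<psi> x \<bullet> b) * (DN x k \<bullet> e) / (N x \<bullet> e)\<^sup>2"

lemma deriv_vf:
  assumes x: "x \<in> W" and \<psi>: "(\<psi> has_derivative (\<lambda>v. G x \<bullet> v)) (at x)"
  shows "(vf \<psi> has_derivative dvf \<psi> G x) (at x)"
  unfolding vf_def[abs_def] dvf_def[abs_def]
  by (rule derivative_eq_intros \<psi> deriv_N[OF x] refl | simp add: algebra_simps fun_eq_iff)+

lemma deriv_Y:
  assumes x: "x \<in> W" and \<psi>: "(\<psi> has_derivative (\<lambda>v. G x \<bullet> v)) (at x)"
  shows "((\<lambda>x. (vf \<psi> x \<bullet> b) / (N x \<bullet> e)) has_derivative dY \<psi> G b x) (at x)"
  unfolding dY_def[abs_def]
  by (rule derivative_eq_intros deriv_vf[where G=G and \<psi>=\<psi>, OF x \<psi>] deriv_N[OF x] refl | use N(3)[OF x] in \<open>simp add: field_simps power2_eq_square fun_eq_iff\<close>)+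

lemma linear_dvf:
  assumes x: "x \<in> W"
  shows "linear (dvf \<psi> G x)"
proof -
  interpret D: linear "DN x" by (rule linear_DN[OF x])
  show ?thesis
    by (rule linearI) (simp_all add: dvf_def D.add D.scaleR inner_add_left inner_add_right algebra_simps)
qed

lemma vf_N: "x \<in> W \<Longrightarrow> vf \<psi> x \<bullet> N x = 0"
  using N by (simp add: vf_def inner_diff_left)

text \<open>\<open>P x\<close> differs from the identity by a map of rank one with values in the
  line of \<open>e\<close>, so the trace changes by a single term.\<close>

lemma linear_sum_P:
  assumes x: "x \<in> W" and A: "linear A"
  shows "(\<Sum>b\<in>Basis. A (P x b) \<bullet> b) = (\<Sum>b\<in>Basis. A b \<bullet> b) - (A e \<bullet> N x) / (N x \<bullet> e)"
proof -
  interpret linear A by (rule A)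
  have "A (P x b) \<bullet> b = A b \<bullet> b - ((N x \<bullet> b) * (A e \<bullet> b)) / (N x \<bullet> e)" for b
    by (simp add: P_def diff scaleR inner_diff_left)
  then show ?thesis
    by (simp add: sum_subtractf sum_divide_distrib[symmetric] linear_trace_shift[OF A])
qed

text \<open>The left side is the flat divergence of \<open>vf \<psi>\<close> / (N \<bullet> e)
  extended constantly along \<open>e\<close>, since \<open>P\<close> is the derivative of
  \<open>pr\<close>. Apart from the tangential divergence, derivatives of the normal are left over:
  from the trace, from the projection, and from the quotient rule. They cancel because the Hessian
  of \<open>f\<close> is symmetric.\<close>

lemma sum_dY:
  assumes x: "x \<in> W"
  shows "(\<Sum>b\<in>Basis. dY \<psi> G b x (P x b)) = radial_div N H \<psi> G x / (N x \<bullet> e)"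
proof -
  interpret D: linear "DN x" by (rule linear_DN[OF x])
  interpret L: linear "dvf \<psi> G x" by (rule linear_dvf[OF x])
  have Nx: "N x \<bullet> N x = 1" "N x \<bullet> e \<noteq> 0" using N[OF x] by auto
  define q where "q = 1 / (N x \<bullet> e)"
  have qe: "q * (N x \<bullet> e) = 1" using Nx by (simp add: q_def)
  have ND: "N x \<bullet> DN x k = 0" "DN x k \<bullet> N x = 0" for k using N_DN[OF x] by (auto simp: inner_commute)
  have Ae: "dvf \<psi> G x e \<bullet> N x = - \<psi> x * (x \<bullet> DN x e)"
    using Nx ND by (simp add: dvf_def inner_diff_left inner_add_left inner_commute[of x "N x"] inner_commute[of e "N x"] algebra_simps)
  have s1: "(\<Sum>b\<in>Basis. (G x \<bullet> b) * (x \<bullet> b)) = G x \<bullet> x" by (rule sum_Basis_inner)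
  have s2: "(\<Sum>b\<in>Basis. (G x \<bullet> b) * (N x \<bullet> b)) = G x \<bullet> N x" by (rule sum_Basis_inner)
  have s3: "(\<Sum>b\<in>Basis. (N x \<bullet> b) * (N x \<bullet> b)) = 1" using sum_Basis_inner[of "N x" "N x"] Nx by simp
  have s4: "(\<Sum>b\<in>Basis. (x \<bullet> DN x b) * (N x \<bullet> b)) = x \<bullet> DN x (N x)"
  proof -
    have "DN x (N x) = DN x (\<Sum>b\<in>Basis. (N x \<bullet> b) *\<^sub>R b)" by (simp add: euclidean_representation)
    then show ?thesis by (simp add: D.sum D.scaleR inner_sum_right mult.commute)
  qed
  have "dvf \<psi> G x b \<bullet> b = (G x \<bullet> b) * (x \<bullet> b) + \<psi> x
      - (x \<bullet> N x) * ((G x \<bullet> b) * (N x \<bullet> b)) - \<psi> x * ((N x \<bullet> b) * (N x \<bullet> b)) - \<psi> x * ((x \<bullet> DN x b) * (N x \<bullet> b))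
      - (\<psi> x * (x \<bullet> N x)) * (DN x b \<bullet> b)" if "b \<in> Basis" for b
    using that by (simp add: dvf_def inner_diff_left inner_add_left inner_commute[of b "N x"] algebra_simps)
  then have "(\<Sum>b\<in>Basis. dvf \<psi> G x b \<bullet> b) = (\<Sum>b\<in>Basis. (G x \<bullet> b) * (x \<bullet> b) + \<psi> x
      - (x \<bullet> N x) * ((G x \<bullet> b) * (N x \<bullet> b)) - \<psi> x * ((N x \<bullet> b) * (N x \<bullet> b)) - \<psi> x * ((x \<bullet> DN x b) * (N x \<bullet> b))
      - (\<psi> x * (x \<bullet> N x)) * (DN x b \<bullet> b))" by (intro sum.cong refl)
  also have "\<dots> = G x \<bullet> x + real DIM('a) * \<psi> x - (x \<bullet> N x) * (G x \<bullet> N x) - \<psi> x - \<psi> x * (x \<bullet> DN x (N x))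
      - \<psi> x * (x \<bullet> N x) * H x"
    by (simp only: sum_subtractf sum.distrib sum_distrib_left[symmetric] s1 s2 s3 s4 H_def[symmetric] sum_constant mult_1_right)
  finally have tr: "(\<Sum>b\<in>Basis. dvf \<psi> G x b \<bullet> b) = radial_div N H \<psi> G x - \<psi> x * (x \<bullet> DN x (N x))"
    by (simp add: radial_div_def algebra_simps)
  \<comment> \<open>The field is tangent, hence fixed by the projection \<open>P\<close>.\<close>
  have Pv: "(\<Sum>b\<in>Basis. (vf \<psi> x \<bullet> b) * (DN x (P x b) \<bullet> e)) = DN x (vf \<psi> x) \<bullet> e"
  proof -
    have "(\<Sum>b\<in>Basis. (vf \<psi> x \<bullet> b) *\<^sub>R P x b) = vf \<psi> x"
    proof -
      have "(\<Sum>b\<in>Basis. (vf \<psi> x \<bullet> b) *\<^sub>R P x b)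
        = (\<Sum>b\<in>Basis. (vf \<psi> x \<bullet> b) *\<^sub>R b) - (\<Sum>b\<in>Basis. (vf \<psi> x \<bullet> b) * (N x \<bullet> b) / (N x \<bullet> e)) *\<^sub>R e"
        by (simp add: P_def scaleR_diff_right sum_subtractf scaleR_sum_left)
      also have "(\<Sum>b\<in>Basis. (vf \<psi> x \<bullet> b) * (N x \<bullet> b) / (N x \<bullet> e)) = 0"
        by (simp only: sum_divide_distrib[symmetric] sum_Basis_inner vf_N[OF x] div_0)
      finally show ?thesis by (simp add: euclidean_representation)
    qed
    then have "DN x (vf \<psi> x) = (\<Sum>b\<in>Basis. (vf \<psi> x \<bullet> b) *\<^sub>R DN x (P x b))"
      by (metis (no_types, lifting) D.scaleR D.sum sum.cong)
    then show ?thesis by (simp add: inner_sum_left)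
  qed
  \<comment> \<open>With \<open>xt\<close> the tangential part of x, all three terms are Hessian
    entries pairing \<open>xt\<close> with \<open>N x\<close> or \<open>e\<close>; exchanging the
    arguments matches them.\<close>
  have key: "- \<psi> x * (x \<bullet> DN x (N x)) + q * \<psi> x * (x \<bullet> DN x e) - q * (DN x (vf \<psi> x) \<bullet> e) = 0"
  proof -
    define xt where "xt = x - (x \<bullet> N x) *\<^sub>R N x"
    have xt: "xt \<bullet> N x = 0" using Nx by (simp add: xt_def inner_diff_left)
    have v: "vf \<psi> x = \<psi> x *\<^sub>R xt" by (simp add: vf_def xt_def algebra_simps)
    have xD: "x \<bullet> DN x k = (h x k \<bullet> xt) / norm (g x)" for k
    proof -
      have "x \<bullet> DN x k = xt \<bullet> DN x k" using ND by (simp add: xt_def inner_diff_left)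
      also have "\<dots> = (h x k \<bullet> xt) / norm (g x)"
        using xt by (simp add: DN_def inner_diff_right inner_commute divide_inverse)
      finally show ?thesis .
    qed
    have De: "DN x xt \<bullet> e = (h x xt \<bullet> e - (h x xt \<bullet> N x) * (N x \<bullet> e)) / norm (g x)"
      by (simp add: DN_def inner_diff_left divide_inverse inner_commute[of "N x" "h x xt"] mult.commute)
    have "q * (DN x xt \<bullet> e) = (q * (h x xt \<bullet> e) - h x xt \<bullet> N x) / norm (g x)"
      unfolding De using qe by (simp add: right_diff_distrib mult.left_commute[of q] mult.commute)
    then have "- (x \<bullet> DN x (N x)) + q * (x \<bullet> DN x e) - q * (DN x xt \<bullet> e) = 0"
      unfolding xD using h_sym[OF x, of xt e] h_sym[OF x, of xt "N x"]
      by (simp add: diff_divide_distrib)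
    then have "\<psi> x * (- (x \<bullet> DN x (N x)) + q * (x \<bullet> DN x e) - q * (DN x xt \<bullet> e)) = 0" by simp
    then show ?thesis by (simp add: v D.scaleR algebra_simps)
  qed
  have "(\<Sum>b\<in>Basis. dY \<psi> G b x (P x b))
     = (\<Sum>b\<in>Basis. dvf \<psi> G x (P x b) \<bullet> b) * q - (\<Sum>b\<in>Basis. (vf \<psi> x \<bullet> b) * (DN x (P x b) \<bullet> e)) * q\<^sup>2"
    by (simp add: dY_def q_def sum_subtractf sum_divide_distrib power_divide)
  also have "\<dots> = (radial_div N H \<psi> G x - \<psi> x * (x \<bullet> DN x (N x)) + \<psi> x * (x \<bullet> DN x e) * q) * q
      - (DN x (vf \<psi> x) \<bullet> e) * q\<^sup>2"
    by (simp add: linear_sum_P[OF x linear_dvf[OF x]] tr Pv Ae q_def)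
  also have "\<dots> = radial_div N H \<psi> G x * q
      + q * (- \<psi> x * (x \<bullet> DN x (N x)) + q * \<psi> x * (x \<bullet> DN x e) - q * (DN x (vf \<psi> x) \<bullet> e))"
    by (simp add: algebra_simps power2_eq_square)
  finally show ?thesis unfolding key by (simp add: q_def)
qed

section \<open>Partial integration over the slab\<close>

definition sheet where "sheet K = {z \<in> C. pr z \<in> K}"
definition slab where "slab = {z. 0 \<le> z \<bullet> e \<and> z \<bullet> e < 1}"

text \<open>\<open>pr\<close> is continuous only on the open set \<open>C\<close>, so closedness
  cannot be read off from a preimage under \<open>pr\<close>. It comes from the compact shadow of
  \<open>K\<close> under the globally defined \<open>Q\<close>.\<close>

lemma closed_sheet:
  assumes K: "compact K" "K \<subseteq> M \<inter> W"
  shows "closed (sheet K)"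
proof -
  have "sheet K = Q -` (Q ` K)"
  proof (intro set_eqI iffI)
    fix z assume "z \<in> sheet K"
    then show "z \<in> Q -` (Q ` K)" using pr_props(2)[of z, symmetric] by (auto simp: sheet_def)
  next
    fix z assume "z \<in> Q -` (Q ` K)"
    then obtain x where "x \<in> K" "Q z = Q x" by auto
    then show "z \<in> sheet K" using pr_eq[of x z] K by (auto simp: sheet_def)
  qed
  moreover have cQ: "continuous_on A Q" for A unfolding Q_def by (intro continuous_intros)
  moreover have "closed (Q ` K)" using K cQ by (simp add: compact_continuous_image compact_imp_closed)
  ultimately show ?thesis by (simp add: closed_vimage)
qed

lemma borel_sheet_fun:
  fixes c :: "'a \<Rightarrow> real"
  assumes K: "compact K" "K \<subseteq> M \<inter> W" and c: "continuous_on K c"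
  shows "(\<lambda>z. if z \<in> sheet K then c (pr z) else 0) \<in> borel_measurable borel"
proof -
  have "continuous_on (sheet K) (\<lambda>z. c (pr z))"
    by (rule continuous_on_compose2[OF c continuous_on_subset[OF cont_pr]]) (auto simp: sheet_def)
  then show ?thesis
    using closed_sheet[OF K] by (intro borel_measurable_continuous_on_if) auto
qed

text \<open>Extension by zero off \<open>sheet K\<close> is differentiable everywhere: on
  \<open>C\<close> it equals a differentiable function, as \<psi> vanishes on the rest of the chart,
  and off the closed sheet it is locally zero. These two open sets cover the space.\<close>

lemma slab_integral_dY:
  assumes \<psi>: "\<And>x. x \<in> W \<Longrightarrow> (\<psi> has_derivative (\<lambda>v. G x \<bullet> v)) (at x)"
    and G: "continuous_on W G" and K: "compact K" "K \<subseteq> M \<inter> W"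
    and zero: "\<And>x. x \<in> M \<inter> W - K \<Longrightarrow> \<psi> x = 0" and b: "b \<in> Basis"
  defines "D \<equiv> \<lambda>z. if z \<in> sheet K then dY \<psi> G b (pr z) (P (pr z) b) else 0"
  shows "integrable lborel (\<lambda>z. indicator slab z * D z)" "(\<integral>z. indicator slab z * D z \<partial>lborel) = 0"
proof -
  have KW: "K \<subseteq> W" using K by auto
  have dY0: "dY \<psi> G b x 0 = 0" if "x \<in> W" for x
    using linear_0[OF linear_dvf[OF that]] linear_0[OF linear_DN[OF that]] by (simp add: dY_def)
  have "integrable lborel (\<lambda>z. indicator slab z * D z) \<and> (\<integral>z. indicator slab z * D z \<partial>lborel) = 0"
  proof (cases "b = e")
    \<comment> \<open>Nothing changes along \<open>e\<close>, so this component of the divergence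
      vanishes pointwise.\<close>
    case True
    have "D z = 0" for z
      unfolding D_def using True P_e[of "pr z"] dY0[of "pr z"] pr_props(1)[of z] by (auto simp: sheet_def)
    then show ?thesis by simp
  next
    case False
    define Y where "Y x = (vf \<psi> x \<bullet> b) / (N x \<bullet> e)" for x
    define y where "y z = (if z \<in> sheet K then Y (pr z) else 0)" for z
    define c where "c x = dY \<psi> G b x (P x b)" for x
    have cont\<psi>: "continuous_on W \<psi>"
      by (meson W(1) \<psi> continuous_at_imp_continuous_on has_derivative_continuous)
    note sub = continuous_on_subset[OF _ KW]
    have contP: "continuous_on K (\<lambda>x. P x b)"
      unfolding P_def using N(3) KW by (auto intro!: continuous_intros sub[OF cont_N])
    have contY: "continuous_on K Y"
      unfolding Y_def vf_def using N(3) KW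
      by (auto intro!: continuous_intros sub[OF cont_N] sub[OF cont\<psi>])
    have contc: "continuous_on K c"
      unfolding c_def dY_def vf_def dvf_def using N(3) KW
      by (auto intro!: continuous_intros sub[OF cont_N] sub[OF cont\<psi>] sub[OF G] contP cont_DN)
    have Deq: "D = (\<lambda>z. if z \<in> sheet K then c (pr z) else 0)" by (simp add: D_def c_def cong: if_cong)
    have "bounded (Y ` K)" "bounded (c ` K)"
      using K contY contc by (simp_all add: compact_continuous_image compact_imp_bounded)
    then obtain B1 B2 where B: "\<And>x. x \<in> K \<Longrightarrow> \<bar>Y x\<bar> \<le> B1" "\<And>x. x \<in> K \<Longrightarrow> \<bar>c x\<bar> \<le> B2"
      by (auto simp: bounded_iff)
    define B where "B = max 0 (max B1 B2)"
    have "continuous_on K Q" unfolding Q_def by (intro continuous_intros)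
    then have "bounded (Q ` K)" using K by (simp add: compact_continuous_image compact_imp_bounded)
    then obtain R where R: "\<And>x. x \<in> K \<Longrightarrow> norm (Q x) \<le> R" by (auto simp: bounded_iff)
    have der: "((\<lambda>t. y (z + t *\<^sub>R b)) has_real_derivative D z) (at 0)" for z
      proof (cases "z \<in> sheet K")
        case True
        then have z: "z \<in> C" by (simp add: sheet_def)
        have pz: "pr z \<in> W" using pr_props[OF z] by blast
        have "((\<lambda>z. Y (pr z)) has_derivative (\<lambda>v. dY \<psi> G b (pr z) (P (pr z) v))) (at z)"
          unfolding Y_def by (rule has_derivative_compose[OF deriv_pr[OF z] deriv_Y[where b=b and G=G and \<psi>=\<psi>, OF pz \<psi>[OF pz]]])
        then have "(y has_derivative (\<lambda>v. dY \<psi> G b (pr z) (P (pr z) v))) (at z)"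
        proof (rule has_derivative_transform_within_open[OF _ open_C z])
          fix w assume "w \<in> C"
          then have "Y (pr w) = 0" if "w \<notin> sheet K"
            using that zero[of "pr w"] pr_props(1)[of w] by (simp add: Y_def vf_def sheet_def)
          then show "Y (pr w) = y w" by (auto simp: y_def)
        qed
        moreover have "((\<lambda>t. z + t *\<^sub>R b) has_derivative (\<lambda>t. t *\<^sub>R b)) (at 0)"
          by (auto intro!: derivative_eq_intros)
        ultimately have d: "((\<lambda>t. y (z + t *\<^sub>R b)) has_derivative (\<lambda>t. dY \<psi> G b (pr z) (P (pr z) (t *\<^sub>R b)))) (at 0)"
          using has_derivative_compose[of "\<lambda>t. z + t *\<^sub>R b" "\<lambda>t. t *\<^sub>R b" 0 UNIV y] by simp
        have "dY \<psi> G b (pr z) (P (pr z) (t *\<^sub>R b)) = D z * t" for t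
        proof -
          have "P (pr z) (t *\<^sub>R b) = t *\<^sub>R P (pr z) b" by (simp add: P_def algebra_simps)
          then show ?thesis using True
            by (simp add: D_def dY_def linear_scale[OF linear_dvf[OF pz]] linear_scale[OF linear_DN[OF pz]] algebra_simps)
        qed
        then show ?thesis using d by (simp add: has_field_derivative_def)
      next
        case False
        have "((\<lambda>t. 0::real) has_real_derivative 0) (at 0)" by simp
        moreover have "open ((\<lambda>t::real. z + t *\<^sub>R b) -` (- sheet K))"
          using closed_sheet[OF K] by (intro continuous_open_vimage continuous_intros) auto
        ultimately have "((\<lambda>t. y (z + t *\<^sub>R b)) has_real_derivative 0) (at 0)"
          by (rule has_field_derivative_transform_within_open) (use False in \<open>auto simp: y_def\<close>)
        then show ?thesis using False by (simp add: D_def)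
      qed
    have bd: "\<bar>D z\<bar> \<le> B" "\<bar>y z\<bar> \<le> B" for z
      using B(1)[of "pr z"] B(2)[of "pr z"] unfolding Deq y_def B_def by (auto simp: sheet_def)
    have supp: "norm (z - (z \<bullet> e) *\<^sub>R e) \<le> R" if "y z \<noteq> 0" for z
      using that R[of "pr z"] pr_props(2)[of z] by (auto simp: y_def sheet_def Q_def split: if_splits)
    have Dm: "D \<in> borel_measurable borel" unfolding Deq by (rule borel_sheet_fun[OF K contc])
    have ym: "y \<in> borel_measurable borel" unfolding y_def by (rule borel_sheet_fun[OF K contY])
    show ?thesis
      using integral_slab_derivative_zero[OF e b False der Dm bd(1) ym bd(2) supp] by (simp add: slab_def)
  qed
  then show "integrable lborel (\<lambda>z. indicator slab z * D z)" "(\<integral>z. indicator slab z * D z \<partial>lborel) = 0" by auto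
qed

lemma slab_integral_radial_div:
  assumes \<psi>: "\<And>x. x \<in> W \<Longrightarrow> (\<psi> has_derivative (\<lambda>v. G x \<bullet> v)) (at x)"
    and G: "continuous_on W G" and K: "compact K" "K \<subseteq> M \<inter> W"
    and zero: "\<And>x. x \<in> M \<inter> W - K \<Longrightarrow> \<psi> x = 0"
  defines "D \<equiv> \<lambda>z. if z \<in> sheet K then radial_div N H \<psi> G (pr z) / (N (pr z) \<bullet> e) else 0"
  shows "integrable lborel (\<lambda>z. indicator slab z * D z)" "(\<integral>z. indicator slab z * D z \<partial>lborel) = 0"
proof -
  let ?g = "\<lambda>b z. indicator slab z * (if z \<in> sheet K then dY \<psi> G b (pr z) (P (pr z) b) else 0)"
  have eq: "(\<lambda>z. indicator slab z * D z) = (\<lambda>z. \<Sum>b\<in>Basis. ?g b z)"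
  proof
    fix z
    have "D z = (\<Sum>b\<in>Basis. if z \<in> sheet K then dY \<psi> G b (pr z) (P (pr z) b) else 0)"
      using sum_dY[of "pr z" \<psi> G] pr_props(1)[of z] by (auto simp: D_def sheet_def)
    then show "indicator slab z * D z = (\<Sum>b\<in>Basis. ?g b z)" by (simp only: sum_distrib_left)
  qed
  note g = slab_integral_dY[OF \<psi> G K zero]
  show "integrable lborel (\<lambda>z. indicator slab z * D z)"
    unfolding eq by (rule Bochner_Integration.integrable_sum) (rule g(1))
  have "(\<integral>z. indicator slab z * D z \<partial>lborel) = (\<Sum>b\<in>Basis. \<integral>z. ?g b z \<partial>lborel)"
    unfolding eq by (rule Bochner_Integration.integral_sum) (rule g(1))
  also have "\<dots> = 0" by (rule sum.neutral) (use g(2) in blast)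
  finally show "(\<integral>z. indicator slab z * D z \<partial>lborel) = 0" .
qed

end

section \<open>The area formula\<close>

text \<open>By Lindelof countably many of the balls cover \<open>S\<close>; \<open>A\<close> is cut
  along them into disjoint pieces, and countable additivity sums the local bounds.\<close>

lemma emeasure_le_if_locally_le:
  fixes m1 m2 :: "'a::euclidean_space measure"
  assumes sets: "sets m1 = sets borel" "sets m2 = sets borel"
    and loc: "\<And>p. p \<in> S \<Longrightarrow> \<exists>\<delta>>0. \<forall>A\<in>sets borel. A \<subseteq> S \<inter> ball p \<delta> \<longrightarrow> emeasure m1 A \<le> \<theta> * emeasure m2 A"
    and A: "A \<in> sets borel" "A \<subseteq> S"
  shows "emeasure m1 A \<le> \<theta> * emeasure m2 A"
proof (cases "S = {}")
  case True
  then show ?thesis using A by simp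
next
  case False
  have "\<exists>\<delta>. \<forall>p\<in>S. \<delta> p > 0 \<and> (\<forall>A\<in>sets borel. A \<subseteq> S \<inter> ball p (\<delta> p) \<longrightarrow> emeasure m1 A \<le> \<theta> * emeasure m2 A)"
    by (rule bchoice) (use loc in blast)
  then obtain \<delta> where \<delta>0: "\<forall>p\<in>S. \<delta> p > 0 \<and> (\<forall>A\<in>sets borel. A \<subseteq> S \<inter> ball p (\<delta> p) \<longrightarrow> emeasure m1 A \<le> \<theta> * emeasure m2 A)" ..
  have \<delta>: "\<delta> p > 0" "X \<in> sets borel \<Longrightarrow> X \<subseteq> S \<inter> ball p (\<delta> p) \<Longrightarrow> emeasure m1 X \<le> \<theta> * emeasure m2 X"
    if "p \<in> S" for p X using \<delta>0[rule_format, OF that] by simp_all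
  obtain \<F> where \<F>: "\<F> \<subseteq> (\<lambda>p. ball p (\<delta> p)) ` S" "countable \<F>" "\<Union>\<F> = (\<Union>p\<in>S. ball p (\<delta> p))"
    by (rule Lindelof[of "(\<lambda>p. ball p (\<delta> p)) ` S"]) auto
  have Fne: "\<F> \<noteq> {}" using \<F>(3) False \<delta>(1) by force
  define B where "B = from_nat_into \<F>"
  have B: "range B = \<F>" unfolding B_def by (rule range_from_nat_into[OF Fne \<F>(2)])
  define X where "X n = A \<inter> disjointed B n" for n :: nat
  have Bn: "\<exists>p\<in>S. B n = ball p (\<delta> p)" for n using B \<F>(1) by blast
  have Bb: "range B \<subseteq> sets borel" using Bn by (metis borel_open image_subsetI open_ball)
  have Xb: "X n \<in> sets borel" for n
    using sets.range_disjointed_sets[OF Bb] A by (auto simp: X_def)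
  have disj: "disjoint_family X"
    by (rule disjoint_family_subset[OF disjoint_family_disjointed[of B]]) (simp add: X_def)
  have un: "(\<Union>n. X n) = A"
  proof -
    have "(\<Union>n. X n) = A \<inter> (\<Union>n. B n)" by (simp only: X_def Int_UN_distrib[symmetric] UN_disjointed_eq)
    also have "(\<Union>n. B n) = (\<Union>p\<in>S. ball p (\<delta> p))" using B \<F>(3) by simp
    finally have "(\<Union>n. X n) = A \<inter> (\<Union>p\<in>S. ball p (\<delta> p))" .
    moreover have "A \<subseteq> (\<Union>p\<in>S. ball p (\<delta> p))" using A(2) \<delta>(1) centre_in_ball by blast
    ultimately show ?thesis by (simp only: Int_absorb2)
  qed
  have le: "emeasure m1 (X n) \<le> \<theta> * emeasure m2 (X n)" for n
  proof -
    obtain p where "p \<in> S" "B n = ball p (\<delta> p)" using Bn by blast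
    moreover have "X n \<subseteq> S \<inter> B n" using A disjointed_subset[of B n] by (auto simp: X_def)
    ultimately show ?thesis using \<delta>(2)[of p "X n"] Xb[of n] by simp
  qed
  have rX: "range X \<subseteq> sets m1" "range X \<subseteq> sets m2" using Xb sets by auto
  have "emeasure m1 A = (\<Sum>n. emeasure m1 (X n))"
    using suminf_emeasure[OF rX(1) disj] un by simp
  also have "\<dots> \<le> (\<Sum>n. \<theta> * emeasure m2 (X n))" by (rule suminf_le) (use le in auto)
  also have "\<dots> = \<theta> * emeasure m2 A"
    using suminf_emeasure[OF rX(2) disj] un by simp
  finally show ?thesis .
qed

lemma ennreal_le_if_le_ratio_power:
  fixes a b :: ennreal
  assumes le: "\<And>\<eta>. 0 < \<eta> \<Longrightarrow> \<eta> < 1 \<Longrightarrow> a \<le> ennreal (((1 + \<eta>) / (1 - \<eta>)) ^ k) * b"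
  shows "a \<le> b"
proof (cases b)
  case (real r)
  have "a \<le> ennreal (((1 + 1/2) / (1 - 1/2)) ^ k) * b" by (rule le) auto
  also have "\<dots> < \<infinity>" by (simp add: real ennreal_mult_less_top)
  finally obtain s where s: "a = ennreal s" "s \<ge> 0" by (cases a) auto
  have "s \<le> ((1 + \<eta>) / (1 - \<eta>)) ^ k * r" if "0 < \<eta>" "\<eta> < 1" for \<eta>
    using le[OF that] that real s by (simp add: ennreal_mult[symmetric] ennreal_le_iff)
  then have "eventually (\<lambda>\<eta>. s \<le> ((1 + \<eta>) / (1 - \<eta>)) ^ k * r) (at_right 0)"
    unfolding eventually_at_right_field by (intro exI[of _ 1]) auto
  moreover have "((\<lambda>\<eta>::real. ((1 + \<eta>) / (1 - \<eta>)) ^ k * r) \<longlongrightarrow> ((1 + 0) / (1 - 0)) ^ k * r) (at_right 0)"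
    by (intro tendsto_intros) auto
  ultimately have "s \<le> ((1 + 0) / (1 - 0)) ^ k * r"
    by (intro tendsto_lowerbound[OF _ _ trivial_limit_at_right_real]) auto
  then show ?thesis using s real by (simp add: ennreal_leI)
qed simp

locale hausdorff_chart = hypersurface_chart M \<nu> f g h e W + hausdorff_borel \<mu> d
  for M :: "'a::euclidean_space set" and \<nu> f g h e W and \<mu> :: "'a measure" and d
begin

lemma borel_MW: "M \<inter> W \<in> sets borel"
proof -
  have "closedin (top_of_set W) (W \<inter> f -` {0})"
    by (intro continuous_closedin_preimage cont_f) simp
  then obtain T where "closed T" "W \<inter> f -` {0} = W \<inter> T" by (auto simp: closedin_closed)
  moreover have "M \<inter> W = W \<inter> f -` {0}" using MW by auto
  ultimately show ?thesis using W(1) by simp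
qed

definition pr0 where "pr0 z = (if z \<in> C then pr z else 0)"
text \<open>The area formula takes the form \<open>area_measure = chart_measure\<close>. The factor
  |N \<bullet> e| stands on the surface side, so neither measure contains a quotient.\<close>

definition chart_measure where
  "chart_measure = distr (density lborel (\<lambda>z. plane_const * indicator (C \<inter> slab) z)) borel pr0"
definition area_measure where
  "area_measure = density \<mu> (\<lambda>x. ennreal (indicator (M \<inter> W) x * \<bar>N x \<bullet> e\<bar>))"

lemma borel_C: "C \<in> sets borel" using open_C by simp

lemma borel_slab: "slab \<in> sets borel" unfolding slab_def by measurable

lemma borel_pr0: "pr0 \<in> borel_measurable borel"
  unfolding pr0_def[abs_def] using open_C
  by (intro borel_measurable_continuous_on_if cont_pr) auto

lemma vimage_pr0: "A \<in> sets borel \<Longrightarrow> pr0 -` A \<in> sets borel"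
  using measurable_sets[OF borel_pr0, of A] by simp

lemma emeasure_chart_measure:
  assumes A: "A \<in> sets borel"
  shows "emeasure chart_measure A = plane_const * emeasure lborel {z \<in> C. pr z \<in> A \<and> z \<in> slab}"
proof -
  note [measurable] = borel_C borel_slab borel_pr0 vimage_pr0[OF A]
  have eq: "{z \<in> C. pr z \<in> A \<and> z \<in> slab} = C \<inter> slab \<inter> pr0 -` A" by (auto simp: pr0_def)
  have "emeasure chart_measure A = (\<integral>\<^sup>+z. plane_const * indicator (C \<inter> slab) z * indicator (pr0 -` A) z \<partial>lborel)"
    unfolding chart_measure_def using A by (subst emeasure_distr) (auto simp: emeasure_density)
  also have "\<dots> = (\<integral>\<^sup>+z. plane_const * indicator (C \<inter> slab \<inter> pr0 -` A) z \<partial>lborel)"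
    by (rule nn_integral_cong) (simp split: split_indicator)
  also have "\<dots> = plane_const * emeasure lborel (C \<inter> slab \<inter> pr0 -` A)"
    by (subst nn_integral_cmult_indicator) auto
  finally show ?thesis unfolding eq .
qed

lemma borel_Ne: "(\<lambda>x. indicator (M \<inter> W) x * \<bar>N x \<bullet> e\<bar>) \<in> borel_measurable borel"
proof -
  have "(\<lambda>x. if x \<in> M \<inter> W then \<bar>N x \<bullet> e\<bar> else 0) \<in> borel_measurable borel"
    by (intro borel_measurable_continuous_on_if borel_MW continuous_intros continuous_on_subset[OF cont_N]) auto
  also have "(\<lambda>x. if x \<in> M \<inter> W then \<bar>N x \<bullet> e\<bar> else 0) = (\<lambda>x. indicator (M \<inter> W) x * \<bar>N x \<bullet> e\<bar>)"
    by (auto simp: indicator_def)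
  finally show ?thesis .
qed

lemma emeasure_area_measure:
  assumes A: "A \<in> sets borel" "A \<subseteq> M \<inter> W"
  shows "(\<And>x. x \<in> A \<Longrightarrow> \<bar>N x \<bullet> e\<bar> \<le> c) \<Longrightarrow> 0 \<le> c \<Longrightarrow> emeasure area_measure A \<le> ennreal c * hausdorff_outer d A"
    "(\<And>x. x \<in> A \<Longrightarrow> c \<le> \<bar>N x \<bullet> e\<bar>) \<Longrightarrow> 0 \<le> c \<Longrightarrow> ennreal c * hausdorff_outer d A \<le> emeasure area_measure A"
proof -
  note [measurable_cong] = sets_\<mu>
  note [measurable] = borel_Ne A(1)
  have em: "emeasure area_measure A = (\<integral>\<^sup>+x. ennreal (indicator (M \<inter> W) x * \<bar>N x \<bullet> e\<bar>) * indicator A x \<partial>\<mu>)"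
    unfolding area_measure_def by (rule emeasure_density) (auto simp: sets_\<mu>)
  have c: "(\<integral>\<^sup>+x. ennreal c * indicator A x \<partial>\<mu>) = ennreal c * hausdorff_outer d A"
    by (subst nn_integral_cmult_indicator) (auto simp: sets_\<mu> emeasure_\<mu> A(1))
  show "emeasure area_measure A \<le> ennreal c * hausdorff_outer d A" if "\<And>x. x \<in> A \<Longrightarrow> \<bar>N x \<bullet> e\<bar> \<le> c" "0 \<le> c"
    unfolding em c[symmetric] using that A(2) by (intro nn_integral_mono) (auto split: split_indicator intro!: ennreal_leI)
  show "ennreal c * hausdorff_outer d A \<le> emeasure area_measure A" if "\<And>x. x \<in> A \<Longrightarrow> c \<le> \<bar>N x \<bullet> e\<bar>" "0 \<le> c"
    unfolding em c[symmetric] using that A(2) by (intro nn_integral_mono) (auto split: split_indicator intro!: ennreal_leI)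
qed

text \<open>Near \<open>p\<close> the function f z - g p \<bullet> z has small derivative, while
  \<open>f\<close> vanishes at both ends of a chord of M; hence the chord is nearly orthogonal to
  \<open>g p\<close>.\<close>

lemma nearly_tangent:
  assumes p: "p \<in> M \<inter> W" and \<eta>: "\<eta> > 0"
  shows "\<exists>\<delta>>0. \<forall>x\<in>M \<inter> W \<inter> ball p \<delta>. \<forall>y\<in>M \<inter> W \<inter> ball p \<delta>. \<bar>(x - y) \<bullet> N p\<bar> \<le> \<eta> * norm (x - y)"
proof -
  have pW: "p \<in> W" using p by simp
  define \<epsilon> where "\<epsilon> = \<eta> * norm (g p)"
  have gp: "norm (g p) > 0" using g0[OF pW] by simp
  have \<epsilon>: "\<epsilon> > 0" using \<eta> gp by (simp add: \<epsilon>_def)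
  have "isCont g p" using cont_g W(1) pW by (simp add: continuous_on_eq_continuous_at)
  then obtain d1 where d1: "d1 > 0" "\<And>x. dist x p < d1 \<Longrightarrow> dist (g x) (g p) < \<epsilon>"
    using \<epsilon> unfolding continuous_at_eps_delta by blast
  obtain d2 where d2: "d2 > 0" "ball p d2 \<subseteq> W" using W(1) pW open_contains_ball by blast
  define \<delta> where "\<delta> = min d1 d2"
  have sub: "ball p \<delta> \<subseteq> W" using d2 by (auto simp: \<delta>_def)
  have "\<bar>(x - y) \<bullet> N p\<bar> \<le> \<eta> * norm (x - y)" if x: "x \<in> M \<inter> W \<inter> ball p \<delta>" and y: "y \<in> M \<inter> W \<inter> ball p \<delta>" for x y
  proof -
    have "norm ((f x - g p \<bullet> x) - (f y - g p \<bullet> y)) \<le> \<epsilon> * norm (x - y)"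
    proof (rule differentiable_bound[where S="ball p \<delta>" and f="\<lambda>z. f z - g p \<bullet> z" and f'="\<lambda>z v. g z \<bullet> v - g p \<bullet> v"])
      fix z assume z: "z \<in> ball p \<delta>"
      have "((\<lambda>z. f z - g p \<bullet> z) has_derivative (\<lambda>v. g z \<bullet> v - g p \<bullet> v)) (at z)"
        using z sub f by (auto intro!: derivative_eq_intros)
      then show "((\<lambda>z. f z - g p \<bullet> z) has_derivative (\<lambda>v. g z \<bullet> v - g p \<bullet> v)) (at z within ball p \<delta>)"
        by (rule has_derivative_at_withinI)
      have "norm (g z - g p) \<le> \<epsilon>" using d1(2)[of z] z by (simp add: \<delta>_def dist_commute[of z p] dist_norm[of "g z"] less_imp_le)
      then have "norm (g z \<bullet> v - g p \<bullet> v) \<le> \<epsilon> * norm v" for v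
        using Cauchy_Schwarz_ineq2[of "g z - g p" v] mult_right_mono[of "norm (g z - g p)" \<epsilon> "norm v"]
        by (simp add: inner_diff_left)
      then show "onorm (\<lambda>v. g z \<bullet> v - g p \<bullet> v) \<le> \<epsilon>" using \<epsilon> by (intro onorm_bound) auto
    qed (use x y in auto)
    moreover have "f x = 0" "f y = 0" using x y MW by auto
    ultimately have "\<bar>g p \<bullet> (x - y)\<bar> \<le> \<epsilon> * norm (x - y)" by (simp add: inner_diff_right abs_minus_commute)
    moreover have "(x - y) \<bullet> N p = (g p \<bullet> (x - y)) / norm (g p)" by (simp add: N_def inner_commute divide_inverse)
    ultimately show ?thesis using gp by (simp add: abs_divide \<epsilon>_def pos_divide_le_eq mult_ac)
  qed
  moreover have "\<delta> > 0" using d1 d2 by (simp add: \<delta>_def)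
  ultimately show ?thesis by blast
qed

text \<open>Near \<open>p\<close> the surface is \<open>(1 \<plusminus> \<eta>)\<close>-bilipschitz to its tangent plane via projection along
  \<open>e\<close>, which does not change the slab volume.\<close>

lemma hausdorff_chart_local:
  assumes p: "p \<in> M \<inter> W" and \<eta>: "0 < \<eta>" "\<eta> < 1"
  shows "\<exists>\<delta>>0. \<forall>A\<in>sets borel. A \<subseteq> M \<inter> W \<inter> ball p \<delta> \<longrightarrow>
     ennreal \<bar>N p \<bullet> e\<bar> * hausdorff_outer d A \<le> ennreal ((1 / (1 - \<eta>)) ^ d) * emeasure chart_measure A \<and>
     emeasure chart_measure A \<le> ennreal ((1 + \<eta>) ^ d) * (ennreal \<bar>N p \<bullet> e\<bar> * hausdorff_outer d A)"
proof -
  have pW: "p \<in> W" using p by simp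
  define u where "u = N p"
  have u: "norm u = 1" and eu: "e \<bullet> u \<noteq> 0" using N[OF pW] by (auto simp: u_def inner_commute)
  \<comment> \<open>The tolerance carries the factor |e \<bullet> u| because the projection along
    \<open>e\<close> divides the normal offset by e \<bullet> u.\<close>
  obtain \<delta> where \<delta>: "\<delta> > 0" "\<And>x y. x \<in> M \<inter> W \<inter> ball p \<delta> \<Longrightarrow> y \<in> M \<inter> W \<inter> ball p \<delta> \<Longrightarrow>
      \<bar>(x - y) \<bullet> u\<bar> \<le> (\<eta> * \<bar>e \<bullet> u\<bar>) * norm (x - y)"
    using nearly_tangent[OF p, of "\<eta> * \<bar>e \<bullet> u\<bar>"] \<eta> eu unfolding u_def by force
  define t where "t z = ((z - p) \<bullet> u) / (e \<bullet> u)" for z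
  define T where "T z = z - t z *\<^sub>R e" for z
  have tT: "t (T z) = 0" for z
    using eu by (simp add: t_def T_def inner_diff_left divide_simps)
  have t_shift: "t (z + s *\<^sub>R e) = t z + s" for z s
    using eu by (simp add: t_def inner_add_left inner_diff_left divide_simps)
  have T_shift: "T (z + s *\<^sub>R e) = T z" for z s
    unfolding T_def t_shift by (simp add: algebra_simps)
  have T_borel: "T \<in> borel_measurable borel" unfolding T_def t_def by measurable
  have t_borel: "t \<in> borel_measurable borel" unfolding t_def by measurable
  have T_pr: "T (pr z) = T z" if "z \<in> C" for z
  proof -
    have "pr z = z + ((pr z) \<bullet> e - z \<bullet> e) *\<^sub>R e" using pr_props(2)[OF that] by (simp add: Q_def algebra_simps)
    then show ?thesis using T_shift by metis
  qed
  have T_C: "T x \<in> C" "pr (T x) = x" if "x \<in> M \<inter> W" for x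
    using C_shift[of x "- t x"] pr_shift[of x "- t x"] on_M[OF that] by (simp_all add: T_def)
  have bil: "norm (T x - T y) \<le> (1 + \<eta>) * norm (x - y)" "(1 - \<eta>) * norm (x - y) \<le> norm (T x - T y)"
    if x: "x \<in> M \<inter> W \<inter> ball p \<delta>" and y: "y \<in> M \<inter> W \<inter> ball p \<delta>" for x y
  proof -
    have eq: "T x - T y = (x - y) - (((x - y) \<bullet> u) / (e \<bullet> u)) *\<^sub>R e"
      by (simp add: T_def t_def inner_diff_left diff_divide_distrib algebra_simps)
    have le: "norm ((((x - y) \<bullet> u) / (e \<bullet> u)) *\<^sub>R e) \<le> \<eta> * norm (x - y)"
      using \<delta>(2)[OF x y] eu by (simp add: ee abs_divide pos_divide_le_eq mult_ac)
    show "norm (T x - T y) \<le> (1 + \<eta>) * norm (x - y)"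
      unfolding eq using norm_triangle_ineq4[of "x - y" "(((x - y) \<bullet> u) / (e \<bullet> u)) *\<^sub>R e"] le
      by (simp add: algebra_simps)
    show "(1 - \<eta>) * norm (x - y) \<le> norm (T x - T y)"
      unfolding eq using norm_triangle_ineq2[of "x - y" "(((x - y) \<bullet> u) / (e \<bullet> u)) *\<^sub>R e"] le
      by (simp add: algebra_simps)
  qed
  have "ennreal \<bar>N p \<bullet> e\<bar> * hausdorff_outer d A \<le> ennreal ((1 / (1 - \<eta>)) ^ d) * emeasure chart_measure A \<and>
     emeasure chart_measure A \<le> ennreal ((1 + \<eta>) ^ d) * (ennreal \<bar>N p \<bullet> e\<bar> * hausdorff_outer d A)"
    if A: "A \<in> sets borel" "A \<subseteq> M \<inter> W \<inter> ball p \<delta>" for A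
  proof -
    \<comment> \<open>The image of \<open>A\<close> in the tangent plane, described by preimages so
      that it is visibly Borel; an image under \<open>T\<close> would not be.\<close>
    define B where "B = C \<inter> {z. T z = z} \<inter> pr0 -` A"
    note [measurable] = borel_C borel_slab borel_pr0 vimage_pr0[OF A(1)] T_borel t_borel
    have Bb: "B \<in> sets borel" unfolding B_def by measurable
    have TA: "T ` A = B"
    proof (intro set_eqI iffI)
      fix z assume "z \<in> T ` A"
      then obtain x where x: "x \<in> A" "z = T x" by blast
      have xM: "x \<in> M \<inter> W" using x A by blast
      have "T (T x) = T x" by (simp add: T_def[of "T x"] tT)
      then show "z \<in> B" using x T_C[OF xM] by (simp add: B_def pr0_def)
    next
      fix z assume "z \<in> B"
      then have "z \<in> C" "T z = z" "pr z \<in> A" by (auto simp: B_def pr0_def)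
      then show "z \<in> T ` A" using T_pr[of z] by (metis image_eqI)
    qed
    have prB: "pr ` B = A"
      unfolding TA[symmetric] image_image using T_C(2) A(2) by (force simp: image_iff)
    have Bp: "(z - p) \<bullet> u = 0" if "z \<in> B" for z
      using that eu tT[of z] by (auto simp: B_def t_def)
    have "hausdorff_outer d B * ennreal \<bar>e \<bullet> u\<bar> = plane_const * emeasure lborel (sweep u e p B)"
      by (rule hausdorff_plane[OF u eu Bb Bp])
    also have "emeasure lborel (sweep u e p B) = emeasure lborel {z \<in> C. pr z \<in> A \<and> z \<in> slab}"
    proof -
      define G :: "'a \<Rightarrow> ennreal" where "G = indicator (C \<inter> pr0 -` A)"
      \<comment> \<open>The prism over \<open>B\<close> is the part of the cylinder with 0 \<le> z
        \<bullet> e - s z < 1. As \<open>s\<close> is constant along \<open>e\<close>, it has the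
        volume of the part in the coordinate slab.\<close>
      define s where "s z = z \<bullet> e - t z" for z
      define \<iota> :: "real \<Rightarrow> ennreal" where "\<iota> = indicator {0..<1}"
      have \<iota>1: "(\<integral>\<^sup>+t. \<iota> t \<partial>lborel) = 1" by (simp add: \<iota>_def)
      have sw: "sweep u e p B = {z. T z \<in> B \<and> 0 \<le> t z \<and> t z < 1}"
        by (simp add: sweep_def T_def t_def)
      have TB: "T z \<in> B \<longleftrightarrow> z \<in> C \<inter> pr0 -` A" for z
      proof -
        have "T z = z + (- t z) *\<^sub>R e" by (simp add: T_def)
        then have "T z \<in> C \<longleftrightarrow> z \<in> C" "pr (T z) = pr z" using C_shift pr_shift by metis+
        then show ?thesis by (simp add: B_def pr0_def T_def[of "T z"] tT)
      qed
      have "emeasure lborel (sweep u e p B) = (\<integral>\<^sup>+z. indicator (sweep u e p B) z \<partial>lborel)"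
        using sweep_measurable[OF Bb] by simp
      also have "\<dots> = (\<integral>\<^sup>+z. G z * \<iota> (z \<bullet> e - s z) \<partial>lborel) * (\<integral>\<^sup>+t. \<iota> t \<partial>lborel)"
        unfolding \<iota>1 mult_1_right
        by (rule nn_integral_cong) (auto simp: sw TB G_def \<iota>_def s_def indicator_def)
      also have "\<dots> = (\<integral>\<^sup>+z. G z * \<iota> (z \<bullet> e) \<partial>lborel) * (\<integral>\<^sup>+t. \<iota> t \<partial>lborel)"
      proof (rule nn_integral_line_invariant[OF _ _ _ _ ee(1)])
        show "G \<in> borel_measurable borel" unfolding G_def by measurable
        show "s \<in> borel_measurable borel" unfolding s_def by measurable
        show "\<iota> \<in> borel_measurable borel" "\<iota> \<in> borel_measurable borel" unfolding \<iota>_def by measurable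
        show "G (z + r *\<^sub>R e) = G z" for z r by (simp add: G_def pr0_def C_shift pr_shift indicator_def)
        show "s (z + r *\<^sub>R e) = s z" for z r by (simp add: s_def t_shift inner_add_left ee)
      qed
      also have "\<dots> = (\<integral>\<^sup>+z. indicator (C \<inter> pr0 -` A \<inter> slab) z \<partial>lborel)"
        unfolding \<iota>1 mult_1_right
        by (rule nn_integral_cong) (auto simp: G_def \<iota>_def slab_def indicator_def)
      also have "\<dots> = emeasure lborel (C \<inter> pr0 -` A \<inter> slab)" by (rule nn_integral_indicator) simp
      also have "C \<inter> pr0 -` A \<inter> slab = {z \<in> C. pr z \<in> A \<and> z \<in> slab}" by (auto simp: pr0_def)
      finally show ?thesis .
    qed
    finally have HB: "ennreal \<bar>N p \<bullet> e\<bar> * hausdorff_outer d B = emeasure chart_measure A"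
      by (simp add: emeasure_chart_measure[OF A(1)] u_def inner_commute mult.commute)
    have 1: "hausdorff_outer d A \<le> ennreal ((1 / (1 - \<eta>)) ^ d) * hausdorff_outer d B"
      unfolding prB[symmetric]
    proof (rule hausdorff_outer_lipschitz)
      fix z w assume "z \<in> B" "w \<in> B"
      then obtain x y where xy: "x \<in> A" "y \<in> A" "z = T x" "w = T y" unfolding TA[symmetric] by blast
      have "norm (x - y) \<le> 1 / (1 - \<eta>) * norm (T x - T y)"
      proof -
        have "x \<in> M \<inter> W \<inter> ball p \<delta>" "y \<in> M \<inter> W \<inter> ball p \<delta>" using xy A(2) by blast+
        from bil(2)[OF this] show ?thesis using \<eta> by (simp add: pos_le_divide_eq mult.commute)
      qed
      moreover have "pr (T x) = x" "pr (T y) = y" using T_C(2) xy A(2) by blast+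
      ultimately show "norm (pr z - pr w) \<le> 1 / (1 - \<eta>) * norm (z - w)" using xy by simp
    qed (use \<eta> in simp)
    have 2: "hausdorff_outer d B \<le> ennreal ((1 + \<eta>) ^ d) * hausdorff_outer d A"
      unfolding TA[symmetric]
    proof (rule hausdorff_outer_lipschitz)
      fix x y assume "x \<in> A" "y \<in> A"
      then show "norm (T x - T y) \<le> (1 + \<eta>) * norm (x - y)" using bil(1) A(2) by blast
    qed (use \<eta> in simp)
    show ?thesis unfolding HB[symmetric]
      using mult_left_mono[OF 1, of "ennreal \<bar>N p \<bullet> e\<bar>"] mult_left_mono[OF 2, of "ennreal \<bar>N p \<bullet> e\<bar>"]
      by (simp add: mult_ac)
  qed
  then show ?thesis using \<delta>(1) by blast
qed

lemma area_chart_local: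
  assumes p: "p \<in> M \<inter> W" and \<eta>: "0 < \<eta>" "\<eta> < 1"
  shows "\<exists>\<delta>>0. \<forall>A\<in>sets borel. A \<subseteq> M \<inter> W \<inter> ball p \<delta> \<longrightarrow>
     emeasure area_measure A \<le> ennreal (((1 + \<eta>) / (1 - \<eta>)) ^ Suc d) * emeasure chart_measure A \<and>
     emeasure chart_measure A \<le> ennreal (((1 + \<eta>) / (1 - \<eta>)) ^ Suc d) * emeasure area_measure A"
proof -
  have pW: "p \<in> W" using p by simp
  define c where "c = \<bar>N p \<bullet> e\<bar>"
  have c: "c > 0" using N(3)[OF pW] by (simp add: c_def)
  obtain \<delta>1 where \<delta>1: "\<delta>1 > 0" "\<And>A. A \<in> sets borel \<Longrightarrow> A \<subseteq> M \<inter> W \<inter> ball p \<delta>1 \<Longrightarrow>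
     ennreal c * hausdorff_outer d A \<le> ennreal ((1 / (1 - \<eta>)) ^ d) * emeasure chart_measure A \<and>
     emeasure chart_measure A \<le> ennreal ((1 + \<eta>) ^ d) * (ennreal c * hausdorff_outer d A)"
    using hausdorff_chart_local[OF p \<eta>] unfolding c_def by auto
  have "continuous_on W (\<lambda>x. \<bar>N x \<bullet> e\<bar>)" by (intro continuous_intros cont_N)
  then have "isCont (\<lambda>x. \<bar>N x \<bullet> e\<bar>) p" using W(1) pW by (simp add: continuous_on_eq_continuous_at)
  moreover have "\<eta> * c > 0" using \<eta> c by simp
  ultimately obtain \<delta>2 where \<delta>2: "\<delta>2 > 0" "\<And>x. dist x p < \<delta>2 \<Longrightarrow> dist \<bar>N x \<bullet> e\<bar> c < \<eta> * c"
    unfolding continuous_at_eps_delta c_def by blast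
  define \<delta> where "\<delta> = min \<delta>1 \<delta>2"
  let ?r = "(1 + \<eta>) / (1 - \<eta>)"
  have r: "1 + \<eta> \<le> ?r" "1 / (1 - \<eta>) \<le> ?r" using \<eta> by (auto simp: field_simps)
  have r1: "(1 + \<eta>) * (1 / (1 - \<eta>)) ^ d \<le> ?r ^ Suc d" "(1 + \<eta>) ^ d * (1 / (1 - \<eta>)) \<le> ?r ^ Suc d"
  proof -
    show "(1 + \<eta>) * (1 / (1 - \<eta>)) ^ d \<le> ?r ^ Suc d"
      unfolding power_Suc by (intro mult_mono power_mono r) (use \<eta> in auto)
    show "(1 + \<eta>) ^ d * (1 / (1 - \<eta>)) \<le> ?r ^ Suc d"
      unfolding power_Suc2 by (intro mult_mono power_mono r) (use \<eta> in auto)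
  qed
  have "emeasure area_measure A \<le> ennreal (?r ^ Suc d) * emeasure chart_measure A \<and>
     emeasure chart_measure A \<le> ennreal (?r ^ Suc d) * emeasure area_measure A"
    if A: "A \<in> sets borel" "A \<subseteq> M \<inter> W \<inter> ball p \<delta>" for A
  proof -
    have A1: "A \<subseteq> M \<inter> W \<inter> ball p \<delta>1" and A0: "A \<subseteq> M \<inter> W" using A(2) by (auto simp: \<delta>_def)
    have Nx: "\<bar>N x \<bullet> e\<bar> \<le> (1 + \<eta>) * c" "(1 - \<eta>) * c \<le> \<bar>N x \<bullet> e\<bar>" if "x \<in> A" for x
    proof -
      have "dist x p < \<delta>2" using that A(2) by (auto simp: \<delta>_def dist_commute)
      from \<delta>2(2)[OF this] show "\<bar>N x \<bullet> e\<bar> \<le> (1 + \<eta>) * c" "(1 - \<eta>) * c \<le> \<bar>N x \<bullet> e\<bar>"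
        by (auto simp: dist_real_def algebra_simps)
    qed
    note H = \<delta>1(2)[OF A(1) A1]
    have "emeasure area_measure A \<le> ennreal ((1 + \<eta>) * c) * hausdorff_outer d A"
      by (rule emeasure_area_measure(1)[OF A(1) A0 Nx(1)]) (use \<eta> c in auto)
    also have "\<dots> = ennreal (1 + \<eta>) * (ennreal c * hausdorff_outer d A)"
      using \<eta> c by (simp add: ennreal_mult mult_ac)
    also have "\<dots> \<le> ennreal (1 + \<eta>) * (ennreal ((1 / (1 - \<eta>)) ^ d) * emeasure chart_measure A)"
      using H by (intro mult_left_mono) auto
    also have "\<dots> = ennreal ((1 + \<eta>) * (1 / (1 - \<eta>)) ^ d) * emeasure chart_measure A"
      using \<eta> by (subst ennreal_mult) (auto simp: mult_ac)
    also have "\<dots> \<le> ennreal (?r ^ Suc d) * emeasure chart_measure A"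
      using r1 by (intro mult_right_mono ennreal_leI) auto
    finally have 1: "emeasure area_measure A \<le> ennreal (?r ^ Suc d) * emeasure chart_measure A" .
    have "ennreal (1 - \<eta>) * (ennreal c * hausdorff_outer d A) = ennreal ((1 - \<eta>) * c) * hausdorff_outer d A"
      using \<eta> c by (simp add: ennreal_mult mult_ac)
    also have "\<dots> \<le> emeasure area_measure A"
      by (rule emeasure_area_measure(2)[OF A(1) A0 Nx(2)]) (use \<eta> c in auto)
    finally have "ennreal (1 / (1 - \<eta>)) * (ennreal (1 - \<eta>) * (ennreal c * hausdorff_outer d A)) \<le> ennreal (1 / (1 - \<eta>)) * emeasure area_measure A"
      by (rule mult_left_mono) simp
    moreover have "ennreal (1 / (1 - \<eta>)) * ennreal (1 - \<eta>) = 1"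
      using \<eta> by (subst ennreal_mult[symmetric]) auto
    ultimately have 3: "ennreal c * hausdorff_outer d A \<le> ennreal (1 / (1 - \<eta>)) * emeasure area_measure A"
      by (simp add: mult.assoc[symmetric])
    have "emeasure chart_measure A \<le> ennreal ((1 + \<eta>) ^ d) * (ennreal c * hausdorff_outer d A)" using H by simp
    also have "\<dots> \<le> ennreal ((1 + \<eta>) ^ d) * (ennreal (1 / (1 - \<eta>)) * emeasure area_measure A)"
      using 3 by (intro mult_left_mono) auto
    also have "\<dots> = ennreal ((1 + \<eta>) ^ d * (1 / (1 - \<eta>))) * emeasure area_measure A"
      using \<eta> by (subst ennreal_mult) (auto simp: mult_ac)
    also have "\<dots> \<le> ennreal (?r ^ Suc d) * emeasure area_measure A"
      using r1 by (intro mult_right_mono ennreal_leI) auto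
    finally show ?thesis using 1 by blast
  qed
  moreover have "\<delta> > 0" using \<delta>1(1) \<delta>2(1) by (simp add: \<delta>_def)
  ultimately show ?thesis by blast
qed

text \<open>The local comparison globalises with its factor unchanged, and the factor tends to 1
  with \<eta>. Outside M \<inter> W both measures vanish.\<close>

lemma area_measure_eq: "area_measure = chart_measure"
proof (rule measure_eqI)
  have s: "sets area_measure = sets borel" "sets chart_measure = sets borel"
    by (auto simp: area_measure_def chart_measure_def sets_\<mu>)
  then show "sets area_measure = sets chart_measure" by simp
  have loc1: "emeasure area_measure A \<le> ennreal (((1 + \<eta>) / (1 - \<eta>)) ^ Suc d) * emeasure chart_measure A"
    if "0 < \<eta>" "\<eta> < 1" "A \<in> sets borel" "A \<subseteq> M \<inter> W" for A \<eta>
  proof (rule emeasure_le_if_locally_le[OF s _ that(3,4)])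
    fix p assume "p \<in> M \<inter> W"
    then show "\<exists>\<delta>>0. \<forall>A\<in>sets borel. A \<subseteq> M \<inter> W \<inter> ball p \<delta> \<longrightarrow>
      emeasure area_measure A \<le> ennreal (((1 + \<eta>) / (1 - \<eta>)) ^ Suc d) * emeasure chart_measure A"
      using area_chart_local[OF _ that(1,2), of p] by blast
  qed
  have loc2: "emeasure chart_measure A \<le> ennreal (((1 + \<eta>) / (1 - \<eta>)) ^ Suc d) * emeasure area_measure A"
    if "0 < \<eta>" "\<eta> < 1" "A \<in> sets borel" "A \<subseteq> M \<inter> W" for A \<eta>
  proof (rule emeasure_le_if_locally_le[OF s(2,1) _ that(3,4)])
    fix p assume "p \<in> M \<inter> W"
    then show "\<exists>\<delta>>0. \<forall>A\<in>sets borel. A \<subseteq> M \<inter> W \<inter> ball p \<delta> \<longrightarrow>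
      emeasure chart_measure A \<le> ennreal (((1 + \<eta>) / (1 - \<eta>)) ^ Suc d) * emeasure area_measure A"
      using area_chart_local[OF _ that(1,2), of p] by blast
  qed
  fix A assume "A \<in> sets area_measure"
  then have A: "A \<in> sets borel" by (simp add: s)
  define A' where "A' = A \<inter> (M \<inter> W)"
  have A': "A' \<in> sets borel" "A' \<subseteq> M \<inter> W" using A borel_MW by (auto simp: A'_def)
  have "emeasure area_measure A' = emeasure chart_measure A'"
    using ennreal_le_if_le_ratio_power[OF loc1[OF _ _ A']] ennreal_le_if_le_ratio_power[OF loc2[OF _ _ A']]
    by (rule antisym)
  moreover have "emeasure area_measure A = emeasure area_measure A'"
  proof -
    note [measurable_cong] = sets_\<mu>
    note [measurable] = borel_Ne
    have "emeasure area_measure A = (\<integral>\<^sup>+x. ennreal (indicator (M \<inter> W) x * \<bar>N x \<bullet> e\<bar>) * indicator A x \<partial>\<mu>)"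
      unfolding area_measure_def using A by (intro emeasure_density) (auto simp: sets_\<mu>)
    also have "\<dots> = (\<integral>\<^sup>+x. ennreal (indicator (M \<inter> W) x * \<bar>N x \<bullet> e\<bar>) * indicator A' x \<partial>\<mu>)"
      by (rule nn_integral_cong) (simp add: A'_def split: split_indicator)
    also have "\<dots> = emeasure area_measure A'"
      unfolding area_measure_def using A'(1) by (intro emeasure_density[symmetric]) (auto simp: sets_\<mu>)
    finally show ?thesis .
  qed
  moreover have "emeasure chart_measure A = emeasure chart_measure A'"
  proof -
    have "{z \<in> C. pr z \<in> A \<and> z \<in> slab} = {z \<in> C. pr z \<in> A' \<and> z \<in> slab}"
      using pr_props(1) by (auto simp: A'_def)
    then show ?thesis using A A' by (simp add: emeasure_chart_measure)
  qed
  ultimately show "emeasure area_measure A = emeasure chart_measure A" by simp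
qed

section \<open>Surface integrals as slab integrals\<close>

lemma surface_integral:
  assumes K: "compact K" "K \<subseteq> M \<inter> W" and F: "continuous_on K F"
    and int: "integrable lborel (\<lambda>z. indicator slab z * (if z \<in> sheet K then F (pr z) / \<bar>N (pr z) \<bullet> e\<bar> else 0))"
  shows "integrable \<mu> (\<lambda>x. indicator K x * F x)"
    "(\<integral>x. indicator K x * F x \<partial>\<mu>) = enn2real plane_const *
       (\<integral>z. indicator slab z * (if z \<in> sheet K then F (pr z) / \<bar>N (pr z) \<bullet> e\<bar> else 0) \<partial>lborel)"
proof -
  \<comment> \<open>The quotient cancels the density of \<open>area_measure\<close>.\<close>
  define \<phi> where "\<phi> x = (if x \<in> K then F x / \<bar>N x \<bullet> e\<bar> else 0)" for x
  define k where "k = enn2real plane_const"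
  have KW: "K \<subseteq> W" and Kcl: "closed K" using K compact_imp_closed by auto
  have Ne: "N x \<bullet> e \<noteq> 0" if "x \<in> K" for x using N(3) KW that by blast
  have \<phi>: "\<phi> \<in> borel_measurable borel"
    unfolding \<phi>_def[abs_def] using Kcl Ne
    by (intro borel_measurable_continuous_on_if continuous_intros F continuous_on_subset[OF cont_N KW]) auto
  have pc: "plane_const * indicator X z = ennreal (k * indicator X z)" for X and z :: 'a
    using plane_const_finite by (auto simp: k_def split: split_indicator)
  note [measurable_cong] = sets_\<mu>
  note [measurable] = borel_C borel_slab borel_pr0 \<phi> borel_Ne
  have k0: "0 \<le> k" by (simp add: k_def)
  let ?R = "\<lambda>z. indicator slab z * (if z \<in> sheet K then F (pr z) / \<bar>N (pr z) \<bullet> e\<bar> else 0)"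
  have eq1: "(\<lambda>x. indicator (M \<inter> W) x * \<bar>N x \<bullet> e\<bar> * \<phi> x) = (\<lambda>x. indicator K x * F x)"
    using K(2) Ne by (auto simp: \<phi>_def fun_eq_iff split: split_indicator)
  have eq2: "(\<lambda>z. k * indicator (C \<inter> slab) z * \<phi> (pr0 z)) = (\<lambda>z. k * ?R z)"
    by (auto simp: \<phi>_def fun_eq_iff pr0_def sheet_def split: split_indicator)
  have cm: "chart_measure = distr (density lborel (\<lambda>z. ennreal (k * indicator (C \<inter> slab) z))) borel pr0"
    unfolding chart_measure_def pc ..
  have i2: "integrable chart_measure \<phi>"
    unfolding cm using k0 int
    by (subst integrable_distr_eq) (auto simp: integrable_density eq2)
  have "integrable area_measure \<phi>" using i2 by (simp add: area_measure_eq)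
  then show "integrable \<mu> (\<lambda>x. indicator K x * F x)"
    unfolding area_measure_def by (subst (asm) integrable_density) (auto simp: eq1)
  have "(\<integral>x. indicator K x * F x \<partial>\<mu>) = (\<integral>x. \<phi> x \<partial>area_measure)"
    unfolding area_measure_def by (subst integral_density) (auto simp: eq1)
  also have "\<dots> = (\<integral>x. \<phi> x \<partial>chart_measure)" by (simp add: area_measure_eq)
  also have "\<dots> = (\<integral>z. k * ?R z \<partial>lborel)"
    unfolding cm eq2[symmetric] using k0 by (subst integral_distr) (auto simp: integral_density)
  finally show "(\<integral>x. indicator K x * F x \<partial>\<mu>) = enn2real plane_const * (\<integral>z. ?R z \<partial>lborel)"
    unfolding k_def by simp
qed

lemma chart_integral_radial_div:
  assumes \<psi>: "\<And>x. x \<in> W \<Longrightarrow> (\<psi> has_derivative (\<lambda>v. G x \<bullet> v)) (at x)"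
    and G: "continuous_on W G" and K: "compact K" "K \<subseteq> M \<inter> W"
    and zero: "\<And>x. x \<in> M \<inter> W - K \<Longrightarrow> \<psi> x = 0"
  shows "integrable \<mu> (\<lambda>x. indicator K x * radial_div \<nu> (mean_curv M \<nu>) \<psi> G x)"
    "(\<integral>x. indicator K x * radial_div \<nu> (mean_curv M \<nu>) \<psi> G x \<partial>\<mu>) = 0"
proof -
  have KW: "K \<subseteq> W" using K by auto
  let ?F = "radial_div N H \<psi> G"
  let ?D = "\<lambda>z. indicator slab z * (if z \<in> sheet K then ?F (pr z) / (N (pr z) \<bullet> e) else 0)"
  let ?D' = "\<lambda>z. indicator slab z * (if z \<in> sheet K then ?F (pr z) / \<bar>N (pr z) \<bullet> e\<bar> else 0)"
  \<comment> \<open>The divergence identity produces N \<bullet> e, the area formula its absolute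
    value; the sign is constant on the chart and factors out.\<close>
  obtain \<sigma> :: real where \<sigma>: "\<And>x. x \<in> W \<Longrightarrow> \<bar>N x \<bullet> e\<bar> = \<sigma> * (N x \<bullet> e)" "\<sigma> = 1 \<or> \<sigma> = -1"
  proof (cases "\<forall>x\<in>W. g x \<bullet> e > 0")
    case True
    then have "N x \<bullet> e > 0" if "x \<in> W" for x using that g0 by (simp add: N_def)
    then show ?thesis using that[of 1] by (simp add: abs_of_pos)
  next
    case False
    then have "\<forall>x\<in>W. g x \<bullet> e < 0" using ge_sign by blast
    then have "N x \<bullet> e < 0" if "x \<in> W" for x
      using that g0 by (simp add: N_def mult_pos_neg)
    then show ?thesis using that[of "-1"] by (simp add: abs_of_neg)
  qed
  have D': "?D' = (\<lambda>z. \<sigma> * ?D z)"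
  proof
    fix z
    show "?D' z = \<sigma> * ?D z"
      using \<sigma>(1)[of "pr z"] \<sigma>(2) KW by (auto simp: sheet_def)
  qed
  have contF: "continuous_on K ?F"
  proof -
    have "continuous_on W \<psi>" by (meson W(1) \<psi> continuous_at_imp_continuous_on has_derivative_continuous)
    then have "continuous_on W ?F"
      unfolding radial_div_def by (intro continuous_intros G cont_N cont_H)
    then show ?thesis using KW continuous_on_subset by blast
  qed
  have int: "integrable lborel ?D'" "(\<integral>z. ?D' z \<partial>lborel) = 0"
    unfolding D' using slab_integral_radial_div[OF \<psi> G K zero] by auto
  have eq: "indicator K x * radial_div \<nu> (mean_curv M \<nu>) \<psi> G x = indicator K x * ?F x" for x
  proof (cases "x \<in> K")
    case True
    then have "x \<in> M \<inter> W" using K(2) by blast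
    then show ?thesis by (simp add: radial_div_def nuN mean_curv_eq)
  qed simp
  show "integrable \<mu> (\<lambda>x. indicator K x * radial_div \<nu> (mean_curv M \<nu>) \<psi> G x)"
    "(\<integral>x. indicator K x * radial_div \<nu> (mean_curv M \<nu>) \<psi> G x \<partial>\<mu>) = 0"
    unfolding eq using surface_integral[OF K contF int(1)] int(2) by auto
qed

end

section \<open>The divergence theorem on a hypersurface\<close>

lemma DERIV_pos_part_square:
  "((\<lambda>s::real. (max 0 s)\<^sup>2) has_real_derivative 2 * max 0 s) (at s)"
proof -
  consider "s > 0" | "s < 0" | "s = 0" by linarith
  then show ?thesis
  proof cases
    case 1
    have "((\<lambda>s::real. s\<^sup>2) has_real_derivative 2 * s) (at s)"
      by (auto intro!: derivative_eq_intros)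
    then have "((\<lambda>s::real. (max 0 s)\<^sup>2) has_real_derivative 2 * s) (at s)"
      by (rule has_field_derivative_transform_within_open[where S="{0<..}"]) (use 1 in auto)
    then show ?thesis using 1 by simp
  next
    case 2
    have "((\<lambda>s::real. 0::real) has_real_derivative 0) (at s)" by simp
    then have "((\<lambda>s::real. (max 0 s)\<^sup>2) has_real_derivative 0) (at s)"
      by (rule has_field_derivative_transform_within_open[where S="{..<0}"]) (use 2 in auto)
    then show ?thesis using 2 by simp
  next
    case 3
    have "((\<lambda>h::real. (max 0 h)\<^sup>2 / h) \<longlongrightarrow> 0) (at 0)"
    proof (rule Lim_null_comparison)
      show "\<forall>\<^sub>F h::real in at 0. norm ((max 0 h)\<^sup>2 / h) \<le> \<bar>h\<bar>"
        by (rule always_eventually) (auto simp: max_def power2_eq_square)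
      show "((\<lambda>h::real. \<bar>h\<bar>) \<longlongrightarrow> 0) (at 0)" by (rule tendsto_rabs_zero) (rule tendsto_ident_at)
    qed
    then show ?thesis using 3 by (simp add: DERIV_def)
  qed
qed

lemma bump_function:
  fixes p :: "'a::euclidean_space"
  assumes \<rho>: "\<rho> > 0"
  obtains \<eta> :: "'a \<Rightarrow> real" and \<gamma> where "\<And>x. (\<eta> has_derivative (\<lambda>v. \<gamma> x \<bullet> v)) (at x)" "continuous_on UNIV \<gamma>"
    "\<And>x. x \<in> ball p \<rho> \<Longrightarrow> \<eta> x = 1 \<and> \<gamma> x = 0" "\<And>x. x \<notin> cball p (2 * \<rho>) \<Longrightarrow> \<eta> x = 0 \<and> \<gamma> x = 0"
proof -
  \<comment> \<open>t is negative inside the ball of radius \<rho> and exceeds 1 outside that of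
    radius 2 \<rho>. The profile is 1 for t \<le> 0 and 0 for t \<ge> 1, and squared positive parts
    make it C^1.\<close>
  define t where "t x = ((x - p) \<bullet> (x - p)) / \<rho>\<^sup>2 - 1" for x
  define \<eta> where "\<eta> x = (max 0 (1 - (max 0 (t x))\<^sup>2))\<^sup>2" for x
  define c where "c x = 2 * max 0 (1 - (max 0 (t x))\<^sup>2) * (- (2 * max 0 (t x)))" for x
  define \<gamma> where "\<gamma> x = (c x * (2 / \<rho>\<^sup>2)) *\<^sub>R (x - p)" for x
  have d: "(\<eta> has_derivative (\<lambda>v. \<gamma> x \<bullet> v)) (at x)" for x
  proof -
    have t: "(t has_derivative (\<lambda>v. (2 / \<rho>\<^sup>2) * ((x - p) \<bullet> v))) (at x)"
    proof -
      have "((\<lambda>x. (x - p) \<bullet> (x - p)) has_derivative (\<lambda>v. 2 * ((x - p) \<bullet> v))) (at x)"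
        by (auto intro!: derivative_eq_intros simp: inner_commute)
      from has_derivative_diff[OF has_derivative_mult_right[OF this, of "1 / \<rho>\<^sup>2"] has_derivative_const[of 1]]
      show ?thesis by (simp add: t_def[abs_def])
    qed
    have "((\<lambda>s::real. 1 - (max 0 s)\<^sup>2) has_real_derivative - (2 * max 0 s)) (at s)" for s
      using DERIV_diff[OF DERIV_const[of 1] DERIV_pos_part_square[of s]] by simp
    from DERIV_chain2[OF DERIV_pos_part_square this]
    have "((\<lambda>s::real. (max 0 (1 - (max 0 s)\<^sup>2))\<^sup>2) has_real_derivative
        2 * max 0 (1 - (max 0 s)\<^sup>2) * (- (2 * max 0 s))) (at s)" for s .
    from has_derivative_compose[OF t this[unfolded has_field_derivative_def]]
    have "(\<eta> has_derivative (\<lambda>v. c x * ((2 / \<rho>\<^sup>2) * ((x - p) \<bullet> v)))) (at x)"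
      unfolding \<eta>_def[abs_def] c_def .
    then show ?thesis by (simp add: \<gamma>_def mult.assoc)
  qed
  have cont: "continuous_on UNIV \<gamma>"
    unfolding \<gamma>_def c_def t_def using \<rho> by (intro continuous_intros) auto
  have 1: "\<eta> x = 1 \<and> \<gamma> x = 0" if "x \<in> ball p \<rho>" for x
  proof -
    have "norm (x - p) < \<rho>" using that by (simp add: dist_norm norm_minus_commute)
    then have "(norm (x - p))\<^sup>2 < \<rho>\<^sup>2" by (intro power_strict_mono) auto
    then have "t x < 0" using \<rho> by (simp add: t_def dot_square_norm)
    then show ?thesis by (simp add: \<eta>_def \<gamma>_def c_def)
  qed
  have 0: "\<eta> x = 0 \<and> \<gamma> x = 0" if "x \<notin> cball p (2 * \<rho>)" for x
  proof -
    have "norm (x - p) > 2 * \<rho>" using that by (simp add: dist_norm norm_minus_commute)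
    then have "(norm (x - p))\<^sup>2 > (2 * \<rho>)\<^sup>2" using \<rho> by (intro power_strict_mono) auto
    then have "4 * \<rho>\<^sup>2 < (norm (x - p))\<^sup>2" by (simp add: power_mult_distrib)
    moreover have r2: "0 < \<rho>\<^sup>2" using \<rho> by simp
    ultimately have "2 * \<rho>\<^sup>2 < (norm (x - p))\<^sup>2" by linarith
    then have "2 < (norm (x - p))\<^sup>2 / \<rho>\<^sup>2" using r2 by (simp only: pos_less_divide_eq)
    then have "t x > 1" by (simp add: t_def dot_square_norm)
    then have "(max 0 (t x))\<^sup>2 \<ge> 1" by simp
    then have "max 0 (1 - (max 0 (t x))\<^sup>2) = 0" by simp
    then show ?thesis by (simp only: \<eta>_def \<gamma>_def c_def) simp
  qed
  show ?thesis using that d cont 1 0 by blast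
qed

text \<open>The given normal field is only continuous and orthogonal to tangent curves. A
  provisional chart with the normalised gradient supplies enough such curves to show that the two
  normals agree up to sign; the sign is constant near \<open>p\<close> and is then absorbed into
  \<open>f\<close>.\<close>

lemma hypersurface_chart_exists:
  fixes M :: "'a::euclidean_space set"
  assumes M: "smooth_hypersurface M" and \<nu>: "unit_normal_field M \<nu>" and p: "p \<in> M"
  obtains f g h e W where "hypersurface_chart M \<nu> f g h e W" "p \<in> W"
proof -
  obtain U f where U: "open U" "p \<in> U" "smooth_on U f" "\<And>x. x \<in> U \<Longrightarrow> grad f x \<noteq> 0" "M \<inter> U = {x\<in>U. f x = 0}"
    using M p unfolding smooth_hypersurface_def by metis
  obtain h where h: "\<And>x. x \<in> U \<Longrightarrow> (f has_derivative (\<lambda>v. grad f x \<bullet> v)) (at x)"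
    "\<And>x. x \<in> U \<Longrightarrow> (grad f has_derivative h x) (at x)" "\<And>v. continuous_on U (\<lambda>x. h x v)"
    using smooth_on_hessian[OF U(1,3)] by blast
  obtain e where e: "e \<in> Basis" "grad f p \<bullet> e \<noteq> 0"
    using U(2,4) euclidean_all_zero_iff by blast
  have "isCont (grad f) p" using h(2)[OF U(2)] by (rule has_derivative_continuous)
  then have "isCont (\<lambda>x. grad f x \<bullet> e) p" by (intro continuous_intros)
  moreover have "\<bar>grad f p \<bullet> e\<bar> > 0" using e by simp
  ultimately obtain \<delta>1 where \<delta>1: "\<delta>1 > 0" "\<And>x. dist x p < \<delta>1 \<Longrightarrow> dist (grad f x \<bullet> e) (grad f p \<bullet> e) < \<bar>grad f p \<bullet> e\<bar>"
    unfolding continuous_at_eps_delta by blast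
  obtain \<delta>2 where \<delta>2: "\<delta>2 > 0" "ball p \<delta>2 \<subseteq> U" using U(1,2) open_contains_ball by blast
  define W where "W = ball p (min \<delta>1 \<delta>2)"
  have WU: "W \<subseteq> U" and pW: "p \<in> W" using \<delta>1 \<delta>2 by (auto simp: W_def)
  have sign: "(\<forall>x\<in>W. grad f x \<bullet> e > 0) \<or> (\<forall>x\<in>W. grad f x \<bullet> e < 0)"
  proof -
    have d: "\<bar>grad f x \<bullet> e - grad f p \<bullet> e\<bar> < \<bar>grad f p \<bullet> e\<bar>" if "x \<in> W" for x
      using \<delta>1(2)[of x] that by (simp add: W_def dist_commute dist_real_def)
    show ?thesis
    proof (cases "grad f p \<bullet> e > 0")
      case True then show ?thesis using d by (intro disjI1 ballI) (smt (verit))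
    next
      case False then show ?thesis using d by (intro disjI2 ballI) (smt (verit))
    qed
  qed
  have MW: "M \<inter> W = {x\<in>W. f x = 0}" using U(5) WU by blast
  interpret c: hypersurface_chart M "\<lambda>x. grad f x /\<^sub>R norm (grad f x)" f "grad f" h e W
    by unfold_locales
      (use e h WU sign MW in \<open>auto simp: W_def intro: continuous_on_subset\<close>)
  have \<nu>1: "norm (\<nu> x) = 1" and \<nu>t: "v \<in> tangent_space M x \<Longrightarrow> \<nu> x \<bullet> v = 0" if "x \<in> M" for x v
    using \<nu> that unfolding unit_normal_field_def by auto
  have par: "\<nu> x = (\<nu> x \<bullet> c.N x) *\<^sub>R c.N x" "\<bar>\<nu> x \<bullet> c.N x\<bar> = 1" if x: "x \<in> M \<inter> W" for x
  proof -
    have xW: "x \<in> W" using x by simp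
    \<comment> \<open>The tangential part of the normal: being a tangent vector it is orthogonal to
      \<nu>, hence to itself.\<close>
    define v where "v = \<nu> x - (\<nu> x \<bullet> c.N x) *\<^sub>R c.N x"
    have v0: "c.N x \<bullet> v = 0" using c.N[OF xW] by (simp add: v_def inner_diff_right inner_commute)
    obtain \<delta> where \<delta>: "\<delta> > 0" "\<forall>t\<in>{-\<delta><..<\<delta>}. c.pr (x + t *\<^sub>R v) \<in> M"
      using c.M_curve(1)[OF x v0] by blast
    have "v \<in> tangent_space M x"
      unfolding tangent_space_def has_vector_derivative_def
      using \<delta> c.M_curve(2)[OF x v0] c.on_M(2)[OF x]
      by (intro CollectI exI[of _ "\<lambda>t. c.pr (x + t *\<^sub>R v)"] exI[of _ \<delta>]) simp
    then have "\<nu> x \<bullet> v = 0" using \<nu>t[of x v] x by simp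
    then have "v \<bullet> v = 0" using v0 by (simp add: v_def inner_diff_left inner_diff_right inner_commute)
    then show eq: "\<nu> x = (\<nu> x \<bullet> c.N x) *\<^sub>R c.N x" by (simp add: v_def)
    have "norm (\<nu> x) = \<bar>\<nu> x \<bullet> c.N x\<bar> * norm (c.N x)" by (subst (1) eq) simp
    then show "\<bar>\<nu> x \<bullet> c.N x\<bar> = 1" using \<nu>1[of x] x c.N[OF xW] by simp
  qed
  define \<sigma> where "\<sigma> = \<nu> p \<bullet> c.N p"
  have \<sigma>: "\<bar>\<sigma>\<bar> = 1" using par(2)[of p] p pW by (simp add: \<sigma>_def)
  have "continuous_on (M \<inter> W) (\<lambda>x. \<nu> x \<bullet> c.N x)"
    using \<nu> by (intro continuous_intros continuous_on_subset[OF c.cont_N])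
      (auto simp: unit_normal_field_def intro: continuous_on_subset)
  \<comment> \<open>Both numbers are 1 or -1, so a distance below 1 makes them equal.\<close>
  then obtain \<delta>3 where \<delta>3: "\<delta>3 > 0" "\<And>x. x \<in> M \<inter> W \<Longrightarrow> dist x p < \<delta>3 \<Longrightarrow> dist (\<nu> x \<bullet> c.N x) \<sigma> < 1"
    unfolding continuous_on_iff \<sigma>_def using p pW by (metis IntI zero_less_one)
  have same: "\<nu> x = \<sigma> *\<^sub>R c.N x" if "x \<in> M \<inter> W" "dist x p < \<delta>3" for x
  proof -
    have "\<bar>\<nu> x \<bullet> c.N x - \<sigma>\<bar> < 1" using \<delta>3(2)[OF that] by (simp add: dist_real_def)
    then have "\<nu> x \<bullet> c.N x = \<sigma>" using \<sigma> par(2)[OF that(1)] by linarith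
    then show ?thesis using par(1)[OF that(1)] by simp
  qed
  define W' where "W' = ball p (min \<delta>3 (min \<delta>1 \<delta>2))"
  have W'W: "W' \<subseteq> W" and pW': "p \<in> W'" using \<delta>1 \<delta>2 \<delta>3 by (auto simp: W'_def W_def)
  have "hypersurface_chart M \<nu> (\<lambda>x. \<sigma> * f x) (\<lambda>x. \<sigma> *\<^sub>R grad f x) (\<lambda>x v. \<sigma> *\<^sub>R h x v) e W'"
  proof
    show "e \<in> Basis" "open W'" "convex W'" using e by (auto simp: W'_def)
    fix x assume x: "x \<in> W'"
    then have xU: "x \<in> U" using W'W WU by blast
    show "((\<lambda>x. \<sigma> * f x) has_derivative (\<lambda>v. (\<sigma> *\<^sub>R grad f x) \<bullet> v)) (at x)"
      using has_derivative_mult_right[OF h(1)[OF xU], of \<sigma>] by simp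
    show "((\<lambda>x. \<sigma> *\<^sub>R grad f x) has_derivative (\<lambda>v. \<sigma> *\<^sub>R h x v)) (at x)"
      by (intro has_derivative_scaleR_right h(2)[OF xU])
  next
    fix v
    have "continuous_on W' (\<lambda>x. h x v)" using h(3) W'W WU by (meson continuous_on_subset)
    then show "continuous_on W' (\<lambda>x. \<sigma> *\<^sub>R h x v)" by (intro continuous_intros)
  next
    show "(\<forall>x\<in>W'. 0 < \<sigma> *\<^sub>R grad f x \<bullet> e) \<or> (\<forall>x\<in>W'. \<sigma> *\<^sub>R grad f x \<bullet> e < 0)"
    proof (cases "\<sigma> > 0")
      case True
      then show ?thesis using sign W'W by (auto simp: zero_less_mult_iff mult_less_0_iff)
    next
      case False
      then have "\<sigma> < 0" using \<sigma> by linarith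
      then show ?thesis using sign W'W by (auto simp: zero_less_mult_iff mult_less_0_iff)
    qed
    show "M \<inter> W' = {x \<in> W'. \<sigma> * f x = 0}" using MW W'W \<sigma> by auto
    fix x assume x: "x \<in> M \<inter> W'"
    then have "\<nu> x = \<sigma> *\<^sub>R c.N x" using same[of x] W'W by (auto simp: W'_def dist_commute)
    then show "\<nu> x = (\<sigma> *\<^sub>R grad f x) /\<^sub>R norm (\<sigma> *\<^sub>R grad f x)" using \<sigma> by (simp add: c.N_def)
  qed
  then show ?thesis using that pW' by blast
qed

section \<open>Global properties of the surface\<close>

lemma continuous_on_mean_curv:
  assumes M: "smooth_hypersurface M" and \<nu>: "unit_normal_field M \<nu>"
  shows "continuous_on M (mean_curv M \<nu>)"
  unfolding continuous_on_eq_continuous_within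
proof
  fix p assume p: "p \<in> M"
  obtain f g h e W where "hypersurface_chart M \<nu> f g h e W" and pW: "p \<in> W"
    using hypersurface_chart_exists[OF M \<nu> p] by blast
  then interpret hypersurface_chart M \<nu> f g h e W by simp
  have "continuous_on (M \<inter> W) (mean_curv M \<nu>)"
    by (rule continuous_on_eq[OF continuous_on_subset[OF cont_H]]) (auto simp: mean_curv_eq)
  then have "continuous (at p within M \<inter> W) (mean_curv M \<nu>)"
    using p pW by (simp add: continuous_on_eq_continuous_within)
  moreover have "at p within M \<inter> W = at p within M"
    by (rule at_within_nhd[OF pW W(1)]) auto
  ultimately show "continuous (at p within M) (mean_curv M \<nu>)" by simp
qed

text \<open>M need not be closed, but it is closed in the union of its defining neighbourhoods,
  hence the intersection of an open and a closed set.\<close>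

lemma hypersurface_borel:
  fixes M :: "'a::euclidean_space set"
  assumes M: "smooth_hypersurface M"
  shows "M \<in> sets borel"
proof -
  define \<U> where "\<U> = {U. open U \<and> (\<exists>f. smooth_on U f \<and> M \<inter> U = {x\<in>U. f x = 0})}"
  have cov: "M \<subseteq> \<Union>\<U>" using M unfolding smooth_hypersurface_def \<U>_def by blast
  have "M = \<Union>\<U> \<inter> closure M"
  proof
    show "M \<subseteq> \<Union>\<U> \<inter> closure M" using cov closure_subset by blast
    show "\<Union>\<U> \<inter> closure M \<subseteq> M"
    proof
      fix x assume "x \<in> \<Union>\<U> \<inter> closure M"
      then obtain U f where U: "open U" "x \<in> U" "smooth_on U f" "M \<inter> U = {x\<in>U. f x = 0}" "x \<in> closure M"
        by (auto simp: \<U>_def)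
      have cf: "continuous_on U f" using U(3) Ck_on.simps(1) unfolding smooth_on_def by blast
      have "closedin (top_of_set U) (U \<inter> f -` {0})"
        by (intro continuous_closedin_preimage cf) simp
      then obtain T where T: "closed T" "U \<inter> f -` {0} = U \<inter> T" by (auto simp: closedin_closed)
      have "M \<inter> U \<subseteq> T" using U(4) T(2) by auto
      then have "closure (M \<inter> U) \<subseteq> T" using T(1) by (rule closure_minimal)
      moreover have "x \<in> closure (M \<inter> U)"
        using U(1,2,5) open_Int_closure_subset[of U M] by (auto simp: Int_commute)
      ultimately have "x \<in> U \<inter> f -` {0}" using T(2) U(2) by blast
      then show "x \<in> M" using U(2,4) by auto
    qed
  qed
  moreover have "open (\<Union>\<U>)" by (auto simp: \<U>_def)
  ultimately show ?thesis by (metis borel_closed borel_open closed_closure sets.Int)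
qed

text \<open>Induction over a finite cover of \<open>K\<close> plays the role of a partition of
  unity: a bump function splits \<psi> into a part inside one chart and a part that vanishes near
  the corresponding ball, and \<open>radial_div\<close> is linear in \<psi> and \<open>G\<close>
  jointly. \<open>G\<close> must vanish off \<open>K\<close> too, since the integral extends over
  all of M.\<close>

lemma hypersurface_integral_radial_div:
  fixes M :: "'a::euclidean_space set"
  assumes \<mu>: "hausdorff_borel \<mu> d" and M: "smooth_hypersurface M" and \<nu>: "unit_normal_field M \<nu>"
    and K: "compact K" "K \<subseteq> M"
    and \<psi>: "\<And>x. (\<psi> has_derivative (\<lambda>v. G x \<bullet> v)) (at x)" "continuous_on UNIV G"
    and zero: "\<And>x. x \<in> M - K \<Longrightarrow> \<psi> x = 0 \<and> G x = 0"
  shows "integrable \<mu> (\<lambda>x. indicator M x * radial_div \<nu> (mean_curv M \<nu>) \<psi> G x) \<and>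
    (\<integral>x. indicator M x * radial_div \<nu> (mean_curv M \<nu>) \<psi> G x \<partial>\<mu>) = 0"
proof -
  let ?F = "radial_div \<nu> (mean_curv M \<nu>)"
  have "\<exists>\<rho>>0. \<exists>f g h e W. hypersurface_chart M \<nu> f g h e W \<and> cball p (2 * \<rho>) \<subseteq> W" if "p \<in> M" for p
  proof -
    obtain f g h e W where c: "hypersurface_chart M \<nu> f g h e W" "p \<in> W"
      using hypersurface_chart_exists[OF M \<nu> \<open>p \<in> M\<close>] by blast
    then have "open W" by (simp add: hypersurface_chart.W)
    then obtain \<delta> where "\<delta> > 0" "cball p \<delta> \<subseteq> W" using c(2) open_contains_cball by blast
    then have "\<delta> / 2 > 0" "cball p (2 * (\<delta> / 2)) \<subseteq> W" by simp_all
    then show ?thesis using c(1) by blast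
  qed
  then have "\<exists>\<rho>. \<forall>p\<in>M. \<rho> p > 0 \<and> (\<exists>f g h e W. hypersurface_chart M \<nu> f g h e W \<and> cball p (2 * \<rho> p) \<subseteq> W)"
    by (intro bchoice) blast
  then obtain \<rho> where \<rho>: "\<And>p. p \<in> M \<Longrightarrow> \<rho> p > 0"
    "\<And>p. p \<in> M \<Longrightarrow> \<exists>f g h e W. hypersurface_chart M \<nu> f g h e W \<and> cball p (2 * \<rho> p) \<subseteq> W" by blast
  obtain A where A: "finite A" "A \<subseteq> M" "K \<subseteq> (\<Union>p\<in>A. ball p (\<rho> p))"
  proof -
    have "K \<subseteq> (\<Union>p\<in>M. ball p (\<rho> p))" using K(2) \<rho>(1) centre_in_ball by blast
    then show ?thesis
      using compactE_image[OF K(1), of M "\<lambda>p. ball p (\<rho> p)"] that by (metis open_ball)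
  qed
  show ?thesis
    using A K \<psi> zero
  proof (induction A arbitrary: K \<psi> G rule: finite_induct)
    case empty
    then have "\<psi> x = 0 \<and> G x = 0" if "x \<in> M" for x using that by auto
    then have eq: "(\<lambda>x. indicator M x * ?F \<psi> G x) = (\<lambda>x. 0)"
      by (auto simp: fun_eq_iff radial_div_def split: split_indicator)
    show ?case unfolding eq by simp
  next
    case (insert p A)
    note \<psi> = insert.prems(5) and G = insert.prems(6) and zero = insert.prems(7)
    have pM: "p \<in> M" using insert.prems by simp
    obtain f g h e W where c: "hypersurface_chart M \<nu> f g h e W" and sub: "cball p (2 * \<rho> p) \<subseteq> W"
      using \<rho>(2)[OF pM] by blast
    interpret c: hausdorff_chart M \<nu> f g h e W \<mu> d
      using c \<mu> by (simp add: hausdorff_chart_def)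
    obtain \<eta> \<gamma> where \<eta>: "\<And>x. (\<eta> has_derivative (\<lambda>v. \<gamma> x \<bullet> v)) (at x)" "continuous_on UNIV \<gamma>"
      "\<And>x. x \<in> ball p (\<rho> p) \<Longrightarrow> \<eta> x = 1 \<and> \<gamma> x = 0" "\<And>x. x \<notin> cball p (2 * \<rho> p) \<Longrightarrow> \<eta> x = 0 \<and> \<gamma> x = 0"
      using bump_function[OF \<rho>(1)[OF pM]] by blast
    have cont: "continuous_on UNIV \<eta>" "continuous_on UNIV \<psi>"
      using \<eta>(1) \<psi> by (meson continuous_at_imp_continuous_on has_derivative_continuous)+
    define \<psi>1 where "\<psi>1 x = \<eta> x * \<psi> x" for x
    define G1 where "G1 x = \<eta> x *\<^sub>R G x + \<psi> x *\<^sub>R \<gamma> x" for x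
    define \<psi>2 where "\<psi>2 x = (1 - \<eta> x) * \<psi> x" for x
    define G2 where "G2 x = (1 - \<eta> x) *\<^sub>R G x - \<psi> x *\<^sub>R \<gamma> x" for x
    have d1: "(\<psi>1 has_derivative (\<lambda>v. G1 x \<bullet> v)) (at x)" for x
      unfolding \<psi>1_def[abs_def] G1_def
      by (rule derivative_eq_intros \<psi> \<eta>(1) refl | simp add: inner_add_left algebra_simps)+
    have d2: "(\<psi>2 has_derivative (\<lambda>v. G2 x \<bullet> v)) (at x)" for x
      unfolding \<psi>2_def[abs_def] G2_def
      by (rule derivative_eq_intros \<psi> \<eta>(1) refl | simp add: inner_diff_left algebra_simps)+
    have c1: "continuous_on S G1" "continuous_on S G2" for S
      unfolding G1_def G2_def
      by (auto intro!: continuous_intros intro: continuous_on_subset[OF cont(1)] continuous_on_subset[OF cont(2)]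
          continuous_on_subset[OF \<eta>(2)] continuous_on_subset[OF G])
    define K1 where "K1 = K \<inter> cball p (2 * \<rho> p)"
    \<comment> \<open>Removing the open ball keeps the set compact and leaves it covered by the
      remaining balls.\<close>
    define K2 where "K2 = K - ball p (\<rho> p)"
    have K1: "compact K1" "K1 \<subseteq> M \<inter> W" using insert.prems sub by (auto simp: K1_def)
    have K2: "compact K2" "K2 \<subseteq> M" using insert.prems by (auto simp: K2_def compact_diff)
    have z1: "\<psi>1 x = 0 \<and> G1 x = 0" if "x \<in> M - K1" for x
      using that zero[of x] \<eta>(4)[of x] by (auto simp: \<psi>1_def G1_def K1_def)
    have z2: "\<psi>2 x = 0 \<and> G2 x = 0" if "x \<in> M - K2" for x
      using that zero[of x] \<eta>(3)[of x] by (auto simp: \<psi>2_def G2_def K2_def)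
    have i1: "integrable \<mu> (\<lambda>x. indicator K1 x * ?F \<psi>1 G1 x)" "(\<integral>x. indicator K1 x * ?F \<psi>1 G1 x \<partial>\<mu>) = 0"
      by (rule c.chart_integral_radial_div[OF d1 c1(1) K1]; use z1 in blast)+
    have i2: "integrable \<mu> (\<lambda>x. indicator M x * ?F \<psi>2 G2 x) \<and> (\<integral>x. indicator M x * ?F \<psi>2 G2 x \<partial>\<mu>) = 0"
    proof (rule insert.IH[OF _ _ K2 d2 c1(2) z2])
      show "A \<subseteq> M" "K2 \<subseteq> (\<Union>p\<in>A. ball p (\<rho> p))" using insert.prems by (auto simp: K2_def)
    qed
    have eq: "(\<lambda>x. indicator M x * ?F \<psi> G x) = (\<lambda>x. indicator K1 x * ?F \<psi>1 G1 x + indicator M x * ?F \<psi>2 G2 x)"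
    proof
      fix x
      have 1: "?F \<psi> G x = ?F \<psi>1 G1 x + ?F \<psi>2 G2 x"
        by (simp add: radial_div_def \<psi>1_def \<psi>2_def G1_def G2_def inner_add_left inner_diff_left algebra_simps)
      have 2: "indicator M x * ?F \<psi>1 G1 x = indicator K1 x * ?F \<psi>1 G1 x"
        using z1[of x] K1(2) by (auto simp: radial_div_def split: split_indicator)
      show "indicator M x * ?F \<psi> G x = indicator K1 x * ?F \<psi>1 G1 x + indicator M x * ?F \<psi>2 G2 x"
        unfolding 1 distrib_left 2 ..
    qed
    show ?case unfolding eq using i1 i2 by simp
  qed
qed

section \<open>The Hardy inequality\<close>

lemma hausdorff_measure_null_or_borel:
  fixes d :: nat
  assumes d: "d = DIM('a) - 1" "d > 0"
  shows "(\<forall>f. (\<integral>\<^sup>+x. f x \<partial>(hausdorff_measure d :: 'a::euclidean_space measure)) = 0)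
    \<or> hausdorff_borel (hausdorff_measure d :: 'a measure) d"
proof -
  let ?\<mu> = "hausdorff_measure d :: 'a measure"
  have sb: "sigma_sets UNIV (sets borel) = sets (borel :: 'a measure)"
    using sets.sigma_sets_eq[of "borel :: 'a measure"] by simp
  have em: "emeasure ?\<mu> B = (if B \<in> sets borel \<and> measure_space UNIV (sets (borel :: 'a measure)) (hausdorff_outer d) then hausdorff_outer d B else 0)" for B
    unfolding hausdorff_measure_def emeasure_measure_of_conv sb ..
  have s: "sets ?\<mu> = sets borel"
    unfolding hausdorff_measure_def by (simp add: sets_measure_of_conv sb)
  show ?thesis
  proof (cases "measure_space UNIV (sets (borel :: 'a measure)) (hausdorff_outer d)")
    case True
    then have "hausdorff_borel ?\<mu> d" using s d em by unfold_locales auto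
    then show ?thesis ..
  next
    case False
    \<comment> \<open>With the whole space null, integrals vanish for every integrand, measurable or
      not.\<close>
    have "AE x in ?\<mu>. False"
    proof (rule AE_I)
      show "emeasure ?\<mu> (space ?\<mu>) = 0" using em False by simp
    qed auto
    then have "(\<integral>\<^sup>+x. f x \<partial>?\<mu>) = (\<integral>\<^sup>+x. 0 \<partial>?\<mu>)" for f
      by (intro nn_integral_cong_AE) (auto elim: eventually_mono)
    then show ?thesis by simp
  qed
qed

section \<open>The pointwise inequality\<close>

lemma weight_inequality:
  fixes a c q X s \<rho> n :: real
  assumes n: "n = 2 * a + 2" and a: "a \<ge> 0" and q: "q > 0" and X: "X = \<rho>\<^sup>2 - s\<^sup>2" "X \<ge> 0" and \<rho>q: "\<rho>\<^sup>2 \<le> q"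
    and c: "c \<ge> 0" "c * \<rho>\<^sup>2 \<le> 1"
  shows "a\<^sup>2 / q + a * (a + 2) * s\<^sup>2 / q\<^sup>2 + c
     \<le> n * (a / q + c) - (a / q + c)\<^sup>2 * X - 2 * a * X / q\<^sup>2 - c\<^sup>2 * s\<^sup>2"
proof -
  define y where "y = 1 / q"
  have y: "y > 0" "q * y = 1" using q by (auto simp: y_def)
  have Xy: "X * y \<le> 1 - s\<^sup>2 * y"
  proof -
    have "(X + s\<^sup>2) * y \<le> q * y" using X \<rho>q y by (intro mult_right_mono) auto
    then show ?thesis using y by (simp add: algebra_simps)
  qed
  have X1: "X * y \<le> 1"
  proof -
    have "0 \<le> s\<^sup>2 * y" using y by simp
    then show ?thesis using Xy by linarith
  qed
  have 1: "(a\<^sup>2 + 2 * a) * y * (X * y) \<le> (a\<^sup>2 + 2 * a) * y * (1 - s\<^sup>2 * y)"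
    using Xy a y by (intro mult_left_mono) auto
  have 2: "2 * a * c * (X * y) \<le> 2 * a * c * 1"
    using X1 a c by (intro mult_left_mono) auto
  have 3: "c * (c * \<rho>\<^sup>2) \<le> c * 1" using c by (intro mult_left_mono) auto
  \<comment> \<open>Here \<rho> is |x|, \<open>s\<close> the normal component of x, \<open>X\<close>
    the squared length of its tangential part, and y = 1 / q. The difference of the two sides is a
    sum of three terms, nonnegative because X + s^2 \<le> q, X \<le> q and c \<rho>^2 \<le>
    1.\<close>
  have "n * (a * y + c) - (a * y + c)\<^sup>2 * X - 2 * a * X * y\<^sup>2 - c\<^sup>2 * s\<^sup>2
     - (a\<^sup>2 * y + a * (a + 2) * s\<^sup>2 * y\<^sup>2 + c)
    = ((a\<^sup>2 + 2 * a) * y * (1 - s\<^sup>2 * y) - (a\<^sup>2 + 2 * a) * y * (X * y))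
      + (2 * a * c * 1 - 2 * a * c * (X * y)) + (c * 1 - c * (c * \<rho>\<^sup>2))"
    unfolding n X(1) by (simp add: algebra_simps power2_eq_square)
  then have "a\<^sup>2 * y + a * (a + 2) * s\<^sup>2 * y\<^sup>2 + c \<le> n * (a * y + c) - (a * y + c)\<^sup>2 * X - 2 * a * X * y\<^sup>2 - c\<^sup>2 * s\<^sup>2"
    using 1 2 3 by linarith
  then show ?thesis by (simp add: y_def power_divide)
qed

text \<open>The curvature and gradient terms need the correction \<open>radial_div\<close> to
  dominate the weights pointwise; integration removes it by the divergence theorem.\<close>

lemma hardy_pointwise:
  fixes x u g :: "'a::euclidean_space" and a c \<epsilon> \<phi> \<eta> :: real
  assumes n: "real DIM('a) - 1 = 2 * a + 2" and a: "a \<ge> 0" and \<epsilon>: "\<epsilon> > 0" and u: "norm u = 1"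
    and c: "c \<ge> 0" "c * (x \<bullet> x) \<le> 1"
  defines "q \<equiv> x \<bullet> x + \<epsilon>"
  shows "\<phi>\<^sup>2 * (a\<^sup>2 / q + a * (a + 2) * (x \<bullet> u)\<^sup>2 / q\<^sup>2 + c / 2)
    \<le> (norm (g - (g \<bullet> u) *\<^sub>R u))\<^sup>2 + a * \<bar>\<eta>\<bar> * \<phi>\<^sup>2 / norm x + 1/4 * (\<eta> * \<phi>)\<^sup>2
      + radial_div (\<lambda>_. u) (\<lambda>_. \<eta>) (\<lambda>_. \<phi>\<^sup>2 * (a / q + c))
          (\<lambda>x. (2 * \<phi> * (a / q + c)) *\<^sub>R g + (- (\<phi>\<^sup>2 * (2 * a / q\<^sup>2))) *\<^sub>R x) x"
proof -
  have uu: "u \<bullet> u = 1" using u by (simp add: dot_square_norm)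
  have q: "q > 0" using \<epsilon> by (simp add: q_def add_nonneg_pos)
  define w where "w = a / q + c"
  define s where "s = x \<bullet> u"
  define gt where "gt = g - (g \<bullet> u) *\<^sub>R u"
  define xt where "xt = x - s *\<^sub>R u"
  define X where "X = xt \<bullet> xt"
  have w0: "w \<ge> 0" using a c q by (simp add: w_def)
  have X': "X = x \<bullet> x - s * s"
    using uu by (simp add: X_def xt_def s_def inner_diff_left inner_diff_right inner_commute[of u x])
  then have X: "X = (norm x)\<^sup>2 - s\<^sup>2" by (simp add: power2_norm_eq_inner power2_eq_square[of s])
  have gx: "gt \<bullet> xt = g \<bullet> x - s * (g \<bullet> u)"
    using uu by (simp add: gt_def xt_def s_def inner_diff_left inner_diff_right inner_commute[of u x])
  have rd: "radial_div (\<lambda>_. u) (\<lambda>_. \<eta>) (\<lambda>_. \<phi>\<^sup>2 * w) (\<lambda>x. (2 * \<phi> * w) *\<^sub>R g + (- (\<phi>\<^sup>2 * (2 * a / q\<^sup>2))) *\<^sub>R x) x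
     = 2 * \<phi> * w * (gt \<bullet> xt) - \<phi>\<^sup>2 * (2 * a * X / q\<^sup>2) + (2 * a + 2) * (\<phi>\<^sup>2 * w) - \<phi>\<^sup>2 * (w * s * \<eta>)"
    unfolding radial_div_def n gx X' s_def[symmetric]
    by (simp add: inner_diff_left inner_add_left s_def[symmetric] algebra_simps diff_divide_distrib power2_eq_square)
  have sq: "0 \<le> (norm gt)\<^sup>2 + 2 * \<phi> * w * (gt \<bullet> xt) + \<phi>\<^sup>2 * (w\<^sup>2 * X)"
  proof -
    have "0 \<le> (gt + (\<phi> * w) *\<^sub>R xt) \<bullet> (gt + (\<phi> * w) *\<^sub>R xt)" by simp
    also have "\<dots> = (norm gt)\<^sup>2 + 2 * \<phi> * w * (gt \<bullet> xt) + \<phi>\<^sup>2 * (w\<^sup>2 * X)"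
      by (simp add: X_def inner_add_left inner_add_right inner_commute[of xt gt] power2_norm_eq_inner power2_eq_square[of \<phi>] power2_eq_square[of w] algebra_simps)
    finally show ?thesis .
  qed
  \<comment> \<open>The part of \<open>w\<close> with \<open>a\<close> uses |s| / q \<le> 1 / |x|,
    the part with \<open>c\<close> a completed square; its remainder c^2 s^2 was subtracted in
    advance in \<open>weight_inequality\<close>.\<close>
  have Hs: "w * s * \<eta> \<le> a * \<bar>\<eta>\<bar> / norm x + \<eta>\<^sup>2 / 4 + c\<^sup>2 * s\<^sup>2"
  proof -
    have s_le: "\<bar>s\<bar> \<le> norm x" using Cauchy_Schwarz_ineq2[of x u] u by (simp add: s_def)
    have "a / q * s * \<eta> \<le> \<bar>a / q * s * \<eta>\<bar>" by (rule abs_ge_self)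
    also have "\<dots> = a * \<bar>\<eta>\<bar> * (\<bar>s\<bar> / q)" using a q by (simp add: abs_mult)
    also have "\<dots> \<le> a * \<bar>\<eta>\<bar> * (1 / norm x)"
    proof (cases "x = 0")
      \<comment> \<open>At the origin s = 0, and 1 / norm x is 0 by the convention for division, so
        both sides vanish.\<close>
      case True
      then show ?thesis by (simp add: s_def)
    next
      case False
      have "\<bar>s\<bar> * norm x \<le> norm x * norm x" using s_le by (intro mult_right_mono) auto
      also have "\<dots> \<le> q" using \<epsilon> by (simp add: q_def power2_norm_eq_inner[symmetric] power2_eq_square)
      finally have "\<bar>s\<bar> / q \<le> 1 / norm x" using False q by (simp add: divide_simps)
      then show ?thesis using a by (intro mult_left_mono) auto
    qed
    finally have 1: "a / q * s * \<eta> \<le> a * \<bar>\<eta>\<bar> / norm x" by simp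
    have "0 \<le> (c * s - \<eta> / 2)\<^sup>2" by simp
    then have 2: "c * s * \<eta> \<le> \<eta>\<^sup>2 / 4 + c\<^sup>2 * s\<^sup>2" by (simp add: power2_diff power_mult_distrib power_divide)
    show ?thesis using 1 2 by (simp add: w_def distrib_right)
  qed
  have W: "a\<^sup>2 / q + a * (a + 2) * s\<^sup>2 / q\<^sup>2 + c \<le> (2 * a + 2) * w - w\<^sup>2 * X - 2 * a * X / q\<^sup>2 - c\<^sup>2 * s\<^sup>2"
    unfolding w_def
    by (rule weight_inequality[OF refl a q X])
      (use \<epsilon> c in \<open>auto simp: X_def q_def power2_norm_eq_inner\<close>)
  have "a\<^sup>2 / q + a * (a + 2) * s\<^sup>2 / q\<^sup>2 + c / 2
     \<le> (2 * a + 2) * w - w\<^sup>2 * X - 2 * a * X / q\<^sup>2 - w * s * \<eta> + a * \<bar>\<eta>\<bar> / norm x + \<eta>\<^sup>2 / 4"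
    using W Hs c(1) by linarith
  then have "\<phi>\<^sup>2 * (a\<^sup>2 / q + a * (a + 2) * s\<^sup>2 / q\<^sup>2 + c / 2)
     \<le> \<phi>\<^sup>2 * ((2 * a + 2) * w - w\<^sup>2 * X - 2 * a * X / q\<^sup>2 - w * s * \<eta> + a * \<bar>\<eta>\<bar> / norm x + \<eta>\<^sup>2 / 4)"
    by (rule mult_left_mono) simp
  also have "\<dots> = a * \<bar>\<eta>\<bar> * \<phi>\<^sup>2 / norm x + 1/4 * (\<eta> * \<phi>)\<^sup>2 + \<phi>\<^sup>2 * ((2 * a + 2) * w)
      - \<phi>\<^sup>2 * (w\<^sup>2 * X) - \<phi>\<^sup>2 * (2 * a * X / q\<^sup>2) - \<phi>\<^sup>2 * (w * s * \<eta>)"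
    by (simp add: algebra_simps power_mult_distrib)
  finally show ?thesis
    unfolding w_def[symmetric] rd s_def[symmetric] gt_def[symmetric] using sq by (simp add: algebra_simps)
qed

lemma deriv_hardy_test:
  fixes \<phi> :: "'a::euclidean_space \<Rightarrow> real" and a c :: real
  assumes \<phi>: "\<And>x. (\<phi> has_derivative (\<lambda>v. g x \<bullet> v)) (at x)" "continuous_on UNIV g" and \<epsilon>: "\<epsilon> > 0"
  defines "G \<equiv> \<lambda>x. (2 * \<phi> x * (a / (x \<bullet> x + \<epsilon>) + c)) *\<^sub>R g x + (- ((\<phi> x)\<^sup>2 * (2 * a / (x \<bullet> x + \<epsilon>)\<^sup>2))) *\<^sub>R x"
  shows "((\<lambda>x. (\<phi> x)\<^sup>2 * (a / (x \<bullet> x + \<epsilon>) + c)) has_derivative (\<lambda>v. G x \<bullet> v)) (at x)" "continuous_on UNIV G"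
proof -
  have pos: "x \<bullet> x + \<epsilon> > 0" for x :: 'a using \<epsilon> by (simp add: add_nonneg_pos)
  define A where "A x = a / (x \<bullet> x + \<epsilon>)" for x :: 'a
  define A' where "A' x = 2 * a / (x \<bullet> x + \<epsilon>)\<^sup>2" for x :: 'a
  have A: "(A has_derivative (\<lambda>v. - A' x * (x \<bullet> v))) (at x)"
  proof -
    have "((\<lambda>x. x \<bullet> x + \<epsilon>) has_derivative (\<lambda>v. 2 * (x \<bullet> v))) (at x)"
      by (auto intro!: derivative_eq_intros simp: inner_commute)
    from has_derivative_divide[OF has_derivative_const[of a] this]
    show ?thesis using pos[of x]
      by (simp add: A_def[abs_def] A'_def power2_eq_square divide_inverse mult_ac)
  qed
  have "((\<lambda>x. (\<phi> x)\<^sup>2 * (A x + c)) has_derivative (\<lambda>v. ((2 * \<phi> x * (A x + c)) *\<^sub>R g x + (- ((\<phi> x)\<^sup>2 * A' x)) *\<^sub>R x) \<bullet> v)) (at x)"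
    by (rule derivative_eq_intros \<phi>(1) A refl | simp add: inner_add_left inner_diff_left algebra_simps fun_eq_iff)+
  then show "((\<lambda>x. (\<phi> x)\<^sup>2 * (a / (x \<bullet> x + \<epsilon>) + c)) has_derivative (\<lambda>v. G x \<bullet> v)) (at x)"
    by (simp only: G_def A_def A'_def)
  have c\<phi>: "continuous_on UNIV \<phi>"
    using \<phi>(1) by (meson continuous_at_imp_continuous_on has_derivative_continuous)
  show "continuous_on UNIV G"
    unfolding G_def using pos by (intro continuous_intros c\<phi> \<phi>(2)) (auto simp: less_imp_neq[symmetric] dest: less_imp_neq)
qed

lemma cmult_set_nn_integral:
  assumes f: "\<And>x. 0 \<le> f x" and k: "0 \<le> k" and m: "(\<lambda>x. indicator M x * f x) \<in> borel_measurable \<mu>"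
  shows "ennreal k * (\<integral>\<^sup>+x\<in>M. ennreal (f x) \<partial>\<mu>) = (\<integral>\<^sup>+x. ennreal (k * (indicator M x * f x)) \<partial>\<mu>)"
proof -
  have "(\<integral>\<^sup>+x\<in>M. ennreal (f x) \<partial>\<mu>) = (\<integral>\<^sup>+x. ennreal (indicator M x * f x) \<partial>\<mu>)"
    by (rule nn_integral_cong) (simp split: split_indicator)
  also have "ennreal k * \<dots> = (\<integral>\<^sup>+x. ennreal k * ennreal (indicator M x * f x) \<partial>\<mu>)"
    by (rule nn_integral_cmult[symmetric]) (use m in measurable)
  also have "\<dots> = (\<integral>\<^sup>+x. ennreal (k * (indicator M x * f x)) \<partial>\<mu>)"
    using k by (simp add: ennreal_mult')
  finally show ?thesis .
qed

section \<open>Passage to the singular weights\<close>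

theorem theorem1p6:
  fixes M :: "'a::euclidean_space set" and \<nu> :: "'a \<Rightarrow> 'a"
    and \<phi> :: "'a \<Rightarrow> real" and r :: real and n :: nat
  defines "n \<equiv> DIM('a) - 1"
  assumes "n \<ge> 2"
    and "smooth_hypersurface M"
    and "unit_normal_field M \<nu>"
    and "r > 0"
    and "Ck_on 1 UNIV \<phi>"
    and "\<exists>K. compact K \<and> K \<subseteq> M \<inter> ball 0 r \<and> (\<forall>x\<in>M - K. \<phi> x = 0)"
  shows
   "ennreal ((real n - 2)^2 / 4) *
        (\<integral>\<^sup>+ x\<in>M. ennreal ((\<phi> x)^2 / (norm x)^2) \<partial>hausdorff_measure n)
    + ennreal ((real n ^ 2 - 4) / 4) *
        (\<integral>\<^sup>+ x\<in>M. ennreal (((x /\<^sub>R norm x) \<bullet> \<nu> x)^2 * (\<phi> x)^2 / (norm x)^2) \<partial>hausdorff_measure n)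
    + ennreal (1 / (2 * r^2)) *
        (\<integral>\<^sup>+ x\<in>M. ennreal ((\<phi> x)^2) \<partial>hausdorff_measure n)
    \<le> (\<integral>\<^sup>+ x\<in>M. ennreal ((norm (tgrad \<nu> \<phi> x))^2
            + (real n - 2) / 2 * \<bar>mean_curv M \<nu> x\<bar> * (\<phi> x)^2 / norm x
            + 1/4 * (mean_curv M \<nu> x * \<phi> x)^2) \<partial>hausdorff_measure n)"
proof -
  note n2 = assms(2) and M = assms(3) and \<nu> = assms(4) and r = assms(5) and C1 = assms(6)
  have d: "n = DIM('a) - 1" "n > 0" using n2 by (auto simp: n_def)
  let ?\<mu> = "hausdorff_measure n :: 'a measure"
  show ?thesis
    using hausdorff_measure_null_or_borel[OF d]
  proof
    assume "\<forall>f. (\<integral>\<^sup>+x. f x \<partial>?\<mu>) = 0"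
    then show ?thesis by simp
  next
    assume borel: "hausdorff_borel ?\<mu> n"
    then interpret hausdorff_borel ?\<mu> n .
    obtain K where K: "compact K" "K \<subseteq> M" "K \<subseteq> ball 0 r" "\<And>x. x \<in> M - K \<Longrightarrow> \<phi> x = 0"
      using assms(7) by blast
    define \<eta> where "\<eta> = mean_curv M \<nu>"
    define a where "a = (real n - 2) / 2"
    define c where "c = 1 / r\<^sup>2"
    have a0: "a \<ge> 0" using n2 by (simp add: a_def)
    have c0: "c \<ge> 0" by (simp add: c_def)
    have na: "real DIM('a) - 1 = 2 * a + 2"
    proof -
      have "real DIM('a) = real n + 1" using d by simp
      then show ?thesis by (simp add: a_def field_simps)
    qed
    note g = Ck_on_1_grad[OF C1]
    have \<nu>1: "norm (\<nu> x) = 1" if "x \<in> M" for x using \<nu> that by (auto simp: unit_normal_field_def)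
    have Mb: "M \<in> sets borel" by (rule hypersurface_borel[OF M])
    have c\<nu>: "continuous_on M \<nu>" using \<nu> by (simp add: unit_normal_field_def)
    have c\<eta>: "continuous_on M \<eta>" unfolding \<eta>_def by (rule continuous_on_mean_curv[OF M \<nu>])
    have c\<phi>: "continuous_on UNIV \<phi>"
      using g(1) by (meson continuous_at_imp_continuous_on has_derivative_continuous)
    have bm: "(\<lambda>x. indicator M x * k x) \<in> borel_measurable borel" if "continuous_on M k" for k :: "'a \<Rightarrow> real"
      using borel_measurable_continuous_on_indicator[OF Mb that] by simp
    note [measurable] = Mb borel_measurable_continuous_onI[OF c\<phi>]
    note [measurable_cong] = sets_\<mu>
    define R where "R x = (norm (tgrad \<nu> \<phi> x))\<^sup>2 + a * \<bar>\<eta> x\<bar> * (\<phi> x)\<^sup>2 / norm x + 1/4 * (\<eta> x * \<phi> x)\<^sup>2" for x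
    \<comment> \<open>The indicator is built in because \<nu> is controlled only on M; this makes
      \<open>S\<close> Borel on the whole space.\<close>
    define S where "S x = indicator M x * (x \<bullet> \<nu> x)\<^sup>2" for x
    have S[measurable]: "S \<in> borel_measurable borel"
      unfolding S_def[abs_def] by (intro bm continuous_intros c\<nu>)
    have R0: "R x \<ge> 0" for x using a0 by (simp add: R_def)
    \<comment> \<open>Division by norm x breaks continuity at the origin, so this summand is split
      off and treated as a product of measurable functions.\<close>
    have Rm[measurable]: "(\<lambda>x. indicator M x * R x) \<in> borel_measurable borel"
    proof -
      have "(\<lambda>x. indicator M x * ((norm (tgrad \<nu> \<phi> x))\<^sup>2 + 1/4 * (\<eta> x * \<phi> x)\<^sup>2)) \<in> borel_measurable borel"
        unfolding tgrad_def
        by (intro bm continuous_intros c\<nu> c\<eta> continuous_on_subset[OF c\<phi>] continuous_on_subset[OF g(2)]) auto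
      moreover have "(\<lambda>x. indicator M x * \<bar>\<eta> x\<bar>) \<in> borel_measurable borel"
        by (intro bm continuous_intros c\<eta>)
      ultimately have "(\<lambda>x. indicator M x * ((norm (tgrad \<nu> \<phi> x))\<^sup>2 + 1/4 * (\<eta> x * \<phi> x)\<^sup>2)
          + (indicator M x * \<bar>\<eta> x\<bar>) * (a * (\<phi> x)\<^sup>2 / norm x)) \<in> borel_measurable borel"
        by measurable
      then show ?thesis by (simp add: R_def algebra_simps)
    qed
    define L where "L \<epsilon> x = (\<phi> x)\<^sup>2 * (a\<^sup>2 / (x \<bullet> x + \<epsilon>) + a * (a + 2) * S x / (x \<bullet> x + \<epsilon>)\<^sup>2 + c / 2)" for \<epsilon> x
    define I where "I = (\<integral>\<^sup>+x. ennreal (indicator M x * R x) \<partial>?\<mu>)"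
    have L0: "L \<epsilon> x \<ge> 0" if "\<epsilon> > 0" for \<epsilon> x
    proof -
      have "0 < x \<bullet> x + \<epsilon>" using that by (simp add: add_nonneg_pos)
      then show ?thesis using a0 c0 by (simp add: L_def S_def)
    qed
    have step: "(\<integral>\<^sup>+x. ennreal (indicator M x * L \<epsilon> x) \<partial>?\<mu>) \<le> I" if \<epsilon>: "\<epsilon> > 0" for \<epsilon>
    \<comment> \<open>If the right-hand side is infinite nothing is to show; otherwise
      \<open>R\<close> is integrable and the vanishing integral of \<open>radial_div\<close> may be
      added to it.\<close>
    proof (cases "I = \<infinity>")
      case False
      define \<psi> where "\<psi> x = (\<phi> x)\<^sup>2 * (a / (x \<bullet> x + \<epsilon>) + c)" for x
      define G where "G x = (2 * \<phi> x * (a / (x \<bullet> x + \<epsilon>) + c)) *\<^sub>R grad \<phi> x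
        + (- ((\<phi> x)\<^sup>2 * (2 * a / (x \<bullet> x + \<epsilon>)\<^sup>2))) *\<^sub>R x" for x
      have \<psi>': "(\<psi> has_derivative (\<lambda>v. G x \<bullet> v)) (at x)" "continuous_on UNIV G" for x
        unfolding \<psi>_def[abs_def] G_def[abs_def] by (rule deriv_hardy_test[OF g \<epsilon>])+
      have F: "integrable ?\<mu> (\<lambda>x. indicator M x * radial_div \<nu> \<eta> \<psi> G x)"
        "(\<integral>x. indicator M x * radial_div \<nu> \<eta> \<psi> G x \<partial>?\<mu>) = 0"
        using hypersurface_integral_radial_div[OF borel M \<nu> K(1,2) \<psi>'] K(4)
        unfolding \<eta>_def by (simp_all add: \<psi>_def G_def)
      have pw: "L \<epsilon> x \<le> R x + radial_div \<nu> \<eta> \<psi> G x" if x: "x \<in> M" for x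
      \<comment> \<open>c |x|^2 \<le> 1 holds on \<open>K\<close>, which lies in the ball of radius
        r. Elsewhere on M, \<phi> vanishes and with it both \<psi> and \<open>G\<close>.\<close>
      proof (cases "x \<in> K")
        case True
        then have "norm x < r" using K(3) by auto
        then have "x \<bullet> x \<le> r\<^sup>2" unfolding dot_square_norm by (intro power_mono) auto
        then have "c * (x \<bullet> x) \<le> 1" using r by (simp add: c_def)
        from hardy_pointwise[OF na a0 \<epsilon> \<nu>1[OF x] c0 this, of "\<phi> x" "grad \<phi> x" "\<eta> x"]
        show ?thesis using x
          by (simp add: L_def S_def R_def tgrad_def radial_div_def \<psi>_def G_def)
      next
        case False
        then have "\<phi> x = 0" using K(4) x by blast
        then show ?thesis using R0[of x] by (simp add: L_def radial_div_def \<psi>_def G_def)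
      qed
      have Ri: "integrable ?\<mu> (\<lambda>x. indicator M x * R x)"
      proof (rule integrableI_bounded)
        show "(\<integral>\<^sup>+x. ennreal (norm (indicator M x * R x)) \<partial>?\<mu>) < \<infinity>"
          using False R0 by (simp add: I_def abs_mult less_top)
      qed measurable
      have sum: "integrable ?\<mu> (\<lambda>x. indicator M x * R x + indicator M x * radial_div \<nu> \<eta> \<psi> G x)"
        using Ri F(1) by (rule Bochner_Integration.integrable_add)
      have ge: "indicator M x * L \<epsilon> x \<le> indicator M x * R x + indicator M x * radial_div \<nu> \<eta> \<psi> G x" for x
        using pw[of x] by (simp split: split_indicator)
      have nn: "0 \<le> indicator M x * L \<epsilon> x" for x using L0[OF \<epsilon>] by simp
      have "(\<integral>\<^sup>+x. ennreal (indicator M x * L \<epsilon> x) \<partial>?\<mu>)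
        \<le> (\<integral>\<^sup>+x. ennreal (indicator M x * R x + indicator M x * radial_div \<nu> \<eta> \<psi> G x) \<partial>?\<mu>)"
        using ge by (intro nn_integral_mono ennreal_leI)
      also have "\<dots> = ennreal (\<integral>x. indicator M x * R x + indicator M x * radial_div \<nu> \<eta> \<psi> G x \<partial>?\<mu>)"
        by (rule nn_integral_eq_integral[OF sum]) (use order_trans[OF nn ge] in auto)
      also have "(\<integral>x. indicator M x * R x + indicator M x * radial_div \<nu> \<eta> \<psi> G x \<partial>?\<mu>) = (\<integral>x. indicator M x * R x \<partial>?\<mu>)"
        using Bochner_Integration.integral_add[OF Ri F(1)] F(2) by simp
      also have "ennreal \<dots> = I"
        unfolding I_def by (rule nn_integral_eq_integral[OF Ri, symmetric]) (use R0 in auto)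
      finally show ?thesis .
    qed simp
    define L' where "L' x = a\<^sup>2 * (indicator M x * ((\<phi> x)\<^sup>2 / (norm x)\<^sup>2))
       + a * (a + 2) * (indicator M x * (((x /\<^sub>R norm x) \<bullet> \<nu> x)\<^sup>2 * (\<phi> x)\<^sup>2 / (norm x)\<^sup>2))
       + c / 2 * (indicator M x * (\<phi> x)\<^sup>2)" for x
    \<comment> \<open>At the origin division by zero drops the singular terms from
      \<open>L'\<close>, so there only an inequality holds; away from it the regularised weights
      converge.\<close>
    have lim: "ennreal (L' x) \<le> liminf (\<lambda>k. ennreal (indicator M x * L (1 / real (Suc k)) x))" for x
    proof (cases "x = 0")
      case True
      have "ennreal (L' x) \<le> ennreal (indicator M x * L (1 / real (Suc k)) x)" for k
      proof (intro ennreal_leI, cases "x \<in> M")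
        assume "x \<in> M"
        have "(\<phi> x)\<^sup>2 * (c / 2) \<le> (\<phi> x)\<^sup>2 * (a\<^sup>2 / (1 / real (Suc k)) + c / 2)"
          by (intro mult_left_mono) auto
        then show "L' x \<le> indicator M x * L (1 / real (Suc k)) x"
          using True \<open>x \<in> M\<close> by (simp add: L'_def L_def S_def mult.commute)
      qed (simp add: L'_def)
      then show ?thesis by (intro Liminf_bounded always_eventually) auto
    next
      case False
      have t: "(\<lambda>k. 1 / real (Suc k)) \<longlonglongrightarrow> 0"
        using LIMSEQ_inverse_real_of_nat by (simp add: inverse_eq_divide)
      have "(\<lambda>k. indicator M x * L (1 / real (Suc k)) x) \<longlonglongrightarrow> indicator M x * L 0 x"
        unfolding L_def by (intro tendsto_intros t) (use False in auto)
      moreover have "indicator M x * L 0 x = L' x"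
      proof -
        have "((x /\<^sub>R norm x) \<bullet> \<nu> x)\<^sup>2 * (\<phi> x)\<^sup>2 / (norm x)\<^sup>2 = (\<phi> x)\<^sup>2 * (x \<bullet> \<nu> x)\<^sup>2 / ((norm x)\<^sup>2)\<^sup>2"
          by (simp add: divide_inverse power_mult_distrib power2_eq_square)
        then show ?thesis
          by (simp add: L_def L'_def S_def dot_square_norm distrib_left mult_ac split: split_indicator)
      qed
      ultimately have "(\<lambda>k. ennreal (indicator M x * L (1 / real (Suc k)) x)) \<longlonglongrightarrow> ennreal (L' x)"
        by (simp add: tendsto_ennrealI)
      then show ?thesis by (simp add: lim_imp_Liminf)
    qed
    have m1: "(\<lambda>x. indicator M x * ((\<phi> x)\<^sup>2 / (norm x)\<^sup>2)) \<in> borel_measurable ?\<mu>" by measurable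
    have m2: "(\<lambda>x. indicator M x * (((x /\<^sub>R norm x) \<bullet> \<nu> x)\<^sup>2 * (\<phi> x)\<^sup>2 / (norm x)\<^sup>2)) \<in> borel_measurable ?\<mu>"
    proof -
      have "(\<lambda>x. S x / (norm x)\<^sup>2 * (\<phi> x)\<^sup>2 / (norm x)\<^sup>2) \<in> borel_measurable ?\<mu>" by measurable
      also have "(\<lambda>x. S x / (norm x)\<^sup>2 * (\<phi> x)\<^sup>2 / (norm x)\<^sup>2)
         = (\<lambda>x. indicator M x * (((x /\<^sub>R norm x) \<bullet> \<nu> x)\<^sup>2 * (\<phi> x)\<^sup>2 / (norm x)\<^sup>2))"
        by (simp add: S_def fun_eq_iff divide_inverse power_mult_distrib mult_ac power_inverse)
      finally show ?thesis .
    qed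
    have m3: "(\<lambda>x. indicator M x * (\<phi> x)\<^sup>2) \<in> borel_measurable ?\<mu>" by measurable
    have coef: "(real n - 2)\<^sup>2 / 4 = a\<^sup>2" "((real n)\<^sup>2 - 4) / 4 = a * (a + 2)" "1 / (2 * r\<^sup>2) = c / 2"
      by (simp_all add: a_def c_def field_simps power2_eq_square)
    have a2: "a * (a + 2) \<ge> 0" "a\<^sup>2 \<ge> 0" "c / 2 \<ge> 0" using a0 c0 by auto
    have "?thesis \<longleftrightarrow> (\<integral>\<^sup>+x. ennreal (L' x) \<partial>?\<mu>) \<le> I"
    proof -
      have Ieq: "(\<integral>\<^sup>+ x\<in>M. ennreal ((norm (tgrad \<nu> \<phi> x))^2
            + (real n - 2) / 2 * \<bar>mean_curv M \<nu> x\<bar> * (\<phi> x)^2 / norm x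
            + 1/4 * (mean_curv M \<nu> x * \<phi> x)^2) \<partial>?\<mu>) = I"
        unfolding I_def R_def \<eta>_def a_def
        by (rule nn_integral_cong) (simp split: split_indicator)
      let ?f1 = "\<lambda>x. a\<^sup>2 * (indicator M x * ((\<phi> x)\<^sup>2 / (norm x)\<^sup>2))"
      let ?f2 = "\<lambda>x. a * (a + 2) * (indicator M x * (((x /\<^sub>R norm x) \<bullet> \<nu> x)\<^sup>2 * (\<phi> x)\<^sup>2 / (norm x)\<^sup>2))"
      let ?f3 = "\<lambda>x. c / 2 * (indicator M x * (\<phi> x)\<^sup>2)"
      have f0: "0 \<le> ?f1 x" "0 \<le> ?f2 x" "0 \<le> ?f3 x" for x
        by (intro mult_nonneg_nonneg a2 divide_nonneg_nonneg zero_le_power2 indicator_pos_le)+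
      have L'eq: "ennreal (L' x) = ennreal (?f1 x) + ennreal (?f2 x) + ennreal (?f3 x)" for x
        unfolding L'_def using f0[of x] by (simp only: ennreal_plus add_nonneg_nonneg)
      have fm: "(\<lambda>x. ennreal (?f1 x)) \<in> borel_measurable ?\<mu>" "(\<lambda>x. ennreal (?f2 x)) \<in> borel_measurable ?\<mu>"
        "(\<lambda>x. ennreal (?f3 x)) \<in> borel_measurable ?\<mu>"
        by (intro measurable_compose[OF _ measurable_ennreal] borel_measurable_times borel_measurable_const m1 m2 m3)+
      have Leq: "(\<integral>\<^sup>+x. ennreal (L' x) \<partial>?\<mu>)
         = (\<integral>\<^sup>+x. ennreal (?f1 x) \<partial>?\<mu>) + (\<integral>\<^sup>+x. ennreal (?f2 x) \<partial>?\<mu>) + (\<integral>\<^sup>+x. ennreal (?f3 x) \<partial>?\<mu>)"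
        unfolding L'eq by (simp only: nn_integral_add borel_measurable_add fm)
      show ?thesis
        unfolding Ieq Leq coef
          cmult_set_nn_integral[OF divide_nonneg_nonneg[OF zero_le_power2 zero_le_power2] a2(2) m1]
          cmult_set_nn_integral[OF divide_nonneg_nonneg[OF mult_nonneg_nonneg[OF zero_le_power2 zero_le_power2] zero_le_power2] a2(1) m2]
          cmult_set_nn_integral[OF zero_le_power2 a2(3) m3] ..
    qed
    moreover have "(\<integral>\<^sup>+x. ennreal (L' x) \<partial>?\<mu>) \<le> I"
    proof -
      have "(\<integral>\<^sup>+x. ennreal (L' x) \<partial>?\<mu>) \<le> (\<integral>\<^sup>+x. liminf (\<lambda>k. ennreal (indicator M x * L (1 / real (Suc k)) x)) \<partial>?\<mu>)"
        by (intro nn_integral_mono lim)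
      also have "\<dots> \<le> liminf (\<lambda>k. \<integral>\<^sup>+x. ennreal (indicator M x * L (1 / real (Suc k)) x) \<partial>?\<mu>)"
        unfolding L_def by (rule nn_integral_liminf) measurable
      also have "\<dots> \<le> liminf (\<lambda>k::nat. I)"
        by (intro Liminf_mono always_eventually allI step) simp
      also have "\<dots> = I" by (rule Liminf_const) simp
      finally show ?thesis .
    qed
    ultimately show ?thesis by blast
  qed
qed

end
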